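(* For a given initial datum $u_0\in L^1_{loc}(\Omega;\nu)$, there exists at most one weak solution $u$ of the Dirichlet problem (D) satisfying the following additional hypotheses: $$u^m\in L^{\frac{m+1}{m}}\left((0,T);V_0^{\frac{m+1}{m}}(\Omega;\nu,\mu)\right),\qquad\nabla(u^m)\in L^2\left((0,T);[L^2(\Omega;\mu)]^N\right)\qquad\forall T>0 .$$
   Context: $m>1$ is fixed, and for $q>0$, $x\in\mathbb{R}$ one sets $x^q:=|x|^q\operatorname{sign}(x)$. $\Omega\subseteq\mathbb{R}^N$ is a domain ($\Omega=\mathbb{R}^N$ allowed). $\rho_\nu,\rho_\mu$ are measurable weights, positive a.e. in $\Omega$, with $\rho_\nu,\rho_\mu\in L^1_{loc}(\Omega)$ and $\rho_\mu^{-1}\in L^1_{loc}(\Omega)$; $\mathrm{d}\nu=\rho_\nu\,\mathrm{d}\mathbf{x}$, $\mathrm{d}\mu=\rho_\mu\,\mathrm{d}\mathbf{x}$; $\|\cdot\|_{p;\nu}$, $\|\cdot\|_{p;\mu}$ are the norms of $L^p(\Omega;\nu)$, $L^p(\Omega;\mu)$. Spaces. For $p\in[1,\infty)$, $V^p_0(\Omega;\nu,\mu)$ is the closure of $C^\infty_c(\Omega)$ with respect to the norm $\|\varphi\|_{p;\nu}+\|\nabla\varphi\|_{2;\mu}$. $V_0(\Omega;\mu)$ is the space of all $v\in W^{1,1}_{loc}(\Omega)$ with $\nabla v\in L^2(\Omega;\mu)$ for which there is a sequence $\{\varphi_n\}\subset C^\infty_c(\Omega)$ with $\|\nabla v-\nabla\varphi_n\|_{2;\mu}\to0$.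 Dirichlet problem (D): $\rho_\nu u_t=\operatorname{div}(\rho_\mu\nabla(u^m))$ in $\Omega\times(0,\infty)$, $u=0$ on $\partial\Omega\times(0,\infty)$, $u(\cdot,0)=u_0$ in $\Omega$. Weak solution of (D) with initial datum $u_0\in L^1_{loc}(\Omega;\nu)$: a function $u$ with $u\in L^1((0,T);L^1_{loc}(\Omega;\nu))$, $u^m(t)\in V_0(\Omega;\mu)$ for a.e. $t>0$, $\nabla(u^m)\in L^1((0,T);[L^2(\Omega;\mu)]^N)$ for all $T>0$, and (for every $T>0$) $$\int_0^T\!\!\int_\Omega u\,\eta_t\,\mathrm{d}\nu\,\mathrm{d}t=-\int_\Omega u_0(\mathbf{x})\eta(\mathbf{x},0)\,\mathrm{d}\nu+\int_0^T\!\!\int_\Omega\nabla(u^m)\cdot\nabla\eta\,\mathrm{d}\mu\,\mathrm{d}t$$ for all $\eta\in C^1(\Omega\times[0,T])$ with $\operatorname{supp}\eta(\cdot,t)\Subset\Omega$ for all $t\in[0,T]$ and $\eta(\mathbf{x},T)=0$ for all $\mathbf{x}\in\Omega$. *)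

theory Defs
  imports "HOL-Analysis.Analysis"
begin

text \<open>Elements of Lebesgue, Sobolev and Bochner spaces are represented by functions, not by
  equivalence classes. Only the values on \<open>\<Omega>\<close> matter.\<close>

definition spow :: "real \<Rightarrow> real \<Rightarrow> real" where
  "spow x q = \<bar>x\<bar> powr q * sgn x"

definition weighted :: "'a::euclidean_space set \<Rightarrow> ('a \<Rightarrow> real) \<Rightarrow> 'a measure" where
  "weighted \<Omega> \<rho> = density (lebesgue_on \<Omega>) (\<lambda>x. ennreal (\<rho> x))"

definition L1_loc ::
    "'a::euclidean_space set \<Rightarrow> 'a measure \<Rightarrow> ('a \<Rightarrow> 'b::{banach, second_countable_topology}) set" where
  "L1_loc \<Omega> M = {f. \<forall>K. compact K \<and> K \<subseteq> \<Omega> \<longrightarrow> set_integrable M K f}"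

definition Lp :: "real \<Rightarrow> 'a measure \<Rightarrow> ('a \<Rightarrow> 'b::{banach, second_countable_topology}) set" where
  "Lp p M = {f \<in> borel_measurable M. integrable M (\<lambda>x. norm (f x) powr p)}"

text \<open>Meaningful only for \<open>f \<in> Lp p M\<close>: the integral of a non-integrable function is \<open>0\<close>.\<close>

definition Lp_norm :: "real \<Rightarrow> 'a measure \<Rightarrow> ('a \<Rightarrow> 'b::{banach, second_countable_topology}) \<Rightarrow> real" where
  "Lp_norm p M f = (LINT x|M. norm (f x) powr p) powr (1 / p)"


subsection \<open>Test functions and gradients\<close>

definition grad :: "('a::euclidean_space \<Rightarrow> real) \<Rightarrow> 'a \<Rightarrow> 'a" where
  "grad f x = (\<Sum>b\<in>Basis. frechet_derivative f (at x) b *\<^sub>R b)"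

primrec Ck :: "nat \<Rightarrow> ('a::euclidean_space \<Rightarrow> real) \<Rightarrow> bool" where
  "Ck 0 f \<longleftrightarrow> continuous_on UNIV f"
| "Ck (Suc k) f \<longleftrightarrow>
     (\<forall>x. f differentiable (at x)) \<and> (\<forall>v. Ck k (\<lambda>x. frechet_derivative f (at x) v))"

text \<open>\<open>C\<^sub>c\<^sup>\<infinity>(\<Omega>)\<close>, for open \<open>\<Omega>\<close>; its elements are extended by \<open>0\<close> to the whole space.\<close>

definition test_functions :: "'a::euclidean_space set \<Rightarrow> ('a \<Rightarrow> real) set" where
  "test_functions \<Omega> =
     {\<phi>. (\<forall>k. Ck k \<phi>) \<and> compact (closure {x. \<phi> x \<noteq> 0}) \<and> closure {x. \<phi> x \<noteq> 0} \<subseteq> \<Omega>}"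

definition is_weak_grad :: "'a::euclidean_space set \<Rightarrow> ('a \<Rightarrow> real) \<Rightarrow> ('a \<Rightarrow> 'a) \<Rightarrow> bool" where
  "is_weak_grad \<Omega> v w \<longleftrightarrow>
     v \<in> L1_loc \<Omega> (lebesgue_on \<Omega>) \<and> w \<in> L1_loc \<Omega> (lebesgue_on \<Omega>) \<and>
     (\<forall>\<phi>\<in>test_functions \<Omega>.
        (LINT x|lebesgue_on \<Omega>. v x *\<^sub>R grad \<phi> x) = - (LINT x|lebesgue_on \<Omega>. \<phi> x *\<^sub>R w x))"

definition W11_loc :: "'a::euclidean_space set \<Rightarrow> ('a \<Rightarrow> real) set" where
  "W11_loc \<Omega> = {v. \<exists>w. is_weak_grad \<Omega> v w}"

text \<open>The weak gradient is determined up to a null set; \<open>wgrad\<close> picks one representative, and is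
  meaningful only on \<open>W11_loc \<Omega>\<close>.\<close>

definition wgrad :: "'a::euclidean_space set \<Rightarrow> ('a \<Rightarrow> real) \<Rightarrow> 'a \<Rightarrow> 'a" where
  "wgrad \<Omega> v = (SOME w. is_weak_grad \<Omega> v w)"


subsection \<open>Energy spaces\<close>

definition V_norm :: "real \<Rightarrow> 'a::euclidean_space set \<Rightarrow> 'a measure \<Rightarrow> 'a measure \<Rightarrow> ('a \<Rightarrow> real) \<Rightarrow> real" where
  "V_norm p \<Omega> \<nu> \<mu> v = Lp_norm p \<nu> v + Lp_norm 2 \<mu> (wgrad \<Omega> v)"

text \<open>The closure of \<open>C\<^sub>c\<^sup>\<infinity>(\<Omega>)\<close> is taken inside the functions for which the norm is defined and finite.
  When the weights are positive and \<open>\<rho>\<^sub>\<mu>\<^sup>-\<^sup>1\<close> is locally integrable, no limit of a Cauchy sequence of test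
  functions is lost in this way.\<close>

definition V0p :: "real \<Rightarrow> 'a::euclidean_space set \<Rightarrow> 'a measure \<Rightarrow> 'a measure \<Rightarrow> ('a \<Rightarrow> real) set" where
  "V0p p \<Omega> \<nu> \<mu> =
     {v \<in> W11_loc \<Omega>. v \<in> Lp p \<nu> \<and> wgrad \<Omega> v \<in> Lp 2 \<mu> \<and>
        (\<exists>\<phi>::nat \<Rightarrow> 'a \<Rightarrow> real. range \<phi> \<subseteq> test_functions \<Omega> \<and>
           (\<lambda>n. V_norm p \<Omega> \<nu> \<mu> (\<lambda>x. v x - \<phi> n x)) \<longlonglongrightarrow> 0)}"

definition V0 :: "'a::euclidean_space set \<Rightarrow> 'a measure \<Rightarrow> ('a \<Rightarrow> real) set" where
  "V0 \<Omega> \<mu> =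
     {v \<in> W11_loc \<Omega>. wgrad \<Omega> v \<in> Lp 2 \<mu> \<and>
        (\<exists>\<phi>::nat \<Rightarrow> 'a \<Rightarrow> real. range \<phi> \<subseteq> test_functions \<Omega> \<and>
           (\<lambda>n. Lp_norm 2 \<mu> (\<lambda>x. wgrad \<Omega> v x - grad (\<phi> n) x)) \<longlonglongrightarrow> 0)}"


subsection \<open>Bochner spaces\<close>

text \<open>\<open>L\<^sup>p((0,T); X)\<close> for a space \<open>X\<close> of functions with seminorm \<open>N\<close>: strong measurability, i.e. almost
  everywhere approximability by \<open>X\<close>-valued simple functions, together with integrability of
  \<open>t \<mapsto> N (f t) powr p\<close>.\<close>

definition Bochner ::
    "real \<Rightarrow> real \<Rightarrow> ('a \<Rightarrow> 'b::real_normed_vector) set \<Rightarrow> (('a \<Rightarrow> 'b) \<Rightarrow> real) \<Rightarrow> (real \<Rightarrow> 'a \<Rightarrow> 'b) set" where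
  "Bochner p T X N =
     {f. (AE t in lebesgue_on {0<..<T}. f t \<in> X) \<and>
         (\<exists>s::nat \<Rightarrow> real \<Rightarrow> 'a \<Rightarrow> 'b.
            (\<forall>n. simple_function (lebesgue_on {0<..<T}) (s n) \<and> s n ` {0<..<T} \<subseteq> X) \<and>
            (AE t in lebesgue_on {0<..<T}. (\<lambda>n. N (\<lambda>x. s n t x - f t x)) \<longlonglongrightarrow> 0)) \<and>
         integrable (lebesgue_on {0<..<T}) (\<lambda>t. N (f t) powr p)}"

text \<open>\<open>L\<^sup>1((0,T); L\<^sup>1\<^sub>l\<^sub>o\<^sub>c(\<Omega>; M))\<close>, the topology of \<open>L\<^sup>1\<^sub>l\<^sub>o\<^sub>c\<close> being given by the \<open>L\<^sup>1(K; M)\<close> seminorms.\<close>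

definition Bochner_L1_loc ::
    "real \<Rightarrow> 'a::euclidean_space set \<Rightarrow> 'a measure \<Rightarrow> (real \<Rightarrow> 'a \<Rightarrow> real) set" where
  "Bochner_L1_loc T \<Omega> M =
     {u. \<forall>K. compact K \<and> K \<subseteq> \<Omega> \<longrightarrow>
            u \<in> Bochner 1 T (Lp 1 (restrict_space M K)) (Lp_norm 1 (restrict_space M K))}"


subsection \<open>Weak solutions\<close>

text \<open>\<open>\<eta> \<in> C\<^sup>1(\<Omega> \<times> [0,T])\<close>, with one-sided time derivatives at \<open>t = 0\<close> and \<open>t = T\<close>.\<close>

definition time_test_functions ::
    "'a::euclidean_space set \<Rightarrow> real \<Rightarrow> ('a \<times> real \<Rightarrow> real) set" where
  "time_test_functions \<Omega> T =
     {\<eta>. (\<exists>D. (\<forall>z\<in>\<Omega> \<times> {0..T}. (\<eta> has_derivative blinfun_apply (D z)) (at z within \<Omega> \<times> {0..T})) \<and>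
              continuous_on (\<Omega> \<times> {0..T}) D) \<and>
         (\<forall>t\<in>{0..T}. compact (closure {x \<in> \<Omega>. \<eta> (x, t) \<noteq> 0}) \<and>
                     closure {x \<in> \<Omega>. \<eta> (x, t) \<noteq> 0} \<subseteq> \<Omega>) \<and>
         (\<forall>x\<in>\<Omega>. \<eta> (x, T) = 0)}"

definition dt :: "('a \<times> real \<Rightarrow> real) \<Rightarrow> real \<Rightarrow> 'a \<Rightarrow> real" where
  "dt \<eta> t x = vector_derivative (\<lambda>s. \<eta> (x, s)) (at t)"

definition dx :: "('a::euclidean_space \<times> real \<Rightarrow> real) \<Rightarrow> real \<Rightarrow> 'a \<Rightarrow> 'a" where
  "dx \<eta> t x = grad (\<lambda>y. \<eta> (y, t)) x"

definition abs_convergent :: "real \<Rightarrow> 'a measure \<Rightarrow> (real \<Rightarrow> 'a \<Rightarrow> real) \<Rightarrow> bool" where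
  "abs_convergent T M f \<longleftrightarrow>
     (\<integral>\<^sup>+ t. (\<integral>\<^sup>+ x. ennreal \<bar>f t x\<bar> \<partial>M) \<partial>lebesgue_on {0<..<T}) < \<infinity>"

text \<open>The supports of the slices \<open>\<eta>(\<cdot>,t)\<close> are compact for each \<open>t\<close>, but their union over \<open>t\<close> need not be
  relatively compact in \<open>\<Omega>\<close>, and then the double integrals may diverge. The integral identity is
  therefore required exactly for those \<open>\<eta>\<close> for which they converge absolutely; this is automatic if the
  supports stay in a fixed compact subset of \<open>\<Omega>\<close>.\<close>

definition weak_solution ::
    "real \<Rightarrow> 'a::euclidean_space set \<Rightarrow> ('a \<Rightarrow> real) \<Rightarrow> ('a \<Rightarrow> real) \<Rightarrow> ('a \<Rightarrow> real) \<Rightarrow>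
     (real \<Rightarrow> 'a \<Rightarrow> real) \<Rightarrow> bool" where
  "weak_solution m \<Omega> \<rho>\<^sub>\<nu> \<rho>\<^sub>\<mu> u\<^sub>0 u \<longleftrightarrow>
     (let \<nu> = weighted \<Omega> \<rho>\<^sub>\<nu>; \<mu> = weighted \<Omega> \<rho>\<^sub>\<mu>;
          um = (\<lambda>t x. spow (u t x) m); Dum = (\<lambda>t. wgrad \<Omega> (um t))
      in (AE t in lebesgue_on {0<..}. um t \<in> V0 \<Omega> \<mu>) \<and>
         (\<forall>T>0.
            u \<in> Bochner_L1_loc T \<Omega> \<nu> \<and>
            Dum \<in> Bochner 1 T (Lp 2 \<mu>) (Lp_norm 2 \<mu>) \<and>
            (\<forall>\<eta>\<in>time_test_functions \<Omega> T.
               abs_convergent T \<nu> (\<lambda>t x. u t x * dt \<eta> t x) \<and>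
               abs_convergent T \<mu> (\<lambda>t x. Dum t x \<bullet> dx \<eta> t x) \<longrightarrow>
               (LINT t|lebesgue_on {0<..<T}. LINT x|\<nu>. u t x * dt \<eta> t x) =
               - (LINT x|\<nu>. u\<^sub>0 x * \<eta> (x, 0)) +
               (LINT t|lebesgue_on {0<..<T}. LINT x|\<mu>. Dum t x \<bullet> dx \<eta> t x))))"

definition energy_class ::
    "real \<Rightarrow> 'a::euclidean_space set \<Rightarrow> ('a \<Rightarrow> real) \<Rightarrow> ('a \<Rightarrow> real) \<Rightarrow> (real \<Rightarrow> 'a \<Rightarrow> real) \<Rightarrow> bool" where
  "energy_class m \<Omega> \<rho>\<^sub>\<nu> \<rho>\<^sub>\<mu> u \<longleftrightarrow>
     (let \<nu> = weighted \<Omega> \<rho>\<^sub>\<nu>; \<mu> = weighted \<Omega> \<rho>\<^sub>\<mu>; p = (m + 1) / m;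
          um = (\<lambda>t x. spow (u t x) m)
      in \<forall>T>0.
           um \<in> Bochner p T (V0p p \<Omega> \<nu> \<mu>) (V_norm p \<Omega> \<nu> \<mu>) \<and>
           (\<lambda>t. wgrad \<Omega> (um t)) \<in> Bochner 2 T (Lp 2 \<mu>) (Lp_norm 2 \<mu>))"

end

theory Submission
  imports Defs
begin

text \<open>Write \<open>p = (m + 1) / m\<close>, \<open>w = u - v\<close> and \<open>z = u\<^sup>m - v\<^sup>m\<close>. The classical argument, due to Oleinik, inserts
  \<open>\<eta>(t) = \<integral>\<^sub>t\<^sup>T z(s) ds\<close> into the difference of the two weak formulations. Formally this gives
  \<open>\<integral>\<integral> w z d\<nu> dt + (1/2) \<parallel>\<integral>\<^sub>0\<^sup>T \<nabla>z dt\<parallel>\<^sup>2 = 0\<close>, where the norm is that of \<open>L\<^sup>2(\<mu>)\<close>. Since \<open>r \<mapsto> r\<^sup>m\<close> is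
  strictly increasing, \<open>w z\<close> is positive wherever \<open>u \<noteq> v\<close> (\<open>diff_mult_spow_diff\<close>), so \<open>u = v\<close>.

  The function \<open>\<eta>\<close> is neither smooth nor compactly supported, so the argument is carried out one
  time at a time. Test functions \<open>\<phi>(x) \<theta>(t)\<close> with \<open>\<theta>(T) = 0\<close> show that for each \<open>\<phi>\<close> and almost every \<open>s\<close>

  \<open>\<integral> w(s) \<phi> d\<nu> + \<integral>\<^sub>0\<^sup>s \<langle>\<nabla>z(t), \<nabla>\<phi>\<rangle> dt = 0\<close>

  (\<open>weak_solutions_time_integrated\<close>). For countably many \<open>\<phi>\<close> the exceptional null set can be chosen
  independently of \<open>\<phi>\<close>, and countably many are enough: strong measurability of \<open>u\<^sup>m\<close> and \<open>v\<^sup>m\<close> provides a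
  countable set of test functions that approximates \<open>u\<^sup>m(s)\<close> and \<open>v\<^sup>m(s)\<close> in the energy norm for almost
  every \<open>s\<close> (\<open>V0p_Bochner_countable_approximants\<close>). The energy class places \<open>w(s)\<close> in \<open>L\<^bsup>m+1\<^esup>(\<nu>)\<close>, the
  dual of \<open>L\<^sup>p(\<nu>)\<close>, so \<open>\<phi>\<close> may be replaced by \<open>u\<^sup>m(s)\<close> and by \<open>v\<^sup>m(s)\<close> (\<open>test_with_energy_function\<close>).
  Subtracting,

  \<open>\<integral> w(s) z(s) d\<nu> = - \<integral>\<^sub>0\<^sup>s \<langle>\<nabla>z(t), \<nabla>z(s)\<rangle> dt\<close>.

  The left side is nonnegative for almost every \<open>s\<close>, while the integral of the right side over \<open>s\<close> is
  at most \<open>0\<close>, being minus half of the integral of the Gram kernel \<open>\<langle>\<nabla>z(t), \<nabla>z(s)\<rangle>\<close> over the square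
  (\<open>L2_time_ordered_integral_nonneg\<close>). Hence both sides vanish.

  The elements of the spaces are functions and \<open>wgrad\<close> is a choice of representative, so even the
  linearity of the weak gradient rests on its uniqueness up to null sets. This is the fundamental lemma
  of the calculus of variations, which requires smooth cutoff functions. The same lemma on the line
  extracts the identity at almost every time from its tested form.\<close>

section \<open>Smooth cutoff functions\<close>

lemma Ck_Suc_imp_Ck: "Ck (Suc k) f \<Longrightarrow> Ck k f"
proof (induction k arbitrary: f)
  case 0
  then show ?case
    by (auto intro!: differentiable_imp_continuous_within simp: continuous_on_eq_continuous_within)
next
  case (Suc k)
  then show ?case by simp
qed

lemma Ck_const: "Ck k (\<lambda>x. c)"
  by (induction k arbitrary: c) auto

lemma Ck_add:
  "Ck k f \<Longrightarrow> Ck k g \<Longrightarrow> Ck k (\<lambda>x. f x + g x)"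
proof (induction k arbitrary: f g)
  case 0
  then show ?case by (auto intro: continuous_intros)
next
  case (Suc k)
  have "frechet_derivative (\<lambda>x. f x + g x) (at x) v
      = frechet_derivative f (at x) v + frechet_derivative g (at x) v" for x v
  proof -
    have "((\<lambda>x. f x + g x) has_derivative
       (\<lambda>h. frechet_derivative f (at x) h + frechet_derivative g (at x) h)) (at x)"
      using Suc.prems by (intro has_derivative_add) (auto simp: frechet_derivative_works[symmetric])
    from frechet_derivative_at[OF this] show ?thesis by metis
  qed
  then show ?case using Suc by simp
qed

lemma Ck_mult:
  "Ck k f \<Longrightarrow> Ck k g \<Longrightarrow> Ck k (\<lambda>x. f x * g x)"
proof (induction k arbitrary: f g)
  case 0
  then show ?case by (auto intro: continuous_intros)
next
  case (Suc k)
  have "frechet_derivative (\<lambda>x. f x * g x) (at x) v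
      = f x * frechet_derivative g (at x) v + frechet_derivative f (at x) v * g x" for x v
  proof -
    have "((\<lambda>x. f x * g x) has_derivative
       (\<lambda>h. f x * frechet_derivative g (at x) h + frechet_derivative f (at x) h * g x)) (at x)"
      using Suc.prems by (intro has_derivative_mult) (auto simp: frechet_derivative_works[symmetric])
    from frechet_derivative_at[OF this] show ?thesis by metis
  qed
  moreover have "Ck k f" "Ck k g"
    using Suc.prems Ck_Suc_imp_Ck by blast+
  ultimately show ?case
    using Suc by (simp add: Ck_add)
qed

lemma Ck_prod:
  "(\<And>i. i \<in> I \<Longrightarrow> Ck k (f i)) \<Longrightarrow> Ck k (\<lambda>x. \<Prod>i\<in>I. f i x)"
  by (induction I rule: infinite_finite_induct) (auto intro: Ck_const Ck_mult)

text \<open>The family \<open>s\<^sup>-\<^sup>k exp (-1/s)\<close>, extended by \<open>0\<close>, is closed under differentiation up to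
  linear combinations. Smoothness of the classical function \<open>exp (-1/s)\<close> therefore follows by one
  induction over the order of differentiability, for all \<open>k\<close> at once.\<close>

definition exp_cutoff :: "nat \<Rightarrow> real \<Rightarrow> real" where
  "exp_cutoff k s = (if s > 0 then inverse s ^ k * exp (- inverse s) else 0)"

lemma tendsto_exp_cutoff_0: "(exp_cutoff k \<longlongrightarrow> 0) (at 0)"
proof -
  have "((\<lambda>s. inverse s ^ k / exp (inverse s)) \<longlongrightarrow> (0::real)) (at_right 0)"
    by (rule filterlim_compose[OF tendsto_power_div_exp_0 filterlim_inverse_at_top_right])
  then have "(exp_cutoff k \<longlongrightarrow> 0) (at_right 0)"
    by (rule Lim_transform_eventually)
      (auto simp: eventually_at_right_field exp_cutoff_def exp_minus field_simps intro: exI[of _ 1])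
  moreover have "(exp_cutoff k \<longlongrightarrow> 0) (at_left 0)"
    by (rule Lim_transform_eventually[OF tendsto_const])
      (auto simp: eventually_at_left_field exp_cutoff_def intro: exI[of _ "-1"])
  ultimately show ?thesis
    by (simp add: filterlim_split_at)
qed

lemma DERIV_exp_cutoff:
  "(exp_cutoff k has_real_derivative exp_cutoff (k + 2) s - real k * exp_cutoff (k + 1) s) (at s)"
proof -
  consider "s > 0" | "s < 0" | "s = 0" by linarith
  then show ?thesis
  proof cases
    case 1
    have eq: "exp_cutoff (k + 2) s - real k * exp_cutoff (k + 1) s =
       (real k * (- (inverse s ^ Suc (Suc 0))) * inverse s ^ (k - 1)) * exp (- inverse s)
         + exp (- inverse s) * (inverse s ^ Suc (Suc 0)) * inverse s ^ k"
      using 1 by (cases k) (auto simp: exp_cutoff_def algebra_simps)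
    have "((\<lambda>s. inverse s ^ k * exp (- inverse s)) has_real_derivative
         exp_cutoff (k + 2) s - real k * exp_cutoff (k + 1) s) (at s)"
      unfolding eq using 1 by (auto intro!: derivative_eq_intros simp: algebra_simps)
    then show ?thesis
      by (rule has_field_derivative_transform_within_open[of _ _ _ "{0<..}"])
        (use 1 in \<open>auto simp: exp_cutoff_def\<close>)
  next
    case 2
    have "((\<lambda>s. 0) has_real_derivative exp_cutoff (k + 2) s - real k * exp_cutoff (k + 1) s) (at s)"
      using 2 by (simp add: exp_cutoff_def)
    then show ?thesis
      by (rule has_field_derivative_transform_within_open[of _ _ _ "{..<0}"])
        (use 2 in \<open>auto simp: exp_cutoff_def\<close>)
  next
    case 3
    \<comment> \<open>The difference quotient at 0 is the next member of the family.\<close>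
    have "((\<lambda>y. (exp_cutoff k y - exp_cutoff k 0) / (y - 0)) \<longlongrightarrow> 0) (at 0)"
      by (rule Lim_transform_eventually[OF tendsto_exp_cutoff_0[of "Suc k"]])
        (auto simp: exp_cutoff_def field_simps eventually_at intro: exI[of _ 1])
    then show ?thesis
      using 3 by (simp add: has_field_derivative_iff exp_cutoff_def)
  qed
qed

lemma Ck_exp_cutoff_affine:
  fixes w :: "'a::euclidean_space"
  shows "Ck j (\<lambda>x. exp_cutoff k (c + x \<bullet> w))"
proof (induction j arbitrary: k)
  case 0
  have "continuous_on UNIV (exp_cutoff k)"
    using DERIV_exp_cutoff DERIV_isCont continuous_at_imp_continuous_on by blast
  then have "continuous_on UNIV (exp_cutoff k \<circ> (\<lambda>x. c + x \<bullet> w))"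
    by (intro continuous_on_compose continuous_intros) (auto elim: continuous_on_subset)
  then show ?case by (simp add: o_def)
next
  case (Suc j)
  let ?d = "\<lambda>x. exp_cutoff (k + 2) (c + x \<bullet> w) + (- real k) * exp_cutoff (k + 1) (c + x \<bullet> w)"
  have D: "((\<lambda>x. exp_cutoff k (c + x \<bullet> w)) has_derivative (\<lambda>v. ?d x * (v \<bullet> w))) (at x)" for x
  proof -
    have "((\<lambda>x. c + x \<bullet> w) has_derivative (\<lambda>v. v \<bullet> w)) (at x)"
      by (auto intro!: derivative_eq_intros)
    from has_derivative_compose[OF this DERIV_exp_cutoff[of k, unfolded has_field_derivative_def]]
    show ?thesis by simp
  qed
  have "frechet_derivative (\<lambda>x. exp_cutoff k (c + x \<bullet> w)) (at x) v = ?d x * (v \<bullet> w)" for x v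
    using frechet_derivative_at[OF D[of x]] by metis
  moreover have "(\<lambda>x. exp_cutoff k (c + x \<bullet> w)) differentiable (at x)" for x
    using D differentiable_def by blast
  moreover have "Ck j (\<lambda>x. ?d x * (v \<bullet> w))" for v
    by (intro Ck_mult Ck_add Ck_const Suc.IH)
  ultimately show ?case by simp
qed

text \<open>As \<open>n\<close> grows, each factor increases to the indicator of a half-space, so that the product
  tends to the indicator of the open box.\<close>

definition box_cutoff :: "'a::euclidean_space \<Rightarrow> 'a \<Rightarrow> nat \<Rightarrow> 'a \<Rightarrow> real" where
  "box_cutoff a b n x =
     (\<Prod>i\<in>Basis. exp_cutoff 0 (real n * (x \<bullet> i - a \<bullet> i)) * exp_cutoff 0 (real n * (b \<bullet> i - x \<bullet> i)))"

lemma Ck_box_cutoff: "Ck k (box_cutoff a b n)"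
proof -
  have "Ck k (\<lambda>x. exp_cutoff 0 (real n * (x \<bullet> i - a \<bullet> i)) * exp_cutoff 0 (real n * (b \<bullet> i - x \<bullet> i)))"
    for i
    using Ck_mult[OF Ck_exp_cutoff_affine[of k 0 "- (n * (a \<bullet> i))" "real n *\<^sub>R i"]
        Ck_exp_cutoff_affine[of k 0 "n * (b \<bullet> i)" "- (real n *\<^sub>R i)"]]
    by (simp add: algebra_simps)
  then show ?thesis
    unfolding box_cutoff_def[abs_def] by (rule Ck_prod)
qed

lemma exp_cutoff_0_bounds: "0 \<le> exp_cutoff 0 s" "exp_cutoff 0 s \<le> 1"
  by (auto simp: exp_cutoff_def)

lemma box_cutoff_bounds: "0 \<le> box_cutoff a b n x" "box_cutoff a b n x \<le> 1"
  unfolding box_cutoff_def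
  by (auto intro!: prod_nonneg prod_le_1 mult_nonneg_nonneg mult_le_one exp_cutoff_0_bounds)

lemma box_cutoff_outside:
  assumes "x \<notin> box a b" shows "box_cutoff a b n x = 0"
proof -
  obtain i where i: "i \<in> Basis" "\<not> (a \<bullet> i < x \<bullet> i \<and> x \<bullet> i < b \<bullet> i)"
    using assms by (auto simp: mem_box)
  then have "exp_cutoff 0 (real n * (x \<bullet> i - a \<bullet> i)) * exp_cutoff 0 (real n * (b \<bullet> i - x \<bullet> i)) = 0"
    by (auto simp: exp_cutoff_def zero_less_mult_iff)
  then show ?thesis
    unfolding box_cutoff_def using i(1) by (intro prod_zero) auto
qed

lemma exp_cutoff_0_tendsto:
  assumes "c > 0" shows "(\<lambda>n. exp_cutoff 0 (real n * c)) \<longlonglongrightarrow> 1"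
proof -
  have "(\<lambda>n. inverse (real n) * inverse c) \<longlonglongrightarrow> 0 * inverse c"
    by (rule tendsto_mult[OF tendsto_inverse_0_at_top[OF filterlim_real_sequentially] tendsto_const])
  then have "(\<lambda>n. exp (- (inverse (real n) * inverse c))) \<longlonglongrightarrow> exp (- (0 * inverse c))"
    by (intro tendsto_exp tendsto_minus)
  then have *: "(\<lambda>n. exp (- (inverse (real n) * inverse c))) \<longlonglongrightarrow> 1" by simp
  have "eventually (\<lambda>n. exp (- (inverse (real n) * inverse c)) = exp_cutoff 0 (real n * c)) sequentially"
    using eventually_gt_at_top[of "0::nat"]
    by eventually_elim (use assms in \<open>auto simp: exp_cutoff_def\<close>)
  then show ?thesis by (rule Lim_transform_eventually[OF *])
qed

lemma box_cutoff_tendsto: "(\<lambda>n. box_cutoff a b n x) \<longlonglongrightarrow> indicator (box a b) x"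
proof (cases "x \<in> box a b")
  case True
  have "(\<lambda>n. box_cutoff a b n x) \<longlonglongrightarrow> (\<Prod>i\<in>(Basis::'a set). 1 * 1)"
    unfolding box_cutoff_def
    using True by (intro tendsto_intros exp_cutoff_0_tendsto) (auto simp: mem_box)
  then show ?thesis using True by simp
qed (simp add: box_cutoff_outside)

lemma box_cutoff_test_function:
  assumes "cbox a b \<subseteq> \<Omega>"
  shows "box_cutoff a b n \<in> test_functions \<Omega>"
proof -
  have "{x. box_cutoff a b n x \<noteq> 0} \<subseteq> cbox a b"
    using box_cutoff_outside box_subset_cbox by blast
  then have "closure {x. box_cutoff a b n x \<noteq> 0} \<subseteq> cbox a b"
    by (simp add: closure_minimal closed_cbox)
  then show ?thesis
    unfolding test_functions_def using assms Ck_box_cutoff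
    by (auto intro: compact_closure[THEN iffD2] bounded_subset[OF bounded_cbox, OF subset_trans[OF closure_subset]])
qed

section \<open>Test functions and the fundamental lemma of the calculus of variations\<close>

text \<open>Boxes form an intersection-stable generator of the Borel sets, so the integral vanishes over
  every Borel set; the sets where a Borel version of \<open>f\<close> is positive or negative then carry no mass.\<close>

lemma set_integral_zero_imp_AE_zero:
  fixes f :: "'a::euclidean_space \<Rightarrow> real"
  assumes f: "integrable lebesgue f"
    and box: "\<And>a b. (LINT x|lebesgue. indicator (box a b) x * f x) = 0"
    and univ: "(LINT x|lebesgue. f x) = 0"
  shows "AE x in lebesgue. f x = 0"
proof -
  have int_ind: "integrable lebesgue (\<lambda>x. indicator A x * f x)" if "A \<in> sets borel" for A
  proof (rule Bochner_Integration.integrable_bound[OF f])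
    have "A \<in> sets lebesgue" using that by simp
    then show "(\<lambda>x. indicator A x * f x) \<in> borel_measurable lebesgue"
      using f by (intro borel_measurable_times borel_measurable_indicator) auto
  qed (auto split: split_indicator)
  have borel_zero: "(LINT x|lebesgue. indicator A x * f x) = 0" if "A \<in> sets borel" for A
  proof -
    let ?E = "range (\<lambda>(a, b). box a b::'a set)"
    have sets_E: "sigma_sets UNIV ?E = sets borel"
      by (simp add: borel_eq_box)
    have "Int_stable ?E"
      by (auto simp: Int_stable_def box_Int_box)
    moreover have "?E \<subseteq> Pow UNIV" by auto
    moreover have "A \<in> sigma_sets UNIV ?E"
      using that sets_E by simp
    ultimately show ?thesis
    proof (induction rule: sigma_sets_induct_disjoint)
      case (basic A)
      then show ?case using box by auto
    next
      case empty
      then show ?case by simp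
    next
      case (compl A)
      have "(LINT x|lebesgue. indicator (UNIV - A) x * f x)
          = (LINT x|lebesgue. f x - indicator A x * f x)"
        by (intro Bochner_Integration.integral_cong) (auto split: split_indicator)
      also have "\<dots> = 0"
        using compl f univ int_ind sets_E by simp
      finally show ?case .
    next
      case (union A)
      have A: "A i \<in> sets borel" for i using union(2) sets_E by auto
      have partial: "(\<Sum>i<n. indicator (A i) x) = (indicator (\<Union>i<n. A i) x :: real)" for n x
        using union(1) by (subst indicator_UN_disjoint) (auto simp: disjoint_family_on_def)
      have "((\<lambda>n. LINT x|lebesgue. (\<Sum>i<n. indicator (A i) x * f x))
          \<longlonglongrightarrow> (LINT x|lebesgue. indicator (\<Union>i. A i) x * f x))"
      proof (rule integral_dominated_convergence[where w = "\<lambda>x. \<bar>f x\<bar>"])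
        have "(\<lambda>n. (\<Sum>i<n. indicator (A i) x)) \<longlonglongrightarrow> (indicator (\<Union>i. A i) x :: real)" for x
          unfolding partial by (rule LIMSEQ_indicator_UN)
        then show "AE x in lebesgue. (\<lambda>n. \<Sum>i<n. indicator (A i) x * f x) \<longlonglongrightarrow> indicator (\<Union>i. A i) x * f x"
          by (auto simp flip: sum_distrib_right intro!: tendsto_mult)
        show "(\<lambda>x. indicator (\<Union>i. A i) x * f x) \<in> borel_measurable lebesgue"
          using A int_ind by auto
        show "(\<lambda>x. \<Sum>i<n. indicator (A i) x * f x) \<in> borel_measurable lebesgue" for n
          using A int_ind by (intro borel_measurable_sum) auto
        show "AE x in lebesgue. norm (\<Sum>i<n. indicator (A i) x * f x) \<le> \<bar>f x\<bar>" for n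
          by (intro AE_I2)
            (auto simp: partial sum_distrib_right[symmetric] split: split_indicator)
      qed (use f in auto)
      moreover have "(LINT x|lebesgue. (\<Sum>i<n. indicator (A i) x * f x)) = 0" for n
        using union(3) A int_ind by (subst Bochner_Integration.integral_sum) auto
      ultimately show ?case by (simp add: LIMSEQ_const_iff)
    qed
  qed
  obtain g where g: "g \<in> borel_measurable lborel" "AE x in lborel. f x = g x"
    using completion_ex_borel_measurable_real[of f lborel] f by auto
  then have fg: "AE x in lebesgue. f x = g x" by (auto intro: AE_completion)
  note g(1)[measurable]
  have "{x \<in> space lborel. g x > 0} \<in> sets lborel" "{x \<in> space lborel. g x < 0} \<in> sets lborel"
    by measurable
  then have pos: "{x. g x > 0} \<in> sets borel" and neg: "{x. g x < 0} \<in> sets borel"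
    by simp_all
  have "AE x in lebesgue. indicator {x. g x > 0} x * f x = 0"
    using int_ind[OF pos] fg borel_zero[OF pos]
    by (subst (asm) integral_nonneg_eq_0_iff_AE) (auto split: split_indicator elim!: eventually_mono)
  moreover have "AE x in lebesgue. - (indicator {x. g x < 0} x * f x) = 0"
  proof (subst integral_nonneg_eq_0_iff_AE[symmetric])
    show "AE x in lebesgue. 0 \<le> - (indicator {x. g x < 0} x * f x)"
      using fg by eventually_elim (auto split: split_indicator)
  qed (use int_ind[OF neg] borel_zero[OF neg] in auto)
  ultimately show ?thesis
    using fg by eventually_elim (auto split: split_indicator_asm)
qed

text \<open>Locally integrable functions are not assumed measurable as a whole; only their restrictions to
  compact sets are. The multiplier has compact support, so the product is unchanged when \<open>f\<close> is cut
  off to that set.\<close>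

lemma L1_loc_scaleR_integrable:
  fixes f :: "'a::euclidean_space \<Rightarrow> 'b::{banach, second_countable_topology}"
  assumes f: "f \<in> L1_loc \<Omega> M" and K: "compact K" "K \<subseteq> \<Omega>"
    and g: "g \<in> borel_measurable M" "\<And>x. x \<notin> K \<Longrightarrow> g x = 0" "\<And>x. \<bar>g x\<bar> \<le> B"
  shows "integrable M (\<lambda>x. g x *\<^sub>R f x)"
proof -
  have fK: "integrable M (\<lambda>x. indicator K x *\<^sub>R f x)"
    using f K by (auto simp: L1_loc_def set_integrable_def)
  have eq: "(\<lambda>x. g x *\<^sub>R f x) = (\<lambda>x. g x *\<^sub>R (indicator K x *\<^sub>R f x))"
    using g(2) by (auto split: split_indicator)
  show ?thesis
  proof (subst eq, rule Bochner_Integration.integrable_bound)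
    show "integrable M (\<lambda>x. B *\<^sub>R (indicator K x *\<^sub>R f x))"
      using fK by (rule integrable_scaleR_right)
    show "(\<lambda>x. g x *\<^sub>R (indicator K x *\<^sub>R f x)) \<in> borel_measurable M"
      by (rule borel_measurable_scaleR[OF g(1) borel_measurable_integrable[OF fK]])
    have "\<bar>g x\<bar> \<le> \<bar>B\<bar>" for x using g(3)[of x] by linarith
    then show "AE x in M. norm (g x *\<^sub>R (indicator K x *\<^sub>R f x)) \<le> norm (B *\<^sub>R (indicator K x *\<^sub>R f x))"
      by (intro AE_I2) (auto simp: abs_mult intro!: mult_right_mono)
  qed
qed

lemma L1_loc_scaleR_integrable':
  fixes f :: "'a::euclidean_space \<Rightarrow> real" and g :: "'a \<Rightarrow> 'b::{banach, second_countable_topology}"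
  assumes f: "f \<in> L1_loc \<Omega> M" and K: "compact K" "K \<subseteq> \<Omega>"
    and g: "g \<in> borel_measurable M" "\<And>x. x \<notin> K \<Longrightarrow> g x = 0" "\<And>x. norm (g x) \<le> B"
  shows "integrable M (\<lambda>x. f x *\<^sub>R g x)"
proof -
  have fK: "integrable M (\<lambda>x. indicator K x *\<^sub>R f x)"
    using f K by (auto simp: L1_loc_def set_integrable_def)
  have eq: "(\<lambda>x. f x *\<^sub>R g x) = (\<lambda>x. (indicator K x *\<^sub>R f x) *\<^sub>R g x)"
    using g(2) by (auto split: split_indicator)
  show ?thesis
  proof (subst eq, rule Bochner_Integration.integrable_bound)
    show "integrable M (\<lambda>x. B *\<^sub>R (indicator K x *\<^sub>R f x))"
      using fK by (rule integrable_scaleR_right)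
    show "(\<lambda>x. (indicator K x *\<^sub>R f x) *\<^sub>R g x) \<in> borel_measurable M"
      by (rule borel_measurable_scaleR[OF borel_measurable_integrable[OF fK] g(1)])
    have "norm (g x) \<le> \<bar>B\<bar>" for x using g(3)[of x] by linarith
    then have "norm (g x) * \<bar>indicator K x * f x\<bar> \<le> \<bar>B\<bar> * \<bar>indicator K x * f x\<bar>" for x
      by (intro mult_right_mono) auto
    then show "AE x in M. norm ((indicator K x *\<^sub>R f x) *\<^sub>R g x) \<le> norm (B *\<^sub>R (indicator K x *\<^sub>R f x))"
      by (intro AE_I2) (simp add: abs_mult mult.commute[of "norm (g _)"])
  qed
qed

lemma L1_loc_minus:
  assumes "f \<in> L1_loc \<Omega> M" "g \<in> L1_loc \<Omega> M"
  shows "(\<lambda>x. f x - g x) \<in> L1_loc \<Omega> M"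
  using assms unfolding L1_loc_def by (auto intro: set_integral_diff)

lemma test_function_derivative:
  assumes "\<phi> \<in> test_functions \<Omega>"
  shows "(\<phi> has_derivative (\<lambda>v. grad \<phi> x \<bullet> v)) (at x)"
proof -
  have "Ck (Suc 0) \<phi>" using assms by (auto simp: test_functions_def)
  then have d: "(\<phi> has_derivative frechet_derivative \<phi> (at x)) (at x)"
    by (simp add: frechet_derivative_works)
  then interpret bounded_linear "frechet_derivative \<phi> (at x)"
    by (rule has_derivative_bounded_linear)
  have "frechet_derivative \<phi> (at x) v = grad \<phi> x \<bullet> v" for v
  proof -
    have "frechet_derivative \<phi> (at x) v
        = frechet_derivative \<phi> (at x) (\<Sum>b\<in>Basis. (v \<bullet> b) *\<^sub>R b)"
      by (simp add: euclidean_representation)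
    also have "\<dots> = (\<Sum>b\<in>Basis. (v \<bullet> b) * frechet_derivative \<phi> (at x) b)"
      by (simp add: sum scale)
    also have "\<dots> = (\<Sum>b\<in>Basis. frechet_derivative \<phi> (at x) b * (b \<bullet> v))"
      by (intro sum.cong refl) (simp add: inner_commute)
    also have "\<dots> = grad \<phi> x \<bullet> v"
      by (simp add: grad_def inner_sum_left)
    finally show ?thesis .
  qed
  then have "frechet_derivative \<phi> (at x) = (\<lambda>v. grad \<phi> x \<bullet> v)" by auto
  with d show ?thesis by simp
qed

lemma test_function_continuous:
  assumes "\<phi> \<in> test_functions \<Omega>"
  shows "continuous_on S \<phi>" "continuous_on S (grad \<phi>)"
proof -
  have "Ck (Suc 0) \<phi>" "Ck 0 \<phi>" using assms unfolding test_functions_def by blast+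
  then have "continuous_on UNIV \<phi>" "continuous_on UNIV (grad \<phi>)"
    by (auto simp: grad_def[abs_def] intro!: continuous_intros)
  then show "continuous_on S \<phi>" "continuous_on S (grad \<phi>)"
    by (auto elim: continuous_on_subset)
qed

lemma test_function_bounds:
  assumes "\<phi> \<in> test_functions \<Omega>"
  obtains K B where "compact K" "K \<subseteq> \<Omega>" "\<And>x. x \<notin> K \<Longrightarrow> \<phi> x = 0"
    "\<And>x. x \<notin> K \<Longrightarrow> grad \<phi> x = 0" "\<And>x. \<bar>\<phi> x\<bar> \<le> B" "\<And>x. norm (grad \<phi> x) \<le> B" "B \<ge> 0"
proof -
  define K where "K = closure {x. \<phi> x \<noteq> 0}"
  have K: "compact K" "K \<subseteq> \<Omega>"
    using assms by (auto simp: test_functions_def K_def)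
  have out: "\<phi> x = 0" if "x \<notin> K" for x
    using that closure_subset[of "{x. \<phi> x \<noteq> 0}"] by (auto simp: K_def)
  have out': "grad \<phi> x = 0" if "x \<notin> K" for x
  proof -
    have "((\<lambda>x. 0) has_derivative (\<lambda>v. grad \<phi> x \<bullet> v)) (at x)"
      by (rule has_derivative_transform_within_open[OF test_function_derivative[OF assms],
            where s = "- K"])
        (use that out K compact_imp_closed in auto)
    from has_derivative_unique[OF this has_derivative_const]
    have "grad \<phi> x \<bullet> grad \<phi> x = 0" by metis
    then show ?thesis by simp
  qed
  have "bounded (\<phi> ` K)" "bounded (grad \<phi> ` K)"
    using K test_function_continuous[OF assms]
    by (auto intro!: compact_imp_bounded compact_continuous_image)
  then obtain B1 B2 where B: "\<And>x. x \<in> K \<Longrightarrow> norm (\<phi> x) \<le> B1" "\<And>x. x \<in> K \<Longrightarrow> norm (grad \<phi> x) \<le> B2"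
    by (metis bounded_iff imageI)
  show thesis
  proof (rule that[OF K out out', of "max 0 (max B1 B2)"])
    show "\<bar>\<phi> x\<bar> \<le> max 0 (max B1 B2)" "norm (grad \<phi> x) \<le> max 0 (max B1 B2)" for x
      using B[of x] out[of x] out'[of x] by (cases "x \<in> K"; force)+
  qed auto
qed

lemma test_function_measurable:
  assumes "\<phi> \<in> test_functions \<Omega>"
  shows "\<phi> \<in> borel_measurable (lebesgue_on S)" "grad \<phi> \<in> borel_measurable (lebesgue_on S)"
proof -
  have "\<phi> \<in> borel_measurable borel" "grad \<phi> \<in> borel_measurable borel"
    using test_function_continuous[OF assms] by (auto intro: borel_measurable_continuous_onI)
  then have "\<phi> \<in> borel_measurable lebesgue" "grad \<phi> \<in> borel_measurable lebesgue"
    by (auto intro: measurable_completion)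
  then show "\<phi> \<in> borel_measurable (lebesgue_on S)" "grad \<phi> \<in> borel_measurable (lebesgue_on S)"
    by (auto intro: measurable_restrict_space1)
qed

text \<open>The fundamental lemma of the calculus of variations. The box cutoffs are test functions and
  converge boundedly to indicators of boxes, hence the integral of \<open>g\<close> over every box inside \<open>\<Omega>\<close>
  vanishes; countably many closed boxes cover \<open>\<Omega>\<close>.\<close>

lemma orthogonal_to_test_functions_imp_AE_zero:
  fixes g :: "'a::euclidean_space \<Rightarrow> real"
  assumes "open \<Omega>" and g: "g \<in> L1_loc \<Omega> (lebesgue_on \<Omega>)"
    and orth: "\<And>\<phi>. \<phi> \<in> test_functions \<Omega> \<Longrightarrow> (LINT x|lebesgue_on \<Omega>. \<phi> x * g x) = 0"
  shows "AE x in lebesgue_on \<Omega>. g x = 0"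
proof -
  have \<Omega>: "\<Omega> \<in> sets lebesgue" using \<open>open \<Omega>\<close> by auto
  have int_cbox: "integrable lebesgue (\<lambda>x. indicator (cbox a b) x * g x)" if "cbox a b \<subseteq> \<Omega>" for a b
  proof -
    have "integrable (lebesgue_on \<Omega>) (\<lambda>x. indicator (cbox a b) x *\<^sub>R g x)"
      using g that by (auto simp: L1_loc_def set_integrable_def)
    then have "integrable lebesgue (\<lambda>x. indicator \<Omega> x *\<^sub>R indicator (cbox a b) x *\<^sub>R g x)"
      using \<Omega> by (simp add: integrable_restrict_space)
    also have "(\<lambda>x. indicator \<Omega> x *\<^sub>R indicator (cbox a b) x *\<^sub>R g x) = (\<lambda>x. indicator (cbox a b) x * g x)"
      using that by (auto simp: fun_eq_iff indicator_def)
    finally show ?thesis .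
  qed
  have box0: "(LINT x|lebesgue. indicator (box a b) x * g x) = 0" if ab: "cbox a b \<subseteq> \<Omega>" for a b
  proof -
    have "(\<lambda>n. LINT x|lebesgue. box_cutoff a b n x * (indicator (cbox a b) x * g x))
         \<longlonglongrightarrow> (LINT x|lebesgue. indicator (box a b) x * (indicator (cbox a b) x * g x))"
    proof (rule integral_dominated_convergence[where w = "\<lambda>x. \<bar>indicator (cbox a b) x * g x\<bar>"])
      show "(\<lambda>x. box_cutoff a b n x * (indicator (cbox a b) x * g x)) \<in> borel_measurable lebesgue" for n
        using test_function_measurable(1)[OF box_cutoff_test_function[OF ab], where S = UNIV]
        by (intro borel_measurable_times[OF _ borel_measurable_integrable[OF int_cbox[OF ab]]])
          (simp add: lebesgue_on_UNIV_eq)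
      show "(\<lambda>x. indicator (box a b) x * (indicator (cbox a b) x * g x)) \<in> borel_measurable lebesgue"
        by (intro borel_measurable_times[OF _ borel_measurable_integrable[OF int_cbox[OF ab]]] borel_measurable_indicator) simp
      show "AE x in lebesgue. (\<lambda>n. box_cutoff a b n x * (indicator (cbox a b) x * g x))
          \<longlonglongrightarrow> indicator (box a b) x * (indicator (cbox a b) x * g x)"
        by (intro AE_I2 tendsto_mult box_cutoff_tendsto tendsto_const)
      show "AE x in lebesgue. norm (box_cutoff a b n x * (indicator (cbox a b) x * g x))
          \<le> \<bar>indicator (cbox a b) x * g x\<bar>" for n
        by (intro AE_I2) (simp add: abs_mult box_cutoff_bounds mult_left_le_one_le)
    qed (use int_cbox[OF ab] in auto)
    moreover have "(LINT x|lebesgue. box_cutoff a b n x * (indicator (cbox a b) x * g x)) = 0" for n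
    proof -
      have "(LINT x|lebesgue. box_cutoff a b n x * (indicator (cbox a b) x * g x))
          = (LINT x|lebesgue. indicator \<Omega> x *\<^sub>R (box_cutoff a b n x * g x))"
        using ab box_subset_cbox[of a b] box_cutoff_outside[of _ a b n]
        by (intro Bochner_Integration.integral_cong) (auto split: split_indicator)
      also have "\<dots> = (LINT x|lebesgue_on \<Omega>. box_cutoff a b n x * g x)"
        using \<Omega> by (simp add: integral_restrict_space)
      also have "\<dots> = 0" by (rule orth[OF box_cutoff_test_function[OF ab]])
      finally show ?thesis .
    qed
    moreover have "(\<lambda>x. indicator (box a b) x * (indicator (cbox a b) x * g x))
        = (\<lambda>x. indicator (box a b) x * g x)"
      using box_subset_cbox[of a b] by (auto simp: fun_eq_iff indicator_def)
    ultimately show ?thesis by (simp add: LIMSEQ_const_iff)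
  qed
  have AE_cbox: "AE x in lebesgue. x \<in> cbox a b \<longrightarrow> g x = 0" if ab: "cbox a b \<subseteq> \<Omega>" for a b
  proof -
    have "cbox a b - box a b \<in> null_sets lebesgue"
      using negligible_frontier_interval[of a b] negligible_iff_null_sets by metis
    then have ae: "AE x in lebesgue. x \<notin> cbox a b - box a b"
      by (rule AE_not_in)
    have restr: "(LINT x|lebesgue. indicator A x * (indicator (cbox a b) x * g x))
       = (LINT x|lebesgue. indicator (A \<inter> box a b) x * g x)" if "A \<in> sets borel" for A
    proof -
      have eq: "indicator (A \<inter> box a b) x * g x
          = indicator (A \<inter> box a b) x * (indicator (cbox a b) x * g x)" for x
        using box_subset_cbox[of a b] by (auto split: split_indicator)
      have A: "A \<in> sets lebesgue" "A \<inter> box a b \<in> sets lebesgue" using that by auto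
      show ?thesis
        unfolding eq
      proof (rule integral_cong_AE)
        show "(\<lambda>x. indicator A x * (indicator (cbox a b) x * g x)) \<in> borel_measurable lebesgue"
          "(\<lambda>x. indicator (A \<inter> box a b) x * (indicator (cbox a b) x * g x)) \<in> borel_measurable lebesgue"
          by (intro borel_measurable_times[OF _ borel_measurable_integrable[OF int_cbox[OF ab]]]
              borel_measurable_indicator A)+
        show "AE x in lebesgue. indicator A x * (indicator (cbox a b) x * g x)
           = indicator (A \<inter> box a b) x * (indicator (cbox a b) x * g x)"
          using ae by (rule eventually_mono) (auto simp: indicator_def)
      qed
    qed
    have "AE x in lebesgue. indicator (cbox a b) x * g x = 0"
    proof (rule set_integral_zero_imp_AE_zero[OF int_cbox[OF ab]])
      fix c d
      define a' b' where "a' = (\<Sum>i\<in>Basis. max (c \<bullet> i) (a \<bullet> i) *\<^sub>R i)"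
        and "b' = (\<Sum>i\<in>Basis. min (d \<bullet> i) (b \<bullet> i) *\<^sub>R i)"
      have "box c d \<inter> box a b = box a' b'"
        by (simp add: box_Int_box a'_def b'_def)
      moreover have "cbox a' b' \<subseteq> cbox a b"
        by (auto simp: mem_box a'_def b'_def)
      ultimately show "(LINT x|lebesgue. indicator (box c d) x * (indicator (cbox a b) x * g x)) = 0"
        using restr[of "box c d"] box0[of a' b'] ab by auto
    next
      show "(LINT x|lebesgue. indicator (cbox a b) x * g x) = 0"
        using restr[of UNIV] box0[OF ab] by simp
    qed
    then show ?thesis by eventually_elim (auto split: split_indicator_asm)
  qed
  obtain \<D> where D: "countable \<D>" "\<D> \<subseteq> Pow \<Omega>" "\<And>X. X \<in> \<D> \<Longrightarrow> \<exists>a b. X = cbox a b" "\<Union>\<D> = \<Omega>"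
    using open_countable_Union_open_cbox[OF \<open>open \<Omega>\<close>] by metis
  have "AE x in lebesgue. \<forall>X\<in>\<D>. x \<in> X \<longrightarrow> g x = 0"
  proof (subst AE_ball_countable[OF D(1)], intro ballI)
    fix X assume X: "X \<in> \<D>"
    then obtain a b where "X = cbox a b" using D(3) by blast
    with X D(2) show "AE x in lebesgue. x \<in> X \<longrightarrow> g x = 0"
      using AE_cbox[of a b] by blast
  qed
  then have "AE x in lebesgue. x \<in> \<Omega> \<longrightarrow> g x = 0"
    using D(4) by (auto elim!: eventually_mono)
  then show ?thesis
    using \<Omega> by (simp add: AE_restrict_space_iff)
qed

section \<open>Integration by parts and weak gradients\<close>

text \<open>Translation invariance makes the integrals of all difference quotients of \<open>f\<close> vanish, and these
  quotients converge boundedly, with supports in a fixed ball.\<close>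

lemma integral_directional_derivative_eq_0:
  fixes f :: "'a::euclidean_space \<Rightarrow> real" and G :: "'a \<Rightarrow> 'a"
  assumes deriv: "\<And>x. (f has_derivative (\<lambda>h. G x \<bullet> h)) (at x)"
    and G: "continuous_on UNIV G"
    and K: "compact K" "\<And>x. x \<notin> K \<Longrightarrow> f x = 0" "\<And>x. x \<notin> K \<Longrightarrow> G x = 0"
  shows "(LINT x|lborel. G x \<bullet> v) = 0"
proof -
  have f_cont: "continuous_on UNIV f"
    using deriv by (meson continuous_at_imp_continuous_on has_derivative_continuous)
  then have [measurable]: "f \<in> borel_measurable borel"
    by (rule borel_measurable_continuous_onI)
  have f_int: "integrable lborel f"
  proof -
    have "integrable lborel (\<lambda>x. indicator K x *\<^sub>R f x)"
      using K f_cont by (intro borel_integrable_compact) (auto elim: continuous_on_subset)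
    also have "(\<lambda>x. indicator K x *\<^sub>R f x) = f"
    proof
      fix x show "indicator K x *\<^sub>R f x = f x"
        using K(2)[of x] by (cases "x \<in> K") simp_all
    qed
    finally show ?thesis .
  qed
  obtain R0 where "\<forall>x\<in>K. norm x \<le> R0"
    using compact_imp_bounded[OF K(1)] unfolding bounded_iff ..
  then have R0: "K \<subseteq> cball 0 R0" by auto
  have "bounded ((\<lambda>x. G x \<bullet> v) ` K)"
    using K(1) G by (intro compact_imp_bounded compact_continuous_image continuous_intros)
      (auto elim: continuous_on_subset)
  then obtain B0 where B0: "\<And>x. x \<in> K \<Longrightarrow> \<bar>G x \<bullet> v\<bar> \<le> B0"
    by (auto simp: bounded_iff)
  define B where "B = max 0 B0"
  have B: "\<bar>G x \<bullet> v\<bar> \<le> B" for x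
    using B0[of x] K(3)[of x] by (cases "x \<in> K") (auto simp: B_def)
  have line: "((\<lambda>s. f (x + s *\<^sub>R v)) has_real_derivative G (x + s *\<^sub>R v) \<bullet> v) (at s)" for x s
  proof -
    have "((\<lambda>s. x + s *\<^sub>R v) has_derivative (\<lambda>h. h *\<^sub>R v)) (at s)"
      by (auto intro!: derivative_eq_intros)
    from has_derivative_compose[OF this deriv[of "x + s *\<^sub>R v"]]
    show ?thesis by (rule has_derivative_imp_has_field_derivative) simp
  qed
  define h where "h n = inverse (real (Suc n))" for n
  have h: "h n > 0" "h n \<le> 1" for n by (auto simp: h_def inverse_le_1_iff)
  define q where "q n x = (f (x + h n *\<^sub>R v) - f x) / h n" for n x
  have shift: "integrable lborel (\<lambda>x. f (x + c))" "(LINT x|lborel. f (x + c)) = (LINT x|lborel. f x)" for c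
  proof -
    have *: "(\<lambda>x. f (x + c)) = (\<lambda>x. f (c + x))" by (simp add: add.commute)
    have "integrable (distr lborel borel ((+) c)) f"
      unfolding lborel_distr_plus by (rule f_int)
    then show "integrable lborel (\<lambda>x. f (x + c))"
      unfolding * by (subst (asm) integrable_distr_eq) auto
    have "(LINT x|lborel. f (c + x)) = (LINT x|distr lborel borel ((+) c). f x)"
      by (subst integral_distr) auto
    then show "(LINT x|lborel. f (x + c)) = (LINT x|lborel. f x)"
      unfolding * lborel_distr_plus .
  qed
  have q0: "(LINT x|lborel. q n x) = 0" for n
    unfolding q_def using shift f_int by simp
  have "(\<lambda>n. LINT x|lborel. q n x) \<longlonglongrightarrow> (LINT x|lborel. G x \<bullet> v)"
  proof (rule integral_dominated_convergence[where w = "\<lambda>x. indicator (cball 0 (R0 + norm v)) x *\<^sub>R B"])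
    show "(\<lambda>x. G x \<bullet> v) \<in> borel_measurable lborel"
      using G by (auto intro!: borel_measurable_continuous_onI continuous_intros)
    show "q n \<in> borel_measurable lborel" for n
      unfolding q_def[abs_def] by measurable
    show "integrable lborel (\<lambda>x. indicator (cball 0 (R0 + norm v)) x *\<^sub>R B)"
      by (intro borel_integrable_compact) auto
    show "AE x in lborel. (\<lambda>n. q n x) \<longlonglongrightarrow> G x \<bullet> v"
    proof (rule AE_I2)
      fix x
      have "((\<lambda>s. (f (x + s *\<^sub>R v) - f x) / s) \<longlongrightarrow> G x \<bullet> v) (at 0)"
        using line[of x 0] by (simp add: has_field_derivative_iff)
      moreover have "filterlim h (at 0) sequentially"
        unfolding filterlim_at h_def[abs_def]
        using LIMSEQ_inverse_real_of_nat by (simp add: add_pos_nonneg)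
      ultimately show "(\<lambda>n. q n x) \<longlonglongrightarrow> G x \<bullet> v"
        unfolding q_def by (rule filterlim_compose)
    qed
    show "AE x in lborel. norm (q n x) \<le> indicator (cball 0 (R0 + norm v)) x *\<^sub>R B" for n
    proof (rule AE_I2)
      fix x
      show "norm (q n x) \<le> indicator (cball 0 (R0 + norm v)) x *\<^sub>R B"
      proof (cases "x \<in> cball 0 (R0 + norm v)")
        case True
        have "\<exists>s>0. s < h n \<and> f (x + h n *\<^sub>R v) - f (x + 0 *\<^sub>R v) = (h n - 0) * (G (x + s *\<^sub>R v) \<bullet> v)"
          by (rule MVT2[OF h(1) line])
        then obtain s where "f (x + h n *\<^sub>R v) - f (x + 0 *\<^sub>R v) = (h n - 0) * (G (x + s *\<^sub>R v) \<bullet> v)"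
          by blast
        then have "q n x = G (x + s *\<^sub>R v) \<bullet> v"
          using h(1)[of n] by (simp add: q_def)
        then show ?thesis using B True by simp
      next
        case False
        have "norm (h n *\<^sub>R v) \<le> norm v"
          using h[of n] by (simp add: mult_left_le_one_le)
        then have "norm x \<le> norm (x + h n *\<^sub>R v) + norm v"
          using norm_triangle_ineq4[of "x + h n *\<^sub>R v" "h n *\<^sub>R v"] by simp
        moreover have "norm x > R0 + norm v" using False by simp
        ultimately have "norm x > R0" "norm (x + h n *\<^sub>R v) > R0"
          using norm_ge_zero[of v] by linarith+
        \<comment> \<open>Neither endpoint of the difference quotient lies in the support, since the step is at most 1.\<close>
        then have "x \<notin> cball 0 R0" "x + h n *\<^sub>R v \<notin> cball 0 R0" by simp_all
        then have "x \<notin> K" "x + h n *\<^sub>R v \<notin> K" using R0 by auto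
        then show ?thesis using K(2) False by (simp add: q_def)
      qed
    qed
  qed
  then show ?thesis by (simp add: q0 LIMSEQ_const_iff)
qed

lemma continuous_L1_loc:
  fixes f :: "'a::euclidean_space \<Rightarrow> 'b::euclidean_space"
  assumes "open \<Omega>" "continuous_on UNIV f"
  shows "f \<in> L1_loc \<Omega> (lebesgue_on \<Omega>)"
proof -
  have "integrable (lebesgue_on \<Omega>) (\<lambda>x. indicator K x *\<^sub>R f x)" if K: "compact K" "K \<subseteq> \<Omega>" for K
  proof -
    have "integrable lborel (\<lambda>x. indicator K x *\<^sub>R f x)"
      using K assms by (intro borel_integrable_compact) (auto elim: continuous_on_subset)
    then have "integrable lebesgue (\<lambda>x. indicator K x *\<^sub>R f x)"
      using integrable_completion borel_measurable_integrable by blast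
    also have "(\<lambda>x. indicator K x *\<^sub>R f x) = (\<lambda>x. indicator \<Omega> x *\<^sub>R indicator K x *\<^sub>R f x)"
      using K by (auto simp: fun_eq_iff indicator_def)
    finally show ?thesis
      using assms(1) by (subst integrable_restrict_space) auto
  qed
  then show ?thesis by (auto simp: L1_loc_def set_integrable_def)
qed

lemma L1_loc_test_function_integrable:
  fixes f :: "'a::euclidean_space \<Rightarrow> 'b::{banach, second_countable_topology}"
  assumes \<phi>: "\<phi> \<in> test_functions \<Omega>" and f: "f \<in> L1_loc \<Omega> M" and M: "sets M = sets (lebesgue_on \<Omega>)"
  shows "integrable M (\<lambda>x. \<phi> x *\<^sub>R f x)"
proof -
  obtain K B where K: "compact K" "K \<subseteq> \<Omega>" "\<And>x. x \<notin> K \<Longrightarrow> \<phi> x = 0" "\<And>x. \<bar>\<phi> x\<bar> \<le> B"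
    using test_function_bounds[OF \<phi>] by metis
  have "\<phi> \<in> borel_measurable M"
    using test_function_measurable(1)[OF \<phi>] measurable_cong_sets[OF M refl] by blast
  then show ?thesis
    using L1_loc_scaleR_integrable[where g = \<phi>, OF f K(1,2) _ K(3,4)] by blast
qed

lemma L1_loc_grad_test_function_integrable:
  assumes \<phi>: "\<phi> \<in> test_functions \<Omega>" and f: "f \<in> L1_loc \<Omega> M" and M: "sets M = sets (lebesgue_on \<Omega>)"
  shows "integrable M (\<lambda>x. f x *\<^sub>R grad \<phi> x)"
proof -
  obtain K B where K: "compact K" "K \<subseteq> \<Omega>" "\<And>x. x \<notin> K \<Longrightarrow> grad \<phi> x = 0" "\<And>x. norm (grad \<phi> x) \<le> B"
    using test_function_bounds[OF \<phi>] by metis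
  have "grad \<phi> \<in> borel_measurable M"
    using test_function_measurable(2)[OF \<phi>] measurable_cong_sets[OF M refl] by blast
  then show ?thesis
    using L1_loc_scaleR_integrable'[where g = "grad \<phi>", OF f K(1,2) _ K(3,4)] by blast
qed

lemma is_weak_grad_test_function:
  assumes "open \<Omega>" and \<phi>: "\<phi> \<in> test_functions \<Omega>"
  shows "is_weak_grad \<Omega> \<phi> (grad \<phi>)"
  unfolding is_weak_grad_def
proof (intro conjI ballI)
  have \<Omega>: "\<Omega> \<in> sets lebesgue" using \<open>open \<Omega>\<close> by auto
  show L: "\<phi> \<in> L1_loc \<Omega> (lebesgue_on \<Omega>)" "grad \<phi> \<in> L1_loc \<Omega> (lebesgue_on \<Omega>)"
    using continuous_L1_loc[OF assms(1)] test_function_continuous[OF \<phi>] by auto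
  fix \<psi> assume \<psi>: "\<psi> \<in> test_functions \<Omega>"
  obtain K B where K: "compact K" "K \<subseteq> \<Omega>" "\<And>x. x \<notin> K \<Longrightarrow> \<psi> x = 0" "\<And>x. x \<notin> K \<Longrightarrow> grad \<psi> x = 0"
    "\<And>x. \<bar>\<psi> x\<bar> \<le> B" "\<And>x. norm (grad \<psi> x) \<le> B"
    using test_function_bounds[OF \<psi>] by metis
  let ?G = "\<lambda>x. \<phi> x *\<^sub>R grad \<psi> x + \<psi> x *\<^sub>R grad \<phi> x"
  have int: "integrable (lebesgue_on \<Omega>) (\<lambda>x. \<phi> x *\<^sub>R grad \<psi> x)"
    "integrable (lebesgue_on \<Omega>) (\<lambda>x. \<psi> x *\<^sub>R grad \<phi> x)"
    by (rule L1_loc_grad_test_function_integrable[OF \<psi> L(1) refl]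
        L1_loc_test_function_integrable[OF \<psi> L(2) refl])+
  have G_cont: "continuous_on UNIV ?G"
    by (intro continuous_intros test_function_continuous[OF \<phi>] test_function_continuous[OF \<psi>])
  have "(LINT x|lebesgue_on \<Omega>. ?G x) = 0"
  proof (rule euclidean_eqI)
    fix b :: 'a
    have "(LINT x|lebesgue_on \<Omega>. ?G x) \<bullet> b = (LINT x|lebesgue_on \<Omega>. ?G x \<bullet> b)"
      using int by (subst integral_inner_left) auto
    also have "\<dots> = (LINT x|lebesgue. indicator \<Omega> x *\<^sub>R (?G x \<bullet> b))"
      using \<Omega> by (simp add: integral_restrict_space)
    also have "\<dots> = (LINT x|lebesgue. ?G x \<bullet> b)"
    proof (intro Bochner_Integration.integral_cong refl)
      fix x show "indicator \<Omega> x *\<^sub>R (?G x \<bullet> b) = ?G x \<bullet> b"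
      proof (cases "x \<in> \<Omega>")
        case False
        then have "\<psi> x = 0" "grad \<psi> x = 0" using K(2-4) by blast+
        then show ?thesis by simp
      qed simp
    qed
    also have "\<dots> = (LINT x|lborel. ?G x \<bullet> b)"
      by (intro integral_completion) (auto intro!: borel_measurable_continuous_onI continuous_intros G_cont)
    also have "\<dots> = 0"
    proof (rule integral_directional_derivative_eq_0[where f = "\<lambda>x. \<phi> x * \<psi> x", OF _ G_cont K(1)])
      show "((\<lambda>x. \<phi> x * \<psi> x) has_derivative (\<lambda>h. ?G x \<bullet> h)) (at x)" for x
        using has_derivative_mult[OF test_function_derivative[OF \<phi>, of x] test_function_derivative[OF \<psi>, of x]]
        by (simp add: inner_add_left mult.commute)
    qed (use K in auto)
    finally show "(LINT x|lebesgue_on \<Omega>. ?G x) \<bullet> b = 0 \<bullet> b" by simp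
  qed
  then have "(LINT x|lebesgue_on \<Omega>. \<phi> x *\<^sub>R grad \<psi> x) + (LINT x|lebesgue_on \<Omega>. \<psi> x *\<^sub>R grad \<phi> x) = 0"
    using int by simp
  then show "(LINT x|lebesgue_on \<Omega>. \<phi> x *\<^sub>R grad \<psi> x) = - (LINT x|lebesgue_on \<Omega>. \<psi> x *\<^sub>R grad \<phi> x)"
    by (simp add: eq_neg_iff_add_eq_0)
qed

lemma is_weak_grad_unique:
  fixes w1 w2 :: "'a::euclidean_space \<Rightarrow> 'a"
  assumes "open \<Omega>" "is_weak_grad \<Omega> v w1" "is_weak_grad \<Omega> v w2"
  shows "AE x in lebesgue_on \<Omega>. w1 x = w2 x"
proof -
  have L: "w1 \<in> L1_loc \<Omega> (lebesgue_on \<Omega>)" "w2 \<in> L1_loc \<Omega> (lebesgue_on \<Omega>)"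
    using assms by (auto simp: is_weak_grad_def)
  have "AE x in lebesgue_on \<Omega>. (w1 x - w2 x) \<bullet> b = 0" for b
  proof (rule orthogonal_to_test_functions_imp_AE_zero[OF assms(1)])
    show "(\<lambda>x. (w1 x - w2 x) \<bullet> b) \<in> L1_loc \<Omega> (lebesgue_on \<Omega>)"
      using L1_loc_minus[OF L] unfolding L1_loc_def set_integrable_def
      by (auto intro: integrable_inner_left simp flip: inner_scaleR_left)
  next
    fix \<phi> assume \<phi>: "\<phi> \<in> test_functions \<Omega>"
    have int: "integrable (lebesgue_on \<Omega>) (\<lambda>x. \<phi> x *\<^sub>R w1 x)" "integrable (lebesgue_on \<Omega>) (\<lambda>x. \<phi> x *\<^sub>R w2 x)"
      by (rule L1_loc_test_function_integrable[OF \<phi> _ refl] L)+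
    have "(LINT x|lebesgue_on \<Omega>. \<phi> x * ((w1 x - w2 x) \<bullet> b))
        = (LINT x|lebesgue_on \<Omega>. (\<phi> x *\<^sub>R w1 x - \<phi> x *\<^sub>R w2 x) \<bullet> b)"
      by (simp add: scaleR_diff_right[symmetric])
    also have "\<dots> = ((LINT x|lebesgue_on \<Omega>. \<phi> x *\<^sub>R w1 x) - (LINT x|lebesgue_on \<Omega>. \<phi> x *\<^sub>R w2 x)) \<bullet> b"
      using int by (subst integral_inner_left) auto
    also have "\<dots> = 0"
    proof -
      have "(LINT x|lebesgue_on \<Omega>. v x *\<^sub>R grad \<phi> x) = - (LINT x|lebesgue_on \<Omega>. \<phi> x *\<^sub>R w1 x)"
        "(LINT x|lebesgue_on \<Omega>. v x *\<^sub>R grad \<phi> x) = - (LINT x|lebesgue_on \<Omega>. \<phi> x *\<^sub>R w2 x)"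
        using assms(2,3) \<phi> unfolding is_weak_grad_def by blast+
      then show ?thesis by simp
    qed
    finally show "(LINT x|lebesgue_on \<Omega>. \<phi> x * ((w1 x - w2 x) \<bullet> b)) = 0" .
  qed
  then have "AE x in lebesgue_on \<Omega>. \<forall>b\<in>Basis. (w1 x - w2 x) \<bullet> b = 0"
    by (subst AE_ball_countable) (auto intro: countable_finite)
  then show ?thesis
    by eventually_elim (auto intro: euclidean_eqI simp: inner_diff_left)
qed

lemma is_weak_grad_diff:
  fixes w1 w2 :: "'a::euclidean_space \<Rightarrow> 'a"
  assumes "is_weak_grad \<Omega> v1 w1" "is_weak_grad \<Omega> v2 w2"
  shows "is_weak_grad \<Omega> (\<lambda>x. v1 x - v2 x) (\<lambda>x. w1 x - w2 x)"
  unfolding is_weak_grad_def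
proof (intro conjI ballI)
  have L: "v1 \<in> L1_loc \<Omega> (lebesgue_on \<Omega>)" "v2 \<in> L1_loc \<Omega> (lebesgue_on \<Omega>)"
    "w1 \<in> L1_loc \<Omega> (lebesgue_on \<Omega>)" "w2 \<in> L1_loc \<Omega> (lebesgue_on \<Omega>)"
    using assms by (auto simp: is_weak_grad_def)
  then show "(\<lambda>x. v1 x - v2 x) \<in> L1_loc \<Omega> (lebesgue_on \<Omega>)"
    "(\<lambda>x. w1 x - w2 x) \<in> L1_loc \<Omega> (lebesgue_on \<Omega>)"
    by (auto intro: L1_loc_minus)
  fix \<phi> assume \<phi>: "\<phi> \<in> test_functions \<Omega>"
  have "integrable (lebesgue_on \<Omega>) (\<lambda>x. \<phi> x *\<^sub>R w1 x)" "integrable (lebesgue_on \<Omega>) (\<lambda>x. \<phi> x *\<^sub>R w2 x)"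
    "integrable (lebesgue_on \<Omega>) (\<lambda>x. v1 x *\<^sub>R grad \<phi> x)" "integrable (lebesgue_on \<Omega>) (\<lambda>x. v2 x *\<^sub>R grad \<phi> x)"
    by (rule L1_loc_test_function_integrable[OF \<phi> _ refl]
        L1_loc_grad_test_function_integrable[OF \<phi> _ refl] L)+
  then show "(LINT x|lebesgue_on \<Omega>. (v1 x - v2 x) *\<^sub>R grad \<phi> x)
      = - (LINT x|lebesgue_on \<Omega>. \<phi> x *\<^sub>R (w1 x - w2 x))"
    using assms \<phi> by (simp add: scaleR_diff_left scaleR_diff_right is_weak_grad_def)
qed

lemma is_weak_grad_wgrad: "v \<in> W11_loc \<Omega> \<Longrightarrow> is_weak_grad \<Omega> v (wgrad \<Omega> v)"
  unfolding W11_loc_def wgrad_def by (simp add: someI_ex)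

text \<open>\<open>wgrad\<close> is an arbitrary choice among the weak gradients, so it is linear only up to null sets.\<close>

lemma wgrad_diff:
  fixes v1 v2 :: "'a::euclidean_space \<Rightarrow> real"
  assumes "open \<Omega>" "v1 \<in> W11_loc \<Omega>" "v2 \<in> W11_loc \<Omega>"
  shows "AE x in lebesgue_on \<Omega>. wgrad \<Omega> (\<lambda>x. v1 x - v2 x) x = wgrad \<Omega> v1 x - wgrad \<Omega> v2 x"
proof -
  have d: "is_weak_grad \<Omega> (\<lambda>x. v1 x - v2 x) (\<lambda>x. wgrad \<Omega> v1 x - wgrad \<Omega> v2 x)"
    using assms by (intro is_weak_grad_diff is_weak_grad_wgrad)
  then have "(\<lambda>x. v1 x - v2 x) \<in> W11_loc \<Omega>" by (auto simp: W11_loc_def)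
  from is_weak_grad_unique[OF assms(1) is_weak_grad_wgrad[OF this] d] show ?thesis .
qed

lemma test_function_W11_loc:
  assumes "open \<Omega>" "\<phi> \<in> test_functions \<Omega>"
  shows "\<phi> \<in> W11_loc \<Omega>"
  using is_weak_grad_test_function[OF assms] by (auto simp: W11_loc_def)

lemma wgrad_test_function:
  assumes "open \<Omega>" "\<phi> \<in> test_functions \<Omega>"
  shows "AE x in lebesgue_on \<Omega>. wgrad \<Omega> \<phi> x = grad \<phi> x"
  by (rule is_weak_grad_unique[OF assms(1) is_weak_grad_wgrad[OF test_function_W11_loc[OF assms]]
        is_weak_grad_test_function[OF assms]])

section \<open>Lebesgue spaces\<close>

lemma Lp_norm_nonneg [simp]: "0 \<le> Lp_norm p M f"
  by (simp add: Lp_norm_def)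

lemma Lp_norm_powr:
  assumes "p > 0"
  shows "Lp_norm p M f powr p = (LINT x|M. norm (f x) powr p)"
  using assms by (simp add: Lp_norm_def powr_powr integral_nonneg)

lemma Lp_measurable: "f \<in> Lp p M \<Longrightarrow> f \<in> borel_measurable M"
  by (simp add: Lp_def)

lemma Lp_cong_AE:
  assumes "f \<in> Lp p M" "g \<in> borel_measurable M" "AE x in M. g x = f x"
  shows "g \<in> Lp p M" "Lp_norm p M g = Lp_norm p M f"
proof -
  have [measurable]: "f \<in> borel_measurable M" "g \<in> borel_measurable M"
    using assms by (auto simp: Lp_def)
  have ae: "AE x in M. norm (g x) powr p = norm (f x) powr p"
    using assms(3) by eventually_elim simp
  have "integrable M (\<lambda>x. norm (g x) powr p) = integrable M (\<lambda>x. norm (f x) powr p)"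
    using ae by (intro integrable_cong_AE) auto
  then show "g \<in> Lp p M" using assms by (simp add: Lp_def)
  have "(LINT x|M. norm (g x) powr p) = (LINT x|M. norm (f x) powr p)"
    using ae by (intro integral_cong_AE) auto
  then show "Lp_norm p M g = Lp_norm p M f" by (simp add: Lp_norm_def)
qed

lemma norm_diff_powr_le:
  fixes a b :: "'b::real_normed_vector"
  assumes "p > 0"
  shows "norm (a - b) powr p \<le> 2 powr p * (norm a powr p + norm b powr p)"
proof -
  have "norm (a - b) \<le> 2 * max (norm a) (norm b)"
    using norm_triangle_ineq4[of a b] by linarith
  then have "norm (a - b) powr p \<le> (2 * max (norm a) (norm b)) powr p"
    using assms by (intro powr_mono2) auto
  also have "\<dots> = 2 powr p * max (norm a) (norm b) powr p"
    by (simp add: powr_mult)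
  also have "\<dots> \<le> 2 powr p * (norm a powr p + norm b powr p)"
    by (intro mult_left_mono) (auto simp: max_def)
  finally show ?thesis .
qed

text \<open>The factor \<open>2 powr p\<close> comes from \<open>norm (a - b) \<le> 2 * max (norm a) (norm b)\<close>; a quasi-triangle
  inequality of this kind serves approximation as well as the triangle inequality does.\<close>

lemma Lp_diff:
  assumes "f \<in> Lp p M" "g \<in> Lp p M" "p > 0"
  shows "(\<lambda>x. f x - g x) \<in> Lp p M"
    and "Lp_norm p M (\<lambda>x. f x - g x) powr p \<le> 2 powr p * (Lp_norm p M f powr p + Lp_norm p M g powr p)"
proof -
  have [measurable]: "f \<in> borel_measurable M" "g \<in> borel_measurable M"
    and int: "integrable M (\<lambda>x. norm (f x) powr p)" "integrable M (\<lambda>x. norm (g x) powr p)"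
    using assms by (auto simp: Lp_def)
  have int': "integrable M (\<lambda>x. 2 powr p * (norm (f x) powr p + norm (g x) powr p))"
    using int by simp
  have d: "integrable M (\<lambda>x. norm (f x - g x) powr p)"
    by (rule Bochner_Integration.integrable_bound[OF int'])
      (use norm_diff_powr_le[OF assms(3)] in auto)
  then show "(\<lambda>x. f x - g x) \<in> Lp p M" by (simp add: Lp_def)
  have "(LINT x|M. norm (f x - g x) powr p) \<le> (LINT x|M. 2 powr p * (norm (f x) powr p + norm (g x) powr p))"
    using d int' norm_diff_powr_le[OF assms(3)] by (intro integral_mono) auto
  then show "Lp_norm p M (\<lambda>x. f x - g x) powr p \<le> 2 powr p * (Lp_norm p M f powr p + Lp_norm p M g powr p)"
    using assms(3) int by (simp add: Lp_norm_powr)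
qed

lemma Lp_norm_minus_commute: "Lp_norm p M (\<lambda>x. f x - g x) = Lp_norm p M (\<lambda>x. g x - f x)"
  by (simp add: Lp_norm_def norm_minus_commute)

lemma Lp_norm_eq_0_imp_AE:
  assumes "f \<in> Lp p M" "p > 0" "Lp_norm p M f = 0"
  shows "AE x in M. f x = 0"
proof -
  have "(LINT x|M. norm (f x) powr p) = 0"
    using Lp_norm_powr[OF assms(2), of M f] assms by simp
  then have "AE x in M. norm (f x) powr p = 0"
    using assms(1) by (subst (asm) integral_nonneg_eq_0_iff_AE) (auto simp: Lp_def)
  then show ?thesis by eventually_elim simp
qed

text \<open>Young's inequality for the normalised functions. Stating it for inner products covers both the
  duality between \<open>L\<^sup>p\<close> and \<open>L\<^sup>q\<close> of scalar functions and the Cauchy-Schwarz inequality for gradients.\<close>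

lemma Hoelder:
  fixes f g :: "'a \<Rightarrow> 'b::euclidean_space"
  assumes f: "f \<in> Lp p M" and g: "g \<in> Lp q M" and pq: "p > 1" "q > 1" "1 / p + 1 / q = 1"
  shows "integrable M (\<lambda>x. f x \<bullet> g x)"
    and "\<bar>LINT x|M. f x \<bullet> g x\<bar> \<le> Lp_norm p M f * Lp_norm q M g"
proof -
  have [measurable]: "f \<in> borel_measurable M" "g \<in> borel_measurable M"
    and int: "integrable M (\<lambda>x. norm (f x) powr p)" "integrable M (\<lambda>x. norm (g x) powr q)"
    using f g by (auto simp: Lp_def)
  have le: "\<bar>f x \<bullet> g x\<bar> \<le> norm (f x) * norm (g x)" for x
    by (rule Cauchy_Schwarz_ineq2)
  have int_norm: "integrable M (\<lambda>x. norm (f x) * norm (g x))"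
  proof (rule Bochner_Integration.integrable_bound)
    show "integrable M (\<lambda>x. norm (f x) powr p / p + norm (g x) powr q / q)"
      using int by simp
    show "AE x in M. norm (norm (f x) * norm (g x)) \<le> norm (norm (f x) powr p / p + norm (g x) powr q / q)"
      using Youngs_inequality[OF pq] by (intro AE_I2) (auto intro: order_trans[OF _ abs_ge_self])
  qed measurable
  show int_fg: "integrable M (\<lambda>x. f x \<bullet> g x)"
    by (rule Bochner_Integration.integrable_bound[OF int_norm]) (use le in auto)
  define A B where "A = Lp_norm p M f" and "B = Lp_norm q M g"
  show "\<bar>LINT x|M. f x \<bullet> g x\<bar> \<le> Lp_norm p M f * Lp_norm q M g"
  proof (cases "A = 0 \<or> B = 0")
    case True
    then have "(AE x in M. f x = 0) \<or> (AE x in M. g x = 0)"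
      using Lp_norm_eq_0_imp_AE[OF f] Lp_norm_eq_0_imp_AE[OF g] pq by (auto simp: A_def B_def)
    then have "AE x in M. f x \<bullet> g x = 0" by (auto elim: eventually_mono)
    then have "(LINT x|M. f x \<bullet> g x) = 0" by (rule integral_eq_zero_AE)
    then show ?thesis by simp
  next
    case False
    then have AB: "A > 0" "B > 0"
      unfolding A_def B_def by (simp_all add: less_le)
    have powr1: "A powr p = (LINT x|M. norm (f x) powr p)" "B powr q = (LINT x|M. norm (g x) powr q)"
      using pq by (simp_all add: A_def B_def Lp_norm_powr)
    have "\<bar>LINT x|M. f x \<bullet> g x\<bar> \<le> (LINT x|M. \<bar>f x \<bullet> g x\<bar>)"
      using integral_norm_bound[of M "\<lambda>x. f x \<bullet> g x"] by simp
    also have "\<dots> \<le> (LINT x|M. A * B * ((norm (f x) powr p / A powr p) / p + (norm (g x) powr q / B powr q) / q))"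
    proof (rule integral_mono)
      fix x
      have "(norm (f x) / A) * (norm (g x) / B) \<le> (norm (f x) / A) powr p / p + (norm (g x) / B) powr q / q"
        using AB by (intro Youngs_inequality pq) auto
      also have "\<dots> = (norm (f x) powr p / A powr p) / p + (norm (g x) powr q / B powr q) / q"
        using AB by (simp add: powr_divide)
      finally have "A * B * ((norm (f x) / A) * (norm (g x) / B))
          \<le> A * B * ((norm (f x) powr p / A powr p) / p + (norm (g x) powr q / B powr q) / q)"
        using AB by (intro mult_left_mono) auto
      moreover have "A * B * ((norm (f x) / A) * (norm (g x) / B)) = norm (f x) * norm (g x)"
        using AB by simp
      ultimately show "\<bar>f x \<bullet> g x\<bar>
          \<le> A * B * ((norm (f x) powr p / A powr p) / p + (norm (g x) powr q / B powr q) / q)"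
        using le[of x] by linarith
    qed (use int_fg int in auto)
    also have "\<dots> = A * B * ((A powr p / A powr p) / p + (B powr q / B powr q) / q)"
      using int by (simp add: powr1)
    also have "\<dots> = A * B"
      using AB pq by simp
    finally show ?thesis by (simp add: A_def B_def)
  qed
qed

abbreviation L2_inner :: "'a measure \<Rightarrow> ('a \<Rightarrow> 'b::euclidean_space) \<Rightarrow> ('a \<Rightarrow> 'b) \<Rightarrow> real" where
  "L2_inner M f g \<equiv> LINT x|M. f x \<bullet> g x"

lemma
  fixes f g :: "'a \<Rightarrow> 'b::euclidean_space"
  assumes "f \<in> Lp 2 M" "g \<in> Lp 2 M"
  shows L2_inner_integrable: "integrable M (\<lambda>x. f x \<bullet> g x)"
    and L2_Cauchy_Schwarz: "\<bar>L2_inner M f g\<bar> \<le> Lp_norm 2 M f * Lp_norm 2 M g"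
  using Hoelder[OF assms] by auto

lemma L2_norm_squared: "(Lp_norm 2 M f)\<^sup>2 = L2_inner M f f"
proof -
  have "(Lp_norm 2 M f)\<^sup>2 = Lp_norm 2 M f powr 2"
    using Lp_norm_nonneg[of 2 M f] by (simp add: powr_numeral)
  also have "\<dots> = (LINT x|M. norm (f x) powr 2)" by (rule Lp_norm_powr) simp
  also have "\<dots> = L2_inner M f f"
    by (intro Bochner_Integration.integral_cong refl) (simp add: powr_numeral dot_square_norm)
  finally show ?thesis .
qed

lemma L2_inner_commute: "L2_inner M f g = L2_inner M g f"
  by (simp add: inner_commute)

lemma L2_inner_diff_left:
  fixes f g :: "'a \<Rightarrow> 'b::euclidean_space"
  assumes "f \<in> Lp 2 M" "g \<in> Lp 2 M" "h \<in> Lp 2 M"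
  shows "L2_inner M (\<lambda>x. f x - g x) h = L2_inner M f h - L2_inner M g h"
  using L2_inner_integrable[OF assms(1,3)] L2_inner_integrable[OF assms(2,3)]
  by (simp add: inner_diff_left)

lemma L2_inner_diff_right:
  fixes f g :: "'a \<Rightarrow> 'b::euclidean_space"
  assumes "f \<in> Lp 2 M" "g \<in> Lp 2 M" "h \<in> Lp 2 M"
  shows "L2_inner M h (\<lambda>x. f x - g x) = L2_inner M h f - L2_inner M h g"
  using L2_inner_diff_left[OF assms] by (simp only: L2_inner_commute[of M h])

lemma L2_diff: "f \<in> Lp 2 M \<Longrightarrow> g \<in> Lp 2 M \<Longrightarrow> (\<lambda>x. f x - g x) \<in> Lp 2 M"
  by (rule Lp_diff(1)) auto

lemma L2_triangle:
  fixes f g :: "'a \<Rightarrow> 'b::euclidean_space"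
  assumes "f \<in> Lp 2 M" "g \<in> Lp 2 M"
  shows "Lp_norm 2 M (\<lambda>x. f x - g x) \<le> Lp_norm 2 M f + Lp_norm 2 M g"
proof (rule power2_le_imp_le)
  have "(Lp_norm 2 M (\<lambda>x. f x - g x))\<^sup>2
      = (Lp_norm 2 M f)\<^sup>2 - 2 * L2_inner M f g + (Lp_norm 2 M g)\<^sup>2"
    unfolding L2_norm_squared using assms
    by (simp add: L2_inner_diff_left L2_inner_diff_right L2_diff L2_inner_commute[of M g f])
  also have "\<dots> \<le> (Lp_norm 2 M f + Lp_norm 2 M g)\<^sup>2"
    using L2_Cauchy_Schwarz[OF assms] by (simp add: power2_sum)
  finally show "(Lp_norm 2 M (\<lambda>x. f x - g x))\<^sup>2 \<le> (Lp_norm 2 M f + Lp_norm 2 M g)\<^sup>2" .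
qed simp

lemma L2_norm_diff_le:
  fixes f g :: "'a \<Rightarrow> 'b::euclidean_space"
  assumes "f \<in> Lp 2 M" "g \<in> Lp 2 M"
  shows "\<bar>Lp_norm 2 M f - Lp_norm 2 M g\<bar> \<le> Lp_norm 2 M (\<lambda>x. f x - g x)"
proof -
  have "Lp_norm 2 M f \<le> Lp_norm 2 M (\<lambda>x. f x - g x) + Lp_norm 2 M g"
    if f: "f \<in> Lp 2 M" and g: "g \<in> Lp 2 M" for f g :: "'a \<Rightarrow> 'b"
  proof -
    have d: "(\<lambda>x. f x - g x) \<in> Lp 2 M" by (rule L2_diff[OF f g])
    have n: "(\<lambda>x. - g x) \<in> Lp 2 M" "Lp_norm 2 M (\<lambda>x. - g x) = Lp_norm 2 M g"
      using g by (auto simp: Lp_def Lp_norm_def)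
    show ?thesis using L2_triangle[OF d n(1)] n(2) by simp
  qed
  from this[OF assms] this[OF assms(2,1)] show ?thesis
    by (simp add: Lp_norm_minus_commute[of 2 M g f])
qed

section \<open>Functionals of strongly measurable functions\<close>

lemma borel_measurable_lebesgue_on_AE:
  fixes f g :: "'a::euclidean_space \<Rightarrow> 'b::euclidean_space"
  assumes S: "S \<in> sets lebesgue" and f: "f \<in> borel_measurable (lebesgue_on S)"
    and ae: "AE x in lebesgue_on S. f x = g x"
  shows "g \<in> borel_measurable (lebesgue_on S)"
proof -
  have "(\<lambda>x. indicator S x *\<^sub>R f x) \<in> borel_measurable lebesgue"
    using f S by (simp add: borel_measurable_restrict_space_iff)
  moreover have "AE x in lebesgue. indicator S x *\<^sub>R f x = indicator S x *\<^sub>R g x"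
    using ae S by (auto simp: AE_restrict_space_iff indicator_def elim!: eventually_mono)
  ultimately have "(\<lambda>x. indicator S x *\<^sub>R g x) \<in> borel_measurable lebesgue"
    by (rule borel_measurable_AE)
  then show ?thesis
    using S by (simp add: borel_measurable_restrict_space_iff)
qed

text \<open>The functional \<open>l\<close> is Lipschitz for \<open>d\<close>, so \<open>l (F t)\<close> is an almost everywhere limit of real-valued
  simple functions; completeness of Lebesgue measure removes the exceptional set.\<close>

lemma simple_limit_functional_measurable:
  fixes l :: "'x \<Rightarrow> real"
  assumes S: "S \<in> sets lebesgue" and F: "AE t in lebesgue_on S. F t \<in> X"
    and s: "\<And>n::nat. simple_function (lebesgue_on S) (s n)" "\<And>n. s n ` S \<subseteq> X"
    and conv: "AE t in lebesgue_on S. (\<lambda>n. d (s n t) (F t)) \<longlonglongrightarrow> 0"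
    and l: "\<And>g h. g \<in> X \<Longrightarrow> h \<in> X \<Longrightarrow> \<bar>l g - l h\<bar> \<le> C * d g h"
  shows "(\<lambda>t. l (F t)) \<in> borel_measurable (lebesgue_on S)"
proof -
  have meas: "(\<lambda>t. l (s n t)) \<in> borel_measurable (lebesgue_on S)" for n
    using simple_function_compose[OF s(1), of l n]
    by (auto intro: borel_measurable_simple_function simp: o_def)
  show ?thesis
  proof (rule borel_measurable_lebesgue_on_AE)
    show "(\<lambda>t. lim (\<lambda>n. l (s n t))) \<in> borel_measurable (lebesgue_on S)"
      using meas by (rule borel_measurable_lim_metric)
    show "AE t in lebesgue_on S. lim (\<lambda>n. l (s n t)) = l (F t)"
      using F conv AE_space
    proof eventually_elim
      case (elim t)
      then have "s n t \<in> X" for n using s(2)[of n] by (auto simp: image_subset_iff)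
      then have "norm (l (s n t) - l (F t)) \<le> C * d (s n t) (F t)" for n
        using elim(1) l[of "s n t" "F t"] by simp
      then have "eventually (\<lambda>n. norm (l (s n t) - l (F t)) \<le> C * d (s n t) (F t)) sequentially"
        by (intro always_eventually allI)
      then have "(\<lambda>n. l (s n t) - l (F t)) \<longlonglongrightarrow> 0"
        by (rule Lim_null_comparison) (rule tendsto_mult_right_zero[OF elim(2)])
      then have "(\<lambda>n. l (s n t)) \<longlonglongrightarrow> l (F t)"
        by (rule LIM_zero_cancel)
      then show ?case by (rule limI)
    qed
  qed (rule S)
qed

lemma Bochner_functional_measurable:
  fixes l :: "('a \<Rightarrow> 'b::real_normed_vector) \<Rightarrow> real"
  assumes F: "F \<in> Bochner p T X N"
    and l: "\<And>g h. g \<in> X \<Longrightarrow> h \<in> X \<Longrightarrow> \<bar>l g - l h\<bar> \<le> C * N (\<lambda>x. g x - h x)"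
  shows "(\<lambda>t. l (F t)) \<in> borel_measurable (lebesgue_on {0<..<T})"
proof -
  obtain s where s: "AE t in lebesgue_on {0<..<T}. F t \<in> X"
    "\<And>n::nat. simple_function (lebesgue_on {0<..<T}) (s n)" "\<And>n. s n ` {0<..<T} \<subseteq> X"
    "AE t in lebesgue_on {0<..<T}. (\<lambda>n. N (\<lambda>x. s n t x - F t x)) \<longlonglongrightarrow> 0"
    using F unfolding Bochner_def by blast
  show ?thesis
    by (rule simple_limit_functional_measurable[where d = "\<lambda>f g. N (\<lambda>x. f x - g x)", OF _ s l]) simp
qed

lemma Bochner_functional_integrable:
  fixes l :: "('a \<Rightarrow> 'b::real_normed_vector) \<Rightarrow> real"
  assumes F: "F \<in> Bochner p T X N" and p: "p \<ge> 1" and N: "\<And>g. g \<in> X \<Longrightarrow> 0 \<le> N g" and C: "C \<ge> 0"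
    and l: "\<And>g h. g \<in> X \<Longrightarrow> h \<in> X \<Longrightarrow> \<bar>l g - l h\<bar> \<le> C * N (\<lambda>x. g x - h x)"
    and l0: "\<And>g. g \<in> X \<Longrightarrow> \<bar>l g\<bar> \<le> C * N g"
  shows "integrable (lebesgue_on {0<..<T}) (\<lambda>t. l (F t))"
proof -
  interpret finite_measure "lebesgue_on {0<..<T}"
    by (rule finite_measure_lebesgue_on) simp
  have X: "AE t in lebesgue_on {0<..<T}. F t \<in> X"
    and int: "integrable (lebesgue_on {0<..<T}) (\<lambda>t. N (F t) powr p)"
    using F by (auto simp: Bochner_def)
  show ?thesis
  proof (rule Bochner_Integration.integrable_bound)
    show "integrable (lebesgue_on {0<..<T}) (\<lambda>t. C * (1 + N (F t) powr p))"
      using int by simp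
    show "(\<lambda>t. l (F t)) \<in> borel_measurable (lebesgue_on {0<..<T})"
      by (rule Bochner_functional_measurable[OF F l])
    show "AE t in lebesgue_on {0<..<T}. norm (l (F t)) \<le> norm (C * (1 + N (F t) powr p))"
      using X
    proof eventually_elim
      case (elim t)
      have "N (F t) \<le> 1 + N (F t) powr p"
      proof (cases "N (F t) \<le> 1")
        case False
        then have "N (F t) powr 1 \<le> N (F t) powr p"
          using p by (intro powr_mono) auto
        then show ?thesis using False by simp
      qed (use powr_ge_zero[of "N (F t)" p] in linarith)
      then have "C * N (F t) \<le> C * (1 + N (F t) powr p)"
        using C by (rule mult_left_mono)
      then show ?case using l0[OF elim] by simp
    qed
  qed
qed

section \<open>Positivity of the time-ordered Gram integral\<close>

lemma Bochner_L2_inner_integrable: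
  fixes F :: "real \<Rightarrow> 'a \<Rightarrow> 'b::euclidean_space"
  assumes F: "F \<in> Bochner p T (Lp 2 \<mu>) (Lp_norm 2 \<mu>)" and p: "p \<ge> 1" and g: "g \<in> Lp 2 \<mu>"
  shows "integrable (lebesgue_on {0<..<T}) (\<lambda>t. L2_inner \<mu> (F t) g)"
proof (rule Bochner_functional_integrable[OF F p, where C = "Lp_norm 2 \<mu> g"])
  fix f h :: "'a \<Rightarrow> 'b" assume fh: "f \<in> Lp 2 \<mu>" "h \<in> Lp 2 \<mu>"
  show "\<bar>L2_inner \<mu> f g - L2_inner \<mu> h g\<bar> \<le> Lp_norm 2 \<mu> g * Lp_norm 2 \<mu> (\<lambda>x. f x - h x)"
    using L2_Cauchy_Schwarz[OF L2_diff[OF fh] g] L2_inner_diff_left[OF fh g]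
    by (simp add: mult.commute)
next
  fix f :: "'a \<Rightarrow> 'b" assume "f \<in> Lp 2 \<mu>"
  from L2_Cauchy_Schwarz[OF this g] show "\<bar>L2_inner \<mu> f g\<bar> \<le> Lp_norm 2 \<mu> g * Lp_norm 2 \<mu> f"
    by (simp add: mult.commute)
qed auto

text \<open>Simple approximants that converge at every time and are dominated by twice the norm of the limit.
  The function is changed on a null set, because a product of Lebesgue measures is not complete and an
  exceptional set of times would spoil measurability in two time variables. Where an approximant is too
  large it is replaced by \<open>0\<close>; this keeps it simple.\<close>

lemma Bochner_L2_approximation:
  fixes F :: "real \<Rightarrow> 'a \<Rightarrow> 'b::euclidean_space"
  assumes F: "F \<in> Bochner 2 T (Lp 2 \<mu>) (Lp_norm 2 \<mu>)"
  defines "M \<equiv> lebesgue_on {0<..<T}"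
  obtains F' s where
    "AE t in M. F' t = F t" "\<And>t. F' t \<in> Lp 2 \<mu>"
    "(\<lambda>t. Lp_norm 2 \<mu> (F' t)) \<in> borel_measurable M"
    "integrable M (\<lambda>t. (Lp_norm 2 \<mu> (F' t))\<^sup>2)"
    "\<And>n::nat. simple_function M (s n)" "\<And>n t. s n t \<in> Lp 2 \<mu>"
    "\<And>n t. Lp_norm 2 \<mu> (s n t) \<le> 2 * Lp_norm 2 \<mu> (F' t)"
    "\<And>t. (\<lambda>n. Lp_norm 2 \<mu> (\<lambda>x. s n t x - F' t x)) \<longlonglongrightarrow> 0"
proof -
  let ?N = "Lp_norm 2 \<mu> :: ('a \<Rightarrow> 'b) \<Rightarrow> real"
  obtain \<sigma> where X: "AE t in M. F t \<in> Lp 2 \<mu>"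
    and \<sigma>: "\<And>n::nat. simple_function M (\<sigma> n)" "\<And>n. \<sigma> n ` {0<..<T} \<subseteq> Lp 2 \<mu>"
    and conv: "AE t in M. (\<lambda>n. ?N (\<lambda>x. \<sigma> n t x - F t x)) \<longlonglongrightarrow> 0"
    and int: "integrable M (\<lambda>t. ?N (F t) powr 2)"
    using F unfolding Bochner_def M_def by blast
  have NF: "(\<lambda>t. ?N (F t)) \<in> borel_measurable M"
    unfolding M_def
    by (rule Bochner_functional_measurable[OF F, where C = 1]) (simp add: L2_norm_diff_le)
  have "AE t in M. F t \<in> Lp 2 \<mu> \<and> (\<lambda>n. ?N (\<lambda>x. \<sigma> n t x - F t x)) \<longlonglongrightarrow> 0"
    using X conv by eventually_elim simp
  then obtain Z where Z: "Z \<in> null_sets M"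
    "{t \<in> space M. \<not> (F t \<in> Lp 2 \<mu> \<and> (\<lambda>n. ?N (\<lambda>x. \<sigma> n t x - F t x)) \<longlonglongrightarrow> 0)} \<subseteq> Z"
    by (auto simp: eventually_ae_filter)
  define G where "G = space M - Z"
  have G_sets [measurable]: "G \<in> sets M" using Z(1) by (auto simp: G_def)
  have G: "F t \<in> Lp 2 \<mu>" "(\<lambda>n. ?N (\<lambda>x. \<sigma> n t x - F t x)) \<longlonglongrightarrow> 0" "t \<in> {0<..<T}" if "t \<in> G" for t
    using that Z(2) by (auto simp: G_def M_def)
  have G_AE: "AE t in M. t \<in> G"
    using AE_not_in[OF Z(1)] AE_space by eventually_elim (simp add: G_def)
  have zero: "(\<lambda>x. 0 :: 'b) \<in> Lp 2 \<mu>" "?N (\<lambda>x. 0) = 0"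
    by (auto simp: Lp_def Lp_norm_def)
  define F' where "F' t = (if t \<in> G then F t else (\<lambda>x. 0))" for t
  \<comment> \<open>The times at which the original approximant obeys the bound by which it will be dominated.\<close>
  define A where "A n = {t \<in> space M. t \<in> G \<and> ?N (\<sigma> n t) \<le> 2 * ?N (F t)}" for n
  define s where "s n t = (if t \<in> A n then \<sigma> n t else (\<lambda>x. 0))" for n t
  have N\<sigma>: "(\<lambda>t. ?N (\<sigma> n t)) \<in> borel_measurable M" for n
    using simple_function_compose[OF \<sigma>(1), of ?N n]
    by (auto intro: borel_measurable_simple_function simp: o_def)
  have A_sets: "A n \<in> sets M" for n
    unfolding A_def using NF N\<sigma>[of n] by measurable
  show thesis
  proof (rule that)
    show ae: "AE t in M. F' t = F t"
      using G_AE by eventually_elim (simp add: F'_def)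
    show F'_Lp: "F' t \<in> Lp 2 \<mu>" for t
      using G(1) zero by (simp add: F'_def)
    have "(\<lambda>t. ?N (F' t)) = (\<lambda>t. if t \<in> G then ?N (F t) else 0)"
      by (auto simp: F'_def zero)
    then show NF': "(\<lambda>t. ?N (F' t)) \<in> borel_measurable M"
      using NF by simp
    have "integrable M (\<lambda>t. (?N (F' t))\<^sup>2) \<longleftrightarrow> integrable M (\<lambda>t. ?N (F t) powr 2)"
      using NF NF' ae by (intro integrable_cong_AE) (auto elim!: eventually_mono)
    then show "integrable M (\<lambda>t. (?N (F' t))\<^sup>2)" using int by simp
    show "simple_function M (s n)" for n
      unfolding s_def
      using A_sets by (intro simple_function_If_set \<sigma>) auto
    show "s n t \<in> Lp 2 \<mu>" for n t
    proof (cases "t \<in> A n")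
      case True
      then have "t \<in> {0<..<T}" using G(3) by (simp add: A_def)
      then show ?thesis using True \<sigma>(2)[of n] by (simp add: s_def image_subset_iff)
    qed (simp add: s_def zero)
    show "?N (s n t) \<le> 2 * ?N (F' t)" for n t
      by (auto simp: s_def zero A_def F'_def)
    show "(\<lambda>n. ?N (\<lambda>x. s n t x - F' t x)) \<longlonglongrightarrow> 0" for t
    proof (cases "t \<in> G")
      case False
      then show ?thesis by (simp add: s_def A_def F'_def zero)
    next
      case True
      have \<sigma>_Lp: "\<sigma> n t \<in> Lp 2 \<mu>" for n
        using G(3)[OF True] \<sigma>(2)[of n] by (simp add: image_subset_iff)
      show ?thesis
      proof (cases "?N (F t) = 0")
        case N0: True
        have "?N (\<lambda>x. s n t x - F' t x) = 0" for n
        proof -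
          have "?N (s n t) = 0"
            using N0 by (auto simp: s_def A_def zero intro: antisym)
          then have "?N (\<lambda>x. s n t x - F t x) \<le> 0"
            using L2_triangle[of "s n t" \<mu> "F t"] N0 G(1)[OF True] \<sigma>_Lp zero by (auto simp: s_def)
          then show ?thesis using True by (simp add: F'_def antisym)
        qed
        then show ?thesis by simp
      next
        case False
        then have pos: "?N (F t) > 0" by (simp add: less_le)
        have "eventually (\<lambda>n. ?N (\<lambda>x. \<sigma> n t x - F t x) < ?N (F t)) sequentially"
          using G(2)[OF True] pos by (rule order_tendstoD)
        then have "eventually (\<lambda>n. ?N (\<lambda>x. \<sigma> n t x - F t x) = ?N (\<lambda>x. s n t x - F' t x)) sequentially"
        proof eventually_elim
          case (elim n)
          have "\<bar>?N (\<sigma> n t) - ?N (F t)\<bar> \<le> ?N (\<lambda>x. \<sigma> n t x - F t x)"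
            by (rule L2_norm_diff_le[OF \<sigma>_Lp G(1)[OF True]])
          then have "?N (\<sigma> n t) \<le> 2 * ?N (F t)" using elim by linarith
          then have "t \<in> A n" using True by (auto simp: A_def G_def)
          then show ?case using True by (simp add: s_def F'_def)
        qed
        then show ?thesis by (rule Lim_transform_eventually[OF G(2)[OF True]])
      qed
    qed
  qed
qed

lemma simple_function_expansion:
  fixes h :: "'x \<Rightarrow> real"
  assumes s: "simple_function M s" and "t \<in> space M"
  shows "h (s t) = (\<Sum>a\<in>s ` space M. h a * indicator (s -` {a} \<inter> space M) t)"
proof -
  have "(\<Sum>a\<in>s ` space M. h a * indicator (s -` {a} \<inter> space M) t)
      = (\<Sum>a\<in>s ` space M. if a = s t then h a else 0)"
    using assms by (intro sum.cong) (auto simp: indicator_def)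
  also have "\<dots> = h (s t)"
    using simple_functionD(1)[OF s] assms by (subst sum.delta) auto
  finally show ?thesis by simp
qed

lemma integral_simple_function_compose:
  fixes h :: "'x \<Rightarrow> real"
  assumes fin: "finite_measure M" and s: "simple_function M s"
  shows "(LINT t|M. h (s t)) = (\<Sum>a\<in>s ` space M. h a * measure M (s -` {a} \<inter> space M))"
proof -
  interpret finite_measure M by (rule fin)
  have "(LINT t|M. h (s t)) = (LINT t|M. (\<Sum>a\<in>s ` space M. h a * indicator (s -` {a} \<inter> space M) t))"
    by (intro Bochner_Integration.integral_cong refl simple_function_expansion s)
  also have "\<dots> = (\<Sum>a\<in>s ` space M. LINT t|M. h a * indicator (s -` {a} \<inter> space M) t)"
    using simple_functionD(2)[OF s]
    by (intro Bochner_Integration.integral_sum integrable_mult_right integrable_real_indicator)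
      (auto simp: emeasure_eq_measure)
  also have "\<dots> = (\<Sum>a\<in>s ` space M. h a * measure M (s -` {a} \<inter> space M))"
    by (intro sum.cong refl) simp
  finally show ?thesis .
qed

lemma measurable_simple_function_pair:
  fixes h :: "'x \<Rightarrow> 'x \<Rightarrow> real"
  assumes s: "simple_function M s"
  shows "(\<lambda>(t, t'). h (s t) (s t')) \<in> borel_measurable (M \<Otimes>\<^sub>M M)"
proof -
  have eq: "(\<lambda>(t, t'). h (s t) (s t')) z
    = (\<Sum>a\<in>s ` space M. \<Sum>b\<in>s ` space M. h a b * indicator (s -` {b} \<inter> space M) (snd z)
         * indicator (s -` {a} \<inter> space M) (fst z))" if "z \<in> space (M \<Otimes>\<^sub>M M)" for z
  proof -
    have z: "fst z \<in> space M" "snd z \<in> space M" using that by (auto simp: space_pair_measure)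
    show ?thesis
      unfolding sum_distrib_right[symmetric] simple_function_expansion[OF s z(2), symmetric]
        simple_function_expansion[OF s z(1), of "\<lambda>a. h a (s (snd z))", symmetric]
      by (simp add: case_prod_beta)
  qed
  note simple_functionD(2)[OF s, measurable]
  show ?thesis
    by (subst measurable_cong[OF eq]) measurable
qed

text \<open>For a simple function the double integral is the squared norm of the finite sum
  \<open>\<Sum>a. M {s = a} a\<close>, which is the time integral of \<open>s\<close>.\<close>

lemma L2_double_integral_simple_nonneg:
  fixes s :: "'t \<Rightarrow> 'a \<Rightarrow> 'b::euclidean_space"
  assumes fin: "finite_measure M" and s: "simple_function M s" "\<And>t. s t \<in> Lp 2 \<mu>"
  shows "0 \<le> (LINT t|M. LINT t'|M. L2_inner \<mu> (s t) (s t'))"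
proof -
  define R where "R = s ` space M"
  define c where "c a = measure M (s -` {a} \<inter> space M)" for a
  have R: "finite R" "\<And>a. a \<in> R \<Longrightarrow> a \<in> Lp 2 \<mu>"
    using simple_functionD(1)[OF s(1)] s(2) by (auto simp: R_def)
  have int: "integrable \<mu> (\<lambda>x. a x \<bullet> b x * c b * c a)" if "a \<in> R" "b \<in> R" for a b
    using L2_inner_integrable[OF R(2)[OF that(1)] R(2)[OF that(2)]] by simp
  have "(LINT t|M. LINT t'|M. L2_inner \<mu> (s t) (s t'))
      = (\<Sum>a\<in>R. (\<Sum>b\<in>R. L2_inner \<mu> a b * c b) * c a)"
    unfolding integral_simple_function_compose[OF fin s(1), where h = "L2_inner \<mu> (s _)"]
      integral_simple_function_compose[OF fin s(1), where h = "\<lambda>a. (\<Sum>b\<in>s ` space M. L2_inner \<mu> a b * measure M (s -` {b} \<inter> space M))"]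
    by (simp add: R_def c_def)
  also have "\<dots> = (\<Sum>a\<in>R. \<Sum>b\<in>R. LINT x|\<mu>. a x \<bullet> b x * c b * c a)"
    by (simp add: sum_distrib_right)
  also have "\<dots> = (LINT x|\<mu>. (\<Sum>a\<in>R. \<Sum>b\<in>R. a x \<bullet> b x * c b * c a))"
    using int by (simp add: Bochner_Integration.integral_sum Bochner_Integration.integrable_sum)
  also have "\<dots> = (LINT x|\<mu>. (\<Sum>a\<in>R. c a *\<^sub>R a x) \<bullet> (\<Sum>a\<in>R. c a *\<^sub>R a x))"
    by (intro Bochner_Integration.integral_cong refl)
      (simp only: inner_sum_left, simp add: inner_sum_right sum_distrib_left mult_ac)
  finally show ?thesis by (simp add: Bochner_Integration.integral_nonneg)
qed

lemma AE_lebesgue_on_neq: "AE t in lebesgue_on S. t \<noteq> (c::real)" if "S \<in> sets lebesgue"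
proof -
  have "AE t in lebesgue. t \<noteq> c"
    using AE_lborel_singleton[of c] by (rule AE_completion)
  then show ?thesis using that by (simp add: AE_restrict_space_iff eventually_mono)
qed

text \<open>This replaces the identity \<open>\<integral>\<langle>Z, Z'\<rangle> = \<parallel>Z(T)\<parallel>\<^sup>2 / 2\<close> for the primitive \<open>Z\<close> of \<open>F\<close>. The kernel
  \<open>\<langle>F t, F t'\<rangle>\<close> is symmetric, so its integral over the triangle \<open>t' < t\<close> is half of its integral over
  the square. The latter is nonnegative as the limit of the corresponding integrals for simple functions.
  The function \<open>J\<close> is a measurable version of the inner integral.\<close>

lemma L2_time_ordered_integral_nonneg:
  fixes F :: "real \<Rightarrow> 'a \<Rightarrow> 'b::euclidean_space"
  assumes F: "F \<in> Bochner 2 T (Lp 2 \<mu>) (Lp_norm 2 \<mu>)"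
  defines "M \<equiv> lebesgue_on {0<..<T}"
  obtains J where "integrable M J" "0 \<le> (LINT t|M. J t)"
    "AE t in M. J t = (LINT t'|M. indicator {..<t} t' * L2_inner \<mu> (F t') (F t))"
proof -
  let ?N = "Lp_norm 2 \<mu> :: ('a \<Rightarrow> 'b) \<Rightarrow> real"
  have fin: "finite_measure M"
    unfolding M_def by (rule finite_measure_lebesgue_on) simp
  interpret M: finite_measure M by (rule fin)
  interpret P: pair_sigma_finite M M ..
  obtain F' s where F'_AE: "AE t in M. F' t = F t" and F'_Lp: "\<And>t. F' t \<in> Lp 2 \<mu>"
    and NF' [measurable]: "(\<lambda>t. ?N (F' t)) \<in> borel_measurable M"
    and NF'_int: "integrable M (\<lambda>t. (?N (F' t))\<^sup>2)"
    and s: "\<And>n::nat. simple_function M (s n)" "\<And>n t. s n t \<in> Lp 2 \<mu>"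
      "\<And>n t. ?N (s n t) \<le> 2 * ?N (F' t)"
      "\<And>t. (\<lambda>n. ?N (\<lambda>x. s n t x - F' t x)) \<longlonglongrightarrow> 0"
    by (rule Bochner_L2_approximation[OF F, folded M_def]) (rule that; (assumption | simp))
  define H where "H = (\<lambda>(t, t'). L2_inner \<mu> (F' t) (F' t'))"
  define Hn where "Hn n = (\<lambda>(t, t'). L2_inner \<mu> (s n t) (s n t'))" for n
  define W where "W = (\<lambda>(t, t'). (2 * ?N (F' t)) * (2 * ?N (F' t')))"
  have Hn_meas [measurable]: "Hn n \<in> borel_measurable (M \<Otimes>\<^sub>M M)" for n
    unfolding Hn_def by (rule measurable_simple_function_pair[OF s(1)])
  have Hn_le: "\<bar>Hn n z\<bar> \<le> W z" for n z
  proof -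
    obtain t t' where z: "z = (t, t')" by (cases z)
    have "\<bar>L2_inner \<mu> (s n t) (s n t')\<bar> \<le> ?N (s n t) * ?N (s n t')"
      by (rule L2_Cauchy_Schwarz[OF s(2) s(2)])
    also have "\<dots> \<le> (2 * ?N (F' t)) * (2 * ?N (F' t'))"
      by (intro mult_mono s(3)) auto
    finally show ?thesis by (simp add: z Hn_def W_def)
  qed
  have Hn_lim: "(\<lambda>n. Hn n z) \<longlonglongrightarrow> H z" for z
  proof -
    obtain t t' where z: "z = (t, t')" by (cases z)
    have "\<bar>Hn n z - H z\<bar> \<le> ?N (\<lambda>x. s n t x - F' t x) * (2 * ?N (F' t'))
          + ?N (F' t) * ?N (\<lambda>x. s n t' x - F' t' x)" for n
    proof -
      have "Hn n z - H z = L2_inner \<mu> (\<lambda>x. s n t x - F' t x) (s n t')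
          + L2_inner \<mu> (F' t) (\<lambda>x. s n t' x - F' t' x)"
        by (simp add: z Hn_def H_def L2_inner_diff_left L2_inner_diff_right s(2) F'_Lp)
      moreover have "\<bar>L2_inner \<mu> (\<lambda>x. s n t x - F' t x) (s n t')\<bar>
          \<le> ?N (\<lambda>x. s n t x - F' t x) * (2 * ?N (F' t'))"
        by (rule order_trans[OF L2_Cauchy_Schwarz[OF L2_diff[OF s(2) F'_Lp] s(2)]])
          (intro mult_left_mono s(3) Lp_norm_nonneg)
      moreover have "\<bar>L2_inner \<mu> (F' t) (\<lambda>x. s n t' x - F' t' x)\<bar>
          \<le> ?N (F' t) * ?N (\<lambda>x. s n t' x - F' t' x)"
        by (rule L2_Cauchy_Schwarz[OF F'_Lp L2_diff[OF s(2) F'_Lp]])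
      ultimately show ?thesis by linarith
    qed
    then have "eventually (\<lambda>n. norm (Hn n z - H z) \<le> ?N (\<lambda>x. s n t x - F' t x) * (2 * ?N (F' t'))
          + ?N (F' t) * ?N (\<lambda>x. s n t' x - F' t' x)) sequentially"
      by (intro always_eventually allI) simp
    moreover have "(\<lambda>n. ?N (\<lambda>x. s n t x - F' t x) * (2 * ?N (F' t'))
          + ?N (F' t) * ?N (\<lambda>x. s n t' x - F' t' x)) \<longlonglongrightarrow> 0"
      by (rule tendsto_add_zero[OF tendsto_mult_left_zero[OF s(4)] tendsto_mult_right_zero[OF s(4)]])
    ultimately have "(\<lambda>n. Hn n z - H z) \<longlonglongrightarrow> 0"
      by (rule Lim_null_comparison)
    then show ?thesis by (rule LIM_zero_cancel)
  qed
  have H_meas [measurable]: "H \<in> borel_measurable (M \<Otimes>\<^sub>M M)"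
    by (rule borel_measurable_LIMSEQ_real[OF Hn_lim Hn_meas])
  have N_int: "integrable M (\<lambda>t. 2 * ?N (F' t))"
  proof (rule Bochner_Integration.integrable_bound)
    show "integrable M (\<lambda>t. 1 + (?N (F' t))\<^sup>2)" using NF'_int by simp
    have "2 * ?N (F' t) \<le> 1 + (?N (F' t))\<^sup>2" for t
      using sum_squares_bound[of 1 "?N (F' t)"] by simp
    then show "AE t in M. norm (2 * ?N (F' t)) \<le> norm (1 + (?N (F' t))\<^sup>2)"
      by (intro AE_I2) simp
  qed measurable
  have W_int: "integrable (M \<Otimes>\<^sub>M M) W"
  proof (rule P.Fubini_integrable)
    show "W \<in> borel_measurable (M \<Otimes>\<^sub>M M)" unfolding W_def by measurable
    show "integrable M (\<lambda>t. LINT t'|M. norm (W (t, t')))"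
      using N_int by (simp add: W_def abs_mult)
    show "AE t in M. integrable M (\<lambda>t'. W (t, t'))"
      using N_int by (simp add: W_def)
  qed
  have ae: "AE z in M \<Otimes>\<^sub>M M. (\<lambda>n. Hn n z) \<longlonglongrightarrow> H z"
    "\<And>n. AE z in M \<Otimes>\<^sub>M M. norm (Hn n z) \<le> W z"
    using Hn_lim Hn_le by auto
  have H_int: "integrable (M \<Otimes>\<^sub>M M) H"
    by (rule integrable_dominated_convergence[OF H_meas Hn_meas W_int ae])
  have Hn_int: "integrable (M \<Otimes>\<^sub>M M) (Hn n)" for n
    by (rule integrable_dominated_convergence2[OF H_meas Hn_meas W_int ae])
  have lim: "(\<lambda>n. integral\<^sup>L (M \<Otimes>\<^sub>M M) (Hn n)) \<longlonglongrightarrow> integral\<^sup>L (M \<Otimes>\<^sub>M M) H"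
    by (rule integral_dominated_convergence[OF H_meas Hn_meas W_int ae])
  have "0 \<le> integral\<^sup>L (M \<Otimes>\<^sub>M M) (Hn n)" for n
    using L2_double_integral_simple_nonneg[OF fin s(1,2), of n] P.integral_fst'[OF Hn_int[of n]]
    by (simp add: Hn_def)
  then have H_nonneg: "0 \<le> integral\<^sup>L (M \<Otimes>\<^sub>M M) H"
    by (intro LIMSEQ_le_const[OF lim]) auto
  have id_meas [measurable]: "(\<lambda>t. t) \<in> borel_measurable M"
    unfolding M_def using id_borel_measurable_lebesgue_on by (simp add: id_def)
  define K where "K = (\<lambda>(t, t'). indicator {..<t} t' * H (t, t'))"
  define K' where "K' = (\<lambda>(t, t'). indicator {t<..} t' * H (t, t'))"
  have K_eq: "K = (\<lambda>z. if snd z < fst z then H z else 0)" "K' = (\<lambda>z. if fst z < snd z then H z else 0)"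
    by (auto simp: K_def K'_def fun_eq_iff)
  have [measurable]: "fst \<in> borel_measurable (M \<Otimes>\<^sub>M M)" "snd \<in> borel_measurable (M \<Otimes>\<^sub>M M)"
    using measurable_compose[OF measurable_fst id_meas] measurable_compose[OF measurable_snd id_meas] by auto
  have K_meas [measurable]: "K \<in> borel_measurable (M \<Otimes>\<^sub>M M)" "K' \<in> borel_measurable (M \<Otimes>\<^sub>M M)"
    unfolding K_eq by measurable
  have K_int: "integrable (M \<Otimes>\<^sub>M M) K" "integrable (M \<Otimes>\<^sub>M M) K'"
    by (rule Bochner_Integration.integrable_bound[OF H_int]; simp add: K_eq)+
  have diag: "integral\<^sup>L (M \<Otimes>\<^sub>M M) H = integral\<^sup>L (M \<Otimes>\<^sub>M M) (\<lambda>z. K z + K' z)"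
  proof (rule integral_cong_AE)
    show "AE z in M \<Otimes>\<^sub>M M. H z = K z + K' z"
    proof (rule P.AE_pair_measure)
      show "{z \<in> space (M \<Otimes>\<^sub>M M). H z = K z + K' z} \<in> sets (M \<Otimes>\<^sub>M M)" by measurable
      show "AE t in M. AE t' in M. H (t, t') = K (t, t') + K' (t, t')"
      proof (rule AE_I2)
        fix t
        have "AE t' in M. t' \<noteq> t"
          unfolding M_def by (rule AE_lebesgue_on_neq) simp
        then show "AE t' in M. H (t, t') = K (t, t') + K' (t, t')"
          by (rule eventually_mono) (auto simp: K_eq)
      qed
    qed
  qed measurable
  have swap: "integral\<^sup>L (M \<Otimes>\<^sub>M M) K' = integral\<^sup>L (M \<Otimes>\<^sub>M M) K"
  proof -
    have "H (t, t') = H (t', t)" for t t'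
      unfolding H_def prod.case by (rule L2_inner_commute)
    then have "K' = (\<lambda>(t, t'). K (t', t))"
      by (auto simp: K_eq fun_eq_iff)
    then show ?thesis using P.integral_product_swap[OF K_meas(1)] by simp
  qed
  have K_nonneg: "0 \<le> integral\<^sup>L (M \<Otimes>\<^sub>M M) K"
    using H_nonneg diag swap K_int by simp
  show thesis
  proof (rule that)
    show "integrable M (\<lambda>t. LINT t'|M. K (t, t'))"
      by (rule P.integrable_fst'[OF K_int(1)])
    show "0 \<le> (LINT t|M. LINT t'|M. K (t, t'))"
      using K_nonneg P.integral_fst'[OF K_int(1)] by simp
    show "AE t in M. (LINT t'|M. K (t, t')) = (LINT t'|M. indicator {..<t} t' * L2_inner \<mu> (F t') (F t))"
      using F'_AE AE_space
    proof eventually_elim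
      case (elim t)
      then have Ft: "F t \<in> Lp 2 \<mu>" using F'_Lp[of t] by simp
      have [measurable]: "(\<lambda>t'. L2_inner \<mu> (F t') (F t)) \<in> borel_measurable M"
        unfolding M_def
        by (rule borel_measurable_integrable[OF Bochner_L2_inner_integrable[OF F _ Ft]]) simp
      show ?case
      proof (rule integral_cong_AE)
        show "(\<lambda>t'. K (t, t')) \<in> borel_measurable M"
          using elim(2) by measurable
        have "(\<lambda>t'. indicator {..<t} t' * L2_inner \<mu> (F t') (F t))
            = (\<lambda>t'. if t' < t then L2_inner \<mu> (F t') (F t) else 0)" by auto
        also have "\<dots> \<in> borel_measurable M" by measurable
        finally show "(\<lambda>t'. indicator {..<t} t' * L2_inner \<mu> (F t') (F t)) \<in> borel_measurable M" .
        show "AE t' in M. K (t, t') = indicator {..<t} t' * L2_inner \<mu> (F t') (F t)"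
          using F'_AE by eventually_elim (simp add: K_def H_def elim(1) L2_inner_commute[of \<mu> "F t"])
      qed
    qed
  qed
qed

section \<open>Weighted measures\<close>

lemma sets_weighted [simp]: "sets (weighted \<Omega> \<rho>) = sets (lebesgue_on \<Omega>)"
  and space_weighted [simp]: "space (weighted \<Omega> \<rho>) = \<Omega>"
  by (simp_all add: weighted_def)

lemma borel_measurable_weighted [simp]:
  "borel_measurable (weighted \<Omega> \<rho>) = borel_measurable (lebesgue_on \<Omega>)"
  by (rule measurable_cong_sets) simp_all

lemma AE_weightedI:
  assumes "\<rho> \<in> borel_measurable (lebesgue_on \<Omega>)" "AE x in lebesgue_on \<Omega>. P x"
  shows "AE x in weighted \<Omega> \<rho>. P x"
  using assms unfolding weighted_def by (subst AE_density) auto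

lemma AE_weightedD:
  assumes "\<rho> \<in> borel_measurable (lebesgue_on \<Omega>)" "AE x in lebesgue_on \<Omega>. \<rho> x > 0"
    and "AE x in weighted \<Omega> \<rho>. P x"
  shows "AE x in lebesgue_on \<Omega>. P x"
proof -
  have "AE x in lebesgue_on \<Omega>. 0 < ennreal (\<rho> x) \<longrightarrow> P x"
    using assms(1,3) unfolding weighted_def by (subst (asm) AE_density) auto
  with assms(2) show ?thesis by eventually_elim simp
qed

lemma Lp_cong_AE_weighted:
  fixes f g :: "'a::euclidean_space \<Rightarrow> 'b::euclidean_space"
  assumes \<Omega>: "\<Omega> \<in> sets lebesgue" and \<rho>: "\<rho> \<in> borel_measurable (lebesgue_on \<Omega>)"
    and f: "f \<in> Lp p (weighted \<Omega> \<rho>)" and ae: "AE x in lebesgue_on \<Omega>. g x = f x"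
  shows "g \<in> Lp p (weighted \<Omega> \<rho>)" "Lp_norm p (weighted \<Omega> \<rho>) g = Lp_norm p (weighted \<Omega> \<rho>) f"
proof -
  have "f \<in> borel_measurable (lebesgue_on \<Omega>)" using Lp_measurable[OF f] by simp
  moreover have "AE x in lebesgue_on \<Omega>. f x = g x" using ae by eventually_elim simp
  ultimately have "g \<in> borel_measurable (weighted \<Omega> \<rho>)"
    using borel_measurable_lebesgue_on_AE[OF \<Omega>] by auto
  from Lp_cong_AE[OF f this AE_weightedI[OF \<rho> ae]]
  show "g \<in> Lp p (weighted \<Omega> \<rho>)" "Lp_norm p (weighted \<Omega> \<rho>) g = Lp_norm p (weighted \<Omega> \<rho>) f" .
qed

lemma bounded_compact_support_Lp:
  fixes g :: "'a::euclidean_space \<Rightarrow> 'b::{banach, second_countable_topology}"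
  assumes \<rho>: "\<rho> \<in> borel_measurable (lebesgue_on \<Omega>)" "AE x in lebesgue_on \<Omega>. \<rho> x > 0"
    "\<rho> \<in> L1_loc \<Omega> (lebesgue_on \<Omega>)"
    and K: "compact K" "K \<subseteq> \<Omega>"
    and g: "g \<in> borel_measurable (lebesgue_on \<Omega>)" "\<And>x. x \<notin> K \<Longrightarrow> g x = 0" "\<And>x. norm (g x) \<le> B"
    and p: "p > 0"
  shows "g \<in> Lp p (weighted \<Omega> \<rho>)"
proof -
  have [measurable]: "g \<in> borel_measurable (lebesgue_on \<Omega>)" "\<rho> \<in> borel_measurable (lebesgue_on \<Omega>)"
    using g \<rho> by auto
  have "integrable (lebesgue_on \<Omega>) (\<lambda>x. (norm (g x) powr p) *\<^sub>R \<rho> x)"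
  proof (rule L1_loc_scaleR_integrable[OF \<rho>(3) K])
    show "\<bar>norm (g x) powr p\<bar> \<le> B powr p" for x
      using g(3)[of x] p by (simp add: powr_mono2)
  qed (use g(2) in auto)
  then have "integrable (weighted \<Omega> \<rho>) (\<lambda>x. norm (g x) powr p)"
    unfolding weighted_def using \<rho>(2)
    by (subst integrable_density) (auto simp: mult.commute elim!: eventually_mono)
  then show ?thesis using g(1) by (simp add: Lp_def)
qed

lemma test_function_Lp:
  assumes \<rho>: "\<rho> \<in> borel_measurable (lebesgue_on \<Omega>)" "AE x in lebesgue_on \<Omega>. \<rho> x > 0"
    "\<rho> \<in> L1_loc \<Omega> (lebesgue_on \<Omega>)"
    and \<phi>: "\<phi> \<in> test_functions \<Omega>" and p: "p > 0"
  shows "\<phi> \<in> Lp p (weighted \<Omega> \<rho>)" "grad \<phi> \<in> Lp p (weighted \<Omega> \<rho>)"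
proof -
  obtain K B where K: "compact K" "K \<subseteq> \<Omega>" "\<And>x. x \<notin> K \<Longrightarrow> \<phi> x = 0"
    "\<And>x. x \<notin> K \<Longrightarrow> grad \<phi> x = 0" "\<And>x. \<bar>\<phi> x\<bar> \<le> B" "\<And>x. norm (grad \<phi> x) \<le> B"
    using test_function_bounds[OF \<phi>] by metis
  show "\<phi> \<in> Lp p (weighted \<Omega> \<rho>)"
    by (rule bounded_compact_support_Lp[OF \<rho> K(1,2) test_function_measurable(1)[OF \<phi>] K(3) _ p])
      (use K(5) in auto)
  show "grad \<phi> \<in> Lp p (weighted \<Omega> \<rho>)"
    by (rule bounded_compact_support_Lp[OF \<rho> K(1,2) test_function_measurable(2)[OF \<phi>] K(4,6) p])
qed

lemma nn_integral_less_top: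
  fixes f :: "'a \<Rightarrow> real"
  assumes "integrable M f"
  shows "(\<integral>\<^sup>+ x. ennreal (f x) \<partial>M) < \<infinity>"
proof -
  have "(\<integral>\<^sup>+ x. ennreal (f x) \<partial>M) \<le> (\<integral>\<^sup>+ x. ennreal (norm (f x)) \<partial>M)"
    by (intro nn_integral_mono ennreal_leI) simp
  also have "\<dots> < \<infinity>"
    using assms unfolding integrable_iff_bounded by blast
  finally show ?thesis .
qed

text \<open>Pairing with a bounded function supported in \<open>K\<close> is a bounded functional on \<open>L\<^sup>1(K)\<close>; this gives
  both measurability in time of the pairings and absolute convergence of the double integrals.\<close>

lemma L1_pairing:
  fixes f g :: "'a \<Rightarrow> real"
  assumes K: "K \<in> sets M" and f: "f \<in> Lp 1 (restrict_space M K)"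
    and g: "g \<in> borel_measurable M" "\<And>x. x \<notin> K \<Longrightarrow> g x = 0" "\<And>x. \<bar>g x\<bar> \<le> B"
  shows "integrable M (\<lambda>x. f x * g x)" "\<bar>LINT x|M. f x * g x\<bar> \<le> B * Lp_norm 1 (restrict_space M K) f"
    and "(\<integral>\<^sup>+ x. ennreal \<bar>f x * g x\<bar> \<partial>M) \<le> ennreal (B * Lp_norm 1 (restrict_space M K) f)"
proof -
  have f_int: "integrable (restrict_space M K) (\<lambda>x. \<bar>f x\<bar>)"
    and f_meas [measurable]: "f \<in> borel_measurable (restrict_space M K)"
    using f by (auto simp: Lp_def)
  have KM: "K \<inter> space M \<in> sets M" using K by auto
  have N: "Lp_norm 1 (restrict_space M K) f = (LINT x|restrict_space M K. \<bar>f x\<bar>)"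
    by (simp add: Lp_norm_def integral_nonneg)
  have int_norm: "integrable M (\<lambda>x. indicator K x *\<^sub>R \<bar>f x\<bar>)"
    by (rule integrable_restrict_space[OF KM, THEN iffD1, OF f_int])
  have "(\<lambda>x. indicator K x *\<^sub>R f x) \<in> borel_measurable M"
    by (rule borel_measurable_restrict_space_iff[OF KM, THEN iffD1, OF f_meas])
  then have m: "(\<lambda>x. (indicator K x *\<^sub>R f x) * g x) \<in> borel_measurable M"
    using g(1) by (rule borel_measurable_times)
  have eq: "f x * g x = (indicator K x *\<^sub>R f x) * g x" for x
    using g(2)[of x] by (cases "x \<in> K") auto
  have le: "\<bar>f x * g x\<bar> \<le> B * (indicator K x *\<^sub>R \<bar>f x\<bar>)" for x
    using g(2)[of x] mult_left_mono[OF g(3)[of x] abs_ge_zero[of "f x"]]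
    by (cases "x \<in> K") (auto simp: abs_mult mult.commute)
  have int_B: "integrable M (\<lambda>x. B * (indicator K x *\<^sub>R \<bar>f x\<bar>))"
    using int_norm by (rule integrable_mult_right)
  show int: "integrable M (\<lambda>x. f x * g x)"
  proof (rule Bochner_Integration.integrable_bound[OF int_B])
    show "(\<lambda>x. f x * g x) \<in> borel_measurable M" unfolding eq by (rule m)
    show "AE x in M. norm (f x * g x) \<le> norm (B * (indicator K x *\<^sub>R \<bar>f x\<bar>))"
      unfolding real_norm_def by (intro AE_I2 order_trans[OF le abs_ge_self])
  qed
  have B_eq: "(LINT x|M. B * (indicator K x *\<^sub>R \<bar>f x\<bar>)) = B * Lp_norm 1 (restrict_space M K) f"
    unfolding N integral_restrict_space[OF KM] by simp
  have "\<bar>LINT x|M. f x * g x\<bar> \<le> (LINT x|M. \<bar>f x * g x\<bar>)"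
    using integral_norm_bound[of M "\<lambda>x. f x * g x"] by simp
  also have "\<dots> \<le> (LINT x|M. B * (indicator K x *\<^sub>R \<bar>f x\<bar>))"
    by (rule integral_mono[OF _ int_B le]) (use int in auto)
  finally show "\<bar>LINT x|M. f x * g x\<bar> \<le> B * Lp_norm 1 (restrict_space M K) f"
    unfolding B_eq .
  have "(\<integral>\<^sup>+ x. ennreal \<bar>f x * g x\<bar> \<partial>M) = ennreal (LINT x|M. \<bar>f x * g x\<bar>)"
    by (rule nn_integral_eq_integral) (use int in auto)
  also have "\<dots> \<le> ennreal (B * Lp_norm 1 (restrict_space M K) f)"
    unfolding B_eq[symmetric] by (intro ennreal_leI integral_mono[OF _ int_B le]) (use int in auto)
  finally show "(\<integral>\<^sup>+ x. ennreal \<bar>f x * g x\<bar> \<partial>M) \<le> ennreal (B * Lp_norm 1 (restrict_space M K) f)" .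
qed

section \<open>Separated test functions in the weak formulation\<close>

lemma separated_time_test_function:
  fixes \<phi> :: "'a::euclidean_space \<Rightarrow> real"
  assumes \<phi>: "\<phi> \<in> test_functions \<Omega>"
    and \<theta>: "\<And>t. t \<in> {0..T} \<Longrightarrow> (\<theta> has_real_derivative \<theta>' t) (at t)"
      "continuous_on {0..T} \<theta>'" "\<theta> T = 0"
  shows "(\<lambda>(x, t). \<phi> x * \<theta> t) \<in> time_test_functions \<Omega> T"
proof -
  define D :: "'a \<times> real \<Rightarrow> ('a \<times> real) \<Rightarrow>\<^sub>L real" where
    "D z = \<theta> (snd z) *\<^sub>R (blinfun_inner_left (grad \<phi> (fst z)) o\<^sub>L fst_blinfun)
         + (\<phi> (fst z) * \<theta>' (snd z)) *\<^sub>R snd_blinfun" for z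
  have \<theta>_cont: "continuous_on {0..T} \<theta>"
    by (intro continuous_at_imp_continuous_on ballI) (rule DERIV_isCont[OF \<theta>(1)])
  have "((\<lambda>(x, t). \<phi> x * \<theta> t) has_derivative blinfun_apply (D z)) (at z within \<Omega> \<times> {0..T})"
    if z: "z \<in> \<Omega> \<times> {0..T}" for z
  proof -
    have 1: "((\<lambda>z. \<phi> (fst z)) has_derivative (\<lambda>h. grad \<phi> (fst z) \<bullet> fst h)) (at z)"
      by (rule has_derivative_compose[OF has_derivative_fst[OF has_derivative_ident]
            test_function_derivative[OF \<phi>]])
    have 2: "((\<lambda>z. \<theta> (snd z)) has_derivative (\<lambda>h. \<theta>' (snd z) * snd h)) (at z)"
      by (rule has_derivative_compose[OF has_derivative_snd[OF has_derivative_ident]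
            \<theta>(1)[unfolded has_field_derivative_def]]) (use z in auto)
    have "((\<lambda>z. \<phi> (fst z) * \<theta> (snd z)) has_derivative
        (\<lambda>h. \<phi> (fst z) * (\<theta>' (snd z) * snd h) + grad \<phi> (fst z) \<bullet> fst h * \<theta> (snd z))) (at z)"
      by (rule has_derivative_mult[OF 1 2])
    also have "(\<lambda>h. \<phi> (fst z) * (\<theta>' (snd z) * snd h) + grad \<phi> (fst z) \<bullet> fst h * \<theta> (snd z))
        = blinfun_apply (D z)"
      by (auto simp: D_def blinfun.bilinear_simps inner_commute fun_eq_iff)
    finally show ?thesis
      unfolding case_prod_beta by (rule has_derivative_at_withinI)
  qed
  moreover have "continuous_on (\<Omega> \<times> {0..T}) D"
  proof -
    have c: "continuous_on (\<Omega> \<times> {0..T}) (\<lambda>z. \<phi> (fst z))" "continuous_on (\<Omega> \<times> {0..T}) (\<lambda>z. grad \<phi> (fst z))"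
      "continuous_on (\<Omega> \<times> {0..T}) (\<lambda>z. \<theta> (snd z))" "continuous_on (\<Omega> \<times> {0..T}) (\<lambda>z. \<theta>' (snd z))"
      using test_function_continuous[OF \<phi>, of UNIV] \<theta>(2) \<theta>_cont
      by (auto intro!: continuous_on_compose2[of _ \<phi> _ fst] continuous_on_compose2[of _ "grad \<phi>" _ fst]
          continuous_on_compose2[of _ \<theta> _ snd] continuous_on_compose2[of _ \<theta>' _ snd]
          continuous_on_fst continuous_on_snd continuous_on_id)
    show ?thesis
      unfolding D_def
      by (intro continuous_on_add continuous_on_scaleR continuous_on_mult c continuous_on_const
          bounded_linear.continuous_on[OF bounded_linear_blinfun_inner_left]
          bounded_bilinear.continuous_on[OF bounded_bilinear_blinfun_compose])
  qed
  moreover have "compact (closure {x \<in> \<Omega>. \<phi> x * \<theta> t \<noteq> 0})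
      \<and> closure {x \<in> \<Omega>. \<phi> x * \<theta> t \<noteq> 0} \<subseteq> \<Omega>" for t
  proof -
    have "closure {x \<in> \<Omega>. \<phi> x * \<theta> t \<noteq> 0} \<subseteq> closure {x. \<phi> x \<noteq> 0}"
      by (rule closure_mono) auto
    moreover have C: "compact (closure {x. \<phi> x \<noteq> 0})" "closure {x. \<phi> x \<noteq> 0} \<subseteq> \<Omega>"
      using \<phi> by (auto simp: test_functions_def)
    ultimately show ?thesis
      using compact_Int_closed[OF C(1) closed_closure, of "{x \<in> \<Omega>. \<phi> x * \<theta> t \<noteq> 0}"]
      by (simp add: Int_absorb1 order_trans)
  qed
  ultimately show ?thesis
    using \<theta>(3) unfolding time_test_functions_def by auto
qed

text \<open>Test functions that are products of a function of space and a function of time. All their slices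
  are supported in one compact set, so the double integrals in the weak formulation converge absolutely.\<close>

lemma weak_solution_separated:
  fixes \<phi> :: "'a::euclidean_space \<Rightarrow> real"
  assumes u: "weak_solution m \<Omega> \<rho>\<^sub>\<nu> \<rho>\<^sub>\<mu> u\<^sub>0 u" and T: "T > 0" and "open \<Omega>"
    and \<mu>: "\<rho>\<^sub>\<mu> \<in> borel_measurable (lebesgue_on \<Omega>)" "AE x in lebesgue_on \<Omega>. \<rho>\<^sub>\<mu> x > 0"
      "\<rho>\<^sub>\<mu> \<in> L1_loc \<Omega> (lebesgue_on \<Omega>)"
    and \<phi>: "\<phi> \<in> test_functions \<Omega>"
    and \<theta>: "\<And>t. t \<in> {0..T} \<Longrightarrow> (\<theta> has_real_derivative \<theta>' t) (at t)"
      "continuous_on {0..T} \<theta>'" "\<theta> T = 0"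
  shows "(LINT t|lebesgue_on {0<..<T}. \<theta>' t * (LINT x|weighted \<Omega> \<rho>\<^sub>\<nu>. u t x * \<phi> x))
      = - (LINT x|weighted \<Omega> \<rho>\<^sub>\<nu>. u\<^sub>0 x * (\<phi> x * \<theta> 0))
        + (LINT t|lebesgue_on {0<..<T}. \<theta> t
             * L2_inner (weighted \<Omega> \<rho>\<^sub>\<mu>) (wgrad \<Omega> (\<lambda>x. spow (u t x) m)) (grad \<phi>))"
proof -
  define \<nu> \<mu> where "\<nu> = weighted \<Omega> \<rho>\<^sub>\<nu>" and "\<mu> = weighted \<Omega> \<rho>\<^sub>\<mu>"
  define M where "M = lebesgue_on {0<..<T}"
  define Du where "Du t = wgrad \<Omega> (\<lambda>x. spow (u t x) m)" for t
  define \<eta> where "\<eta> = (\<lambda>(x, t). \<phi> x * \<theta> t)"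
  obtain K B where K: "compact K" "K \<subseteq> \<Omega>" "\<And>x. x \<notin> K \<Longrightarrow> \<phi> x = 0" "\<And>x. \<bar>\<phi> x\<bar> \<le> B" "B \<ge> 0"
    using test_function_bounds[OF \<phi>] by metis
  have weak: "u \<in> Bochner_L1_loc T \<Omega> \<nu>" "Du \<in> Bochner 1 T (Lp 2 \<mu>) (Lp_norm 2 \<mu>)"
    "\<And>\<eta>. \<eta> \<in> time_test_functions \<Omega> T \<Longrightarrow> abs_convergent T \<nu> (\<lambda>t x. u t x * dt \<eta> t x) \<Longrightarrow>
       abs_convergent T \<mu> (\<lambda>t x. Du t x \<bullet> dx \<eta> t x) \<Longrightarrow>
       (LINT t|M. LINT x|\<nu>. u t x * dt \<eta> t x) =
         - (LINT x|\<nu>. u\<^sub>0 x * \<eta> (x, 0)) + (LINT t|M. LINT x|\<mu>. Du t x \<bullet> dx \<eta> t x)"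
    using u T unfolding weak_solution_def Let_def \<nu>_def \<mu>_def M_def Du_def by blast+
  have dt: "dt \<eta> t x = \<phi> x * \<theta>' t" if "t \<in> {0<..<T}" for t x
  proof -
    have "((\<lambda>s. \<phi> x * \<theta> s) has_real_derivative \<phi> x * \<theta>' t) (at t)"
      using that by (intro DERIV_cmult \<theta>(1)) auto
    then show ?thesis
      unfolding dt_def \<eta>_def prod.case
      by (intro vector_derivative_at) (simp add: has_real_derivative_iff_has_vector_derivative)
  qed
  have dx: "dx \<eta> t x = \<theta> t *\<^sub>R grad \<phi> x" for t x
  proof -
    have "((\<lambda>y. \<phi> y * \<theta> t) has_derivative (\<lambda>h. (grad \<phi> x \<bullet> h) * \<theta> t)) (at x)"
      by (rule has_derivative_mult_left[OF test_function_derivative[OF \<phi>]])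
    from frechet_derivative_at[OF this]
    have "frechet_derivative (\<lambda>y. \<phi> y * \<theta> t) (at x) b = (grad \<phi> x \<bullet> b) * \<theta> t" for b by metis
    then have "grad (\<lambda>y. \<phi> y * \<theta> t) x = (\<Sum>b\<in>Basis. ((grad \<phi> x \<bullet> b) * \<theta> t) *\<^sub>R b)"
      unfolding grad_def[of "\<lambda>y. \<phi> y * \<theta> t"] by simp
    also have "\<dots> = \<theta> t *\<^sub>R (\<Sum>b\<in>Basis. (grad \<phi> x \<bullet> b) *\<^sub>R b)"
      by (simp add: scaleR_sum_right mult.commute)
    finally show ?thesis by (simp add: dx_def \<eta>_def euclidean_representation)
  qed
  have \<theta>_cont: "continuous_on {0..T} \<theta>"
    by (intro continuous_at_imp_continuous_on ballI) (rule DERIV_isCont[OF \<theta>(1)])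
  have "bounded (\<theta> ` {0..T})" "bounded (\<theta>' ` {0..T})"
    using \<theta>_cont \<theta>(2) by (auto intro!: compact_imp_bounded compact_continuous_image)
  then obtain c c' where c: "\<And>t. t \<in> {0..T} \<Longrightarrow> \<bar>\<theta> t\<bar> \<le> c" "\<And>t. t \<in> {0..T} \<Longrightarrow> \<bar>\<theta>' t\<bar> \<le> c'"
    unfolding bounded_iff by (metis imageI real_norm_def)
  have K_sets: "K \<in> sets \<nu>"
    using K(1,2) \<open>open \<Omega>\<close> compact_imp_closed[OF K(1)]
    by (auto simp: \<nu>_def sets_restrict_space image_iff intro!: bexI[of _ K])
  have \<phi>_meas: "\<phi> \<in> borel_measurable \<nu>"
    using test_function_measurable(1)[OF \<phi>] by (simp add: \<nu>_def)
  have uK: "u \<in> Bochner 1 T (Lp 1 (restrict_space \<nu> K)) (Lp_norm 1 (restrict_space \<nu> K))"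
    using weak(1) K(1,2) unfolding Bochner_L1_loc_def by blast
  have conv1: "abs_convergent T \<nu> (\<lambda>t x. u t x * dt \<eta> t x)"
  proof -
    let ?N = "Lp_norm 1 (restrict_space \<nu> K)"
    have ae: "AE t in M. u t \<in> Lp 1 (restrict_space \<nu> K)" and int: "integrable M (\<lambda>t. ?N (u t) powr 1)"
      using uK unfolding Bochner_def M_def by blast+
    have "AE t in M. (\<integral>\<^sup>+ x. ennreal \<bar>u t x * dt \<eta> t x\<bar> \<partial>\<nu>) \<le> ennreal (B * c' * ?N (u t))"
      using ae AE_space
    proof eventually_elim
      case (elim t)
      then have t: "t \<in> {0<..<T}" by (simp add: M_def)
      have "\<bar>dt \<eta> t x\<bar> \<le> B * c'" for x
        unfolding dt[OF t] abs_mult using K(4)[of x] c(2)[of t] K(5) t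
        by (intro mult_mono) auto
      moreover have "dt \<eta> t x = 0" if "x \<notin> K" for x
        using K(3)[OF that] dt[OF t] by simp
      moreover have "dt \<eta> t \<in> borel_measurable \<nu>"
        using \<phi>_meas by (simp add: dt[OF t, abs_def])
      ultimately show ?case
        using L1_pairing(3)[OF K_sets elim(1)] by blast
    qed
    then have "(\<integral>\<^sup>+ t. (\<integral>\<^sup>+ x. ennreal \<bar>u t x * dt \<eta> t x\<bar> \<partial>\<nu>) \<partial>M) \<le> (\<integral>\<^sup>+ t. ennreal (B * c' * ?N (u t)) \<partial>M)"
      by (rule nn_integral_mono_AE)
    also have "\<dots> < \<infinity>"
      by (rule nn_integral_less_top) (use int in simp)
    finally show ?thesis by (simp add: abs_convergent_def M_def)
  qed
  have grad_L2: "grad \<phi> \<in> Lp 2 \<mu>"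
    unfolding \<mu>_def by (rule test_function_Lp(2)[OF \<mu> \<phi>]) simp
  have conv2: "abs_convergent T \<mu> (\<lambda>t x. Du t x \<bullet> dx \<eta> t x)"
  proof -
    let ?N = "Lp_norm 2 \<mu> :: ('a \<Rightarrow> 'a) \<Rightarrow> real"
    have ae: "AE t in M. Du t \<in> Lp 2 \<mu>" and int: "integrable M (\<lambda>t. ?N (Du t) powr 1)"
      using weak(2) unfolding Bochner_def M_def by blast+
    have "AE t in M. (\<integral>\<^sup>+ x. ennreal \<bar>Du t x \<bullet> dx \<eta> t x\<bar> \<partial>\<mu>) \<le> ennreal (c * ?N (grad \<phi>) * ?N (Du t))"
      using ae AE_space
    proof eventually_elim
      case (elim t)
      then have t: "t \<in> {0..T}" by (simp add: M_def)
      have int_a: "integrable \<mu> (\<lambda>x. \<bar>Du t x \<bullet> grad \<phi> x\<bar>)"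
        using L2_inner_integrable[OF elim(1) grad_L2] by simp
      have n: "(\<lambda>x. norm (Du t x)) \<in> Lp 2 \<mu>" "(\<lambda>x. norm (grad \<phi> x)) \<in> Lp 2 \<mu>"
        using elim(1) grad_L2 by (auto simp: Lp_def)
      have "(LINT x|\<mu>. \<bar>Du t x \<bullet> grad \<phi> x\<bar>)
          \<le> L2_inner \<mu> (\<lambda>x. norm (Du t x)) (\<lambda>x. norm (grad \<phi> x))"
        using int_a L2_inner_integrable[OF n]
        by (intro integral_mono) (simp_all add: Cauchy_Schwarz_ineq2)
      also have "\<dots> \<le> ?N (Du t) * ?N (grad \<phi>)"
        using L2_Cauchy_Schwarz[OF n] by (simp add: Lp_norm_def)
      finally have le: "(LINT x|\<mu>. \<bar>Du t x \<bullet> grad \<phi> x\<bar>) \<le> ?N (Du t) * ?N (grad \<phi>)" .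
      have "(\<integral>\<^sup>+ x. ennreal \<bar>Du t x \<bullet> dx \<eta> t x\<bar> \<partial>\<mu>)
          \<le> (\<integral>\<^sup>+ x. ennreal (c * \<bar>Du t x \<bullet> grad \<phi> x\<bar>) \<partial>\<mu>)"
        using c(1)[OF t] by (intro nn_integral_mono ennreal_leI) (auto simp: dx abs_mult intro: mult_right_mono)
      also have "\<dots> = ennreal (LINT x|\<mu>. c * \<bar>Du t x \<bullet> grad \<phi> x\<bar>)"
        using int_a c(1)[OF t] by (intro nn_integral_eq_integral) auto
      also have "\<dots> \<le> ennreal (c * ?N (grad \<phi>) * ?N (Du t))"
        using le c(1)[OF t] mult_left_mono[OF le, of c] by (intro ennreal_leI) (simp add: mult_ac)
      finally show ?case .
    qed
    then have "(\<integral>\<^sup>+ t. (\<integral>\<^sup>+ x. ennreal \<bar>Du t x \<bullet> dx \<eta> t x\<bar> \<partial>\<mu>) \<partial>M)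
        \<le> (\<integral>\<^sup>+ t. ennreal (c * ?N (grad \<phi>) * ?N (Du t)) \<partial>M)"
      by (rule nn_integral_mono_AE)
    also have "\<dots> < \<infinity>"
      by (rule nn_integral_less_top) (use int in simp)
    finally show ?thesis by (simp add: abs_convergent_def M_def)
  qed
  have "\<eta> \<in> time_test_functions \<Omega> T"
    unfolding \<eta>_def by (rule separated_time_test_function[OF \<phi> \<theta>])
  from weak(3)[OF this conv1 conv2]
  have "(LINT t|M. LINT x|\<nu>. u t x * dt \<eta> t x)
      = - (LINT x|\<nu>. u\<^sub>0 x * (\<phi> x * \<theta> 0)) + (LINT t|M. LINT x|\<mu>. Du t x \<bullet> dx \<eta> t x)"
    by (simp add: \<eta>_def)
  moreover have "(LINT t|M. LINT x|\<nu>. u t x * dt \<eta> t x) = (LINT t|M. \<theta>' t * (LINT x|\<nu>. u t x * \<phi> x))"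
  proof (rule Bochner_Integration.integral_cong[OF refl])
    fix t assume "t \<in> space M"
    then have t: "t \<in> {0<..<T}" by (simp add: M_def)
    have "(LINT x|\<nu>. u t x * dt \<eta> t x) = (LINT x|\<nu>. \<theta>' t * (u t x * \<phi> x))"
      by (simp add: dt[OF t] mult_ac)
    then show "(LINT x|\<nu>. u t x * dt \<eta> t x) = \<theta>' t * (LINT x|\<nu>. u t x * \<phi> x)" by simp
  qed
  ultimately show ?thesis
    by (simp add: dx \<nu>_def \<mu>_def M_def Du_def)
qed

section \<open>The weak formulation integrated in time\<close>

lemma Bochner_L2_diff:
  fixes F G :: "real \<Rightarrow> 'a \<Rightarrow> 'b::euclidean_space"
  assumes F: "F \<in> Bochner 2 T (Lp 2 \<mu>) (Lp_norm 2 \<mu>)" and G: "G \<in> Bochner 2 T (Lp 2 \<mu>) (Lp_norm 2 \<mu>)"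
  shows "(\<lambda>t x. F t x - G t x) \<in> Bochner 2 T (Lp 2 \<mu>) (Lp_norm 2 \<mu>)"
proof -
  define M where "M = lebesgue_on {0<..<T}"
  let ?N = "Lp_norm 2 \<mu> :: ('a \<Rightarrow> 'b) \<Rightarrow> real"
  obtain s where s: "AE t in M. F t \<in> Lp 2 \<mu>"
    "\<And>n::nat. simple_function M (s n)" "\<And>n. s n ` {0<..<T} \<subseteq> Lp 2 \<mu>"
    "AE t in M. (\<lambda>n. ?N (\<lambda>x. s n t x - F t x)) \<longlonglongrightarrow> 0"
    and int_F: "integrable M (\<lambda>t. ?N (F t) powr 2)"
    using F unfolding Bochner_def M_def by blast
  obtain r where r: "AE t in M. G t \<in> Lp 2 \<mu>"
    "\<And>n::nat. simple_function M (r n)" "\<And>n. r n ` {0<..<T} \<subseteq> Lp 2 \<mu>"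
    "AE t in M. (\<lambda>n. ?N (\<lambda>x. r n t x - G t x)) \<longlonglongrightarrow> 0"
    and int_G: "integrable M (\<lambda>t. ?N (G t) powr 2)"
    using G unfolding Bochner_def M_def by blast
  let ?D = "\<lambda>t x. F t x - G t x" and ?d = "\<lambda>n t x. s n t x - r n t x"
  have X: "AE t in M. ?D t \<in> Lp 2 \<mu>"
    using s(1) r(1) by eventually_elim (rule L2_diff)
  have d: "simple_function M (?d n)" "?d n ` {0<..<T} \<subseteq> Lp 2 \<mu>" for n
    using simple_function_compose2[OF s(2) r(2), of "\<lambda>f g x. f x - g x" n n] s(3)[of n] r(3)[of n]
    by (auto simp: image_subset_iff intro: L2_diff)
  have conv: "AE t in M. (\<lambda>n. ?N (\<lambda>x. ?d n t x - ?D t x)) \<longlonglongrightarrow> 0"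
    using s(1,4) r(1,4) AE_space
  proof eventually_elim
    case (elim t)
    then have t: "t \<in> {0<..<T}" by (simp add: M_def)
    have "norm (?N (\<lambda>x. ?d n t x - ?D t x))
        \<le> ?N (\<lambda>x. s n t x - F t x) + ?N (\<lambda>x. r n t x - G t x)" for n
    proof -
      have "s n t \<in> Lp 2 \<mu>" "r n t \<in> Lp 2 \<mu>"
        using s(3)[of n] r(3)[of n] t by (auto simp: image_subset_iff)
      then have "(\<lambda>x. s n t x - F t x) \<in> Lp 2 \<mu>" "(\<lambda>x. r n t x - G t x) \<in> Lp 2 \<mu>"
        using elim by (auto intro: L2_diff)
      from L2_triangle[OF this] show ?thesis by (simp add: algebra_simps)
    qed
    then have "eventually (\<lambda>n. norm (?N (\<lambda>x. ?d n t x - ?D t x))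
        \<le> ?N (\<lambda>x. s n t x - F t x) + ?N (\<lambda>x. r n t x - G t x)) sequentially"
      by (intro always_eventually allI)
    then show ?case
      by (rule Lim_null_comparison) (rule tendsto_add_zero[OF elim(2,4)])
  qed
  have meas: "(\<lambda>t. ?N (?D t)) \<in> borel_measurable M"
    unfolding M_def
    by (rule simple_limit_functional_measurable[where d = "\<lambda>f g. ?N (\<lambda>x. f x - g x)" and C = 1,
          OF _ X[unfolded M_def] d[unfolded M_def] conv[unfolded M_def]])
      (simp_all add: L2_norm_diff_le)
  have "integrable M (\<lambda>t. ?N (?D t) powr 2)"
  proof (rule Bochner_Integration.integrable_bound)
    show "integrable M (\<lambda>t. 2 powr 2 * (?N (F t) powr 2 + ?N (G t) powr 2))"
      using int_F int_G by simp
    show "(\<lambda>t. ?N (?D t) powr 2) \<in> borel_measurable M" using meas by measurable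
    show "AE t in M. norm (?N (?D t) powr 2) \<le> norm (2 powr 2 * (?N (F t) powr 2 + ?N (G t) powr 2))"
      using s(1) r(1)
    proof eventually_elim
      case (elim t)
      have "?N (?D t) powr 2 \<le> 2 powr 2 * (?N (F t) powr 2 + ?N (G t) powr 2)"
        by (rule Lp_diff(2)[OF elim]) simp
      also have "\<dots> \<le> norm \<dots>" by simp
      finally show ?case by simp
    qed
  qed
  then have "(AE t in M. ?D t \<in> Lp 2 \<mu>)
      \<and> (\<exists>s. (\<forall>n. simple_function M (s n) \<and> s n ` {0<..<T} \<subseteq> Lp 2 \<mu>)
             \<and> (AE t in M. (\<lambda>n. ?N (\<lambda>x. s n t x - ?D t x)) \<longlonglongrightarrow> 0))
      \<and> integrable M (\<lambda>t. ?N (?D t) powr 2)"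
    by (intro conjI exI[of _ ?d] allI X d conv)
  then show ?thesis
    unfolding Bochner_def M_def mem_Collect_eq .
qed

lemma test_function_time_primitive:
  assumes \<psi>: "\<psi> \<in> test_functions {0<..<T}" and T: "T > (0::real)"
  obtains \<theta> where "\<And>t. t \<in> {0..T} \<Longrightarrow> (\<theta> has_real_derivative - \<psi> t) (at t)" "\<theta> T = 0"
    "\<And>t. t \<in> {0<..<T} \<Longrightarrow> \<theta> t = (LINT s|lebesgue_on {0<..<T}. indicator {t<..} s * \<psi> s)"
proof -
  have cont: "continuous_on S \<psi>" for S by (rule test_function_continuous[OF \<psi>])
  \<comment> \<open>The primitive starts left of 0 and is differentiated on an interval with \<open>[0, T]\<close> in its interior.\<close>
  define \<theta> where "\<theta> t = integral {-1..T} \<psi> - integral {-1..t} \<psi>" for t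
  show thesis
  proof (rule that)
    show "(\<theta> has_real_derivative - \<psi> t) (at t)" if t: "t \<in> {0..T}" for t
    proof -
      have "((\<lambda>t. integral {-1..t} \<psi>) has_real_derivative \<psi> t) (at t within {-1..T+1})"
        by (rule integral_has_real_derivative[OF cont]) (use t in auto)
      moreover have "at t within {-1..T+1} = at t"
        by (rule at_within_Icc_at) (use t in auto)
      ultimately have d: "((\<lambda>t. integral {-1..t} \<psi>) has_real_derivative \<psi> t) (at t)" by simp
      show ?thesis
        unfolding \<theta>_def using DERIV_diff[OF DERIV_const d, of "integral {-1..T} \<psi>"] by simp
    qed
    show "\<theta> T = 0" by (simp add: \<theta>_def)
    show "\<theta> t = (LINT s|lebesgue_on {0<..<T}. indicator {t<..} s * \<psi> s)" if t: "t \<in> {0<..<T}" for t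
    proof -
      have "\<theta> t = integral {t..T} \<psi>"
        unfolding \<theta>_def
        using Henstock_Kurzweil_Integration.integral_combine[of "-1" t T \<psi>] t integrable_continuous_interval[OF cont] by simp
      also have "\<dots> = integral {t<..<T} \<psi>"
        using integral_open_interval[of t T \<psi>] by (simp add: box_real cbox_interval)
      also have "\<dots> = (LINT s|lebesgue_on {t<..<T}. \<psi> s)"
      proof (rule lebesgue_integral_eq_integral[symmetric])
        obtain B where B: "\<And>s. \<bar>\<psi> s\<bar> \<le> B" using test_function_bounds[OF \<psi>] by metis
        interpret finite_measure "lebesgue_on {t<..<T}" by (rule finite_measure_lebesgue_on) simp
        show "integrable (lebesgue_on {t<..<T}) \<psi>"
          by (rule integrable_const_bound[where B = B]) (use B test_function_measurable[OF \<psi>] in auto)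
      qed simp
      also have "\<dots> = (LINT s|lebesgue. indicator {t<..<T} s *\<^sub>R \<psi> s)"
        by (rule integral_restrict_space) simp
      also have "\<dots> = (LINT s|lebesgue. indicator {0<..<T} s *\<^sub>R (indicator {t<..} s * \<psi> s))"
        by (intro Bochner_Integration.integral_cong refl) (use t in \<open>auto simp: indicator_def\<close>)
      also have "\<dots> = (LINT s|lebesgue_on {0<..<T}. indicator {t<..} s * \<psi> s)"
        by (rule integral_restrict_space[symmetric]) simp
      finally show ?thesis .
    qed
  qed
qed

lemma integrable_bounded_mult:
  fixes f g :: "'a \<Rightarrow> real"
  assumes f: "f \<in> borel_measurable M" "\<And>x. x \<in> space M \<Longrightarrow> \<bar>f x\<bar> \<le> B" and g: "integrable M g"
  shows "integrable M (\<lambda>x. f x * g x)"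
proof (rule Bochner_Integration.integrable_bound)
  show "integrable M (\<lambda>x. B * g x)" using g by simp
  show "(\<lambda>x. f x * g x) \<in> borel_measurable M"
    using f(1) g by (intro borel_measurable_times) auto
  have "\<bar>f x\<bar> \<le> \<bar>B\<bar>" if "x \<in> space M" for x using f(2)[OF that] by linarith
  then show "AE x in M. norm (f x * g x) \<le> norm (B * g x)"
    by (intro AE_I2) (auto simp: abs_mult intro!: mult_right_mono)
qed

text \<open>The functions \<open>\<theta>\<close> with \<open>\<theta>' = - \<psi>\<close> and \<open>\<theta> T = 0\<close>, for \<open>\<psi>\<close> a test function on \<open>(0, T)\<close>, turn the
  hypothesis into orthogonality of \<open>W s + \<integral>\<^sub>0\<^sup>s G\<close> to \<open>\<psi>\<close>, by exchanging the order of integration over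
  the triangle \<open>t < s\<close>.\<close>

lemma Volterra_identity_from_primitives:
  fixes W G :: "real \<Rightarrow> real"
  assumes T: "T > 0"
  defines "M \<equiv> lebesgue_on {0<..<T}"
  assumes W: "integrable M W" and G: "integrable M G"
    and eq: "\<And>\<theta> \<theta>'. (\<And>t. t \<in> {0..T} \<Longrightarrow> (\<theta> has_real_derivative \<theta>' t) (at t)) \<Longrightarrow>
       continuous_on {0..T} \<theta>' \<Longrightarrow> \<theta> T = 0 \<Longrightarrow>
       (LINT t|M. \<theta>' t * W t) = (LINT t|M. \<theta> t * G t)"
  shows "AE s in M. W s + (LINT t|M. indicator {..<s} t * G t) = 0"
proof -
  have fin: "finite_measure M"
    unfolding M_def by (rule finite_measure_lebesgue_on) simp
  interpret M: finite_measure M by (rule fin)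
  interpret P: pair_sigma_finite M M ..
  have id_meas [measurable]: "(\<lambda>t. t) \<in> borel_measurable M"
    unfolding M_def using id_borel_measurable_lebesgue_on by (simp add: id_def)
  have [measurable]: "fst \<in> borel_measurable (M \<Otimes>\<^sub>M M)" "snd \<in> borel_measurable (M \<Otimes>\<^sub>M M)"
    using measurable_compose[OF measurable_fst id_meas] measurable_compose[OF measurable_snd id_meas] by auto
  have G_meas [measurable]: "G \<in> borel_measurable M" using G by auto
  have int_pair: "integrable (M \<Otimes>\<^sub>M M) (\<lambda>(t, s). indicator {t<..} s * c s * G t)"
    if c: "c \<in> borel_measurable M" "\<And>s. \<bar>c s\<bar> \<le> B" for c :: "real \<Rightarrow> real" and B
  proof -
    note c(1)[measurable]
    have B: "B \<ge> 0" using c(2)[of 0] by linarith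
    have eq: "(\<lambda>(t, s). indicator {t<..} s * c s * G t)
        = (\<lambda>z. if fst z < snd z then c (snd z) * G (fst z) else 0)"
      by (auto simp: fun_eq_iff indicator_def)
    show ?thesis
    proof (rule Bochner_Integration.integrable_bound)
      show "integrable (M \<Otimes>\<^sub>M M) (\<lambda>z. B * \<bar>G (fst z)\<bar>)"
      proof (rule P.Fubini_integrable)
        show "(\<lambda>z. B * \<bar>G (fst z)\<bar>) \<in> borel_measurable (M \<Otimes>\<^sub>M M)" by measurable
        show "integrable M (\<lambda>t. LINT s|M. norm (B * \<bar>G (fst (t, s))\<bar>))"
          using G by (simp add: abs_mult)
        show "AE t in M. integrable M (\<lambda>s. B * \<bar>G (fst (t, s))\<bar>)" by simp
      qed
      show "(\<lambda>(t, s). indicator {t<..} s * c s * G t) \<in> borel_measurable (M \<Otimes>\<^sub>M M)"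
        unfolding eq by measurable
      show "AE z in M \<Otimes>\<^sub>M M. norm (case z of (t, s) \<Rightarrow> indicator {t<..} s * c s * G t)
          \<le> norm (B * \<bar>G (fst z)\<bar>)"
        using c(2) B by (intro AE_I2) (auto simp: indicator_def abs_mult intro!: mult_right_mono)
    qed
  qed
  define V where "V s = (LINT t|M. indicator {..<s} t * G t)" for s
  have ind: "indicator {..<s} t = (indicator {t<..} s :: real)" for s t :: real
    by (simp add: indicator_def)
  have V_int: "integrable M V"
    using P.integrable_snd[OF int_pair[of "\<lambda>_. 1" 1]] by (simp add: V_def[abs_def] ind)
  have "AE s in lebesgue_on {0<..<T}. W s + V s = 0"
  proof (rule orthogonal_to_test_functions_imp_AE_zero)
    have "integrable M (\<lambda>s. W s + V s)" using W V_int by simp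
    then have "set_integrable M K (\<lambda>s. W s + V s)" if "compact K" "K \<subseteq> {0<..<T}" for K
      unfolding set_integrable_def using that compact_imp_closed[OF that(1)]
      by (intro integrable_mult_indicator)
        (auto simp: M_def sets_restrict_space image_iff intro!: bexI[of _ K])
    then show "(\<lambda>s. W s + V s) \<in> L1_loc {0<..<T} (lebesgue_on {0<..<T})"
      by (auto simp: L1_loc_def M_def)
  next
    fix \<psi> assume \<psi>: "\<psi> \<in> test_functions {0<..<T}"
    obtain B where B: "\<And>s. \<bar>\<psi> s\<bar> \<le> B" using test_function_bounds[OF \<psi>] by metis
    have \<psi>_meas: "\<psi> \<in> borel_measurable M"
      unfolding M_def by (rule test_function_measurable[OF \<psi>])
    obtain \<theta> where \<theta>: "\<And>t. t \<in> {0..T} \<Longrightarrow> (\<theta> has_real_derivative - \<psi> t) (at t)" "\<theta> T = 0"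
      "\<And>t. t \<in> {0<..<T} \<Longrightarrow> \<theta> t = (LINT s|M. indicator {t<..} s * \<psi> s)"
        proof (rule test_function_time_primitive[OF \<psi> T])
      fix \<theta>
      assume 1: "\<And>t. t \<in> {0..T} \<Longrightarrow> (\<theta> has_real_derivative - \<psi> t) (at t)" and 2: "\<theta> T = 0"
        and 3: "\<And>t. t \<in> {0<..<T} \<Longrightarrow> \<theta> t = (LINT s|lebesgue_on {0<..<T}. indicator {t<..} s * \<psi> s)"
      show thesis by (rule that[OF 1 2 3[folded M_def]])
    qed
    have int_\<psi>: "integrable M (\<lambda>s. \<psi> s * f s)" if "integrable M f" for f :: "real \<Rightarrow> real"
      by (rule integrable_bounded_mult[OF \<psi>_meas B that])
    have "(LINT t|M. - \<psi> t * W t) = (LINT t|M. \<theta> t * G t)"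
      by (rule eq[OF \<theta>(1) _ \<theta>(2)]) (auto intro!: continuous_on_minus test_function_continuous[OF \<psi>])
    also have "\<dots> = (LINT t|M. LINT s|M. indicator {t<..} s * \<psi> s * G t)"
      by (intro Bochner_Integration.integral_cong refl) (simp add: \<theta>(3) M_def)
    also have "\<dots> = (LINT s|M. LINT t|M. indicator {t<..} s * \<psi> s * G t)"
      by (rule P.Fubini_integral[symmetric, OF int_pair[OF \<psi>_meas B]])
    also have "\<dots> = (LINT s|M. \<psi> s * V s)"
    proof (intro Bochner_Integration.integral_cong refl)
      fix s
      have "(LINT t|M. indicator {t<..} s * \<psi> s * G t) = (LINT t|M. \<psi> s * (indicator {..<s} t * G t))"
        by (simp add: ind mult_ac)
      then show "(LINT t|M. indicator {t<..} s * \<psi> s * G t) = \<psi> s * V s"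
        by (simp add: V_def)
    qed
    finally show "(LINT s|lebesgue_on {0<..<T}. \<psi> s * (W s + V s)) = 0"
      using int_\<psi>[OF W] int_\<psi>[OF V_int] by (simp add: M_def distrib_left)
  qed simp
  then show ?thesis unfolding V_def M_def .
qed

lemma weak_solution_pairing_integrable:
  assumes u: "weak_solution m \<Omega> \<rho>\<^sub>\<nu> \<rho>\<^sub>\<mu> u\<^sub>0 u" and T: "T > 0" and "open \<Omega>"
    and \<mu>: "\<rho>\<^sub>\<mu> \<in> borel_measurable (lebesgue_on \<Omega>)" "AE x in lebesgue_on \<Omega>. \<rho>\<^sub>\<mu> x > 0"
      "\<rho>\<^sub>\<mu> \<in> L1_loc \<Omega> (lebesgue_on \<Omega>)"
    and \<phi>: "\<phi> \<in> test_functions \<Omega>"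
  shows "integrable (lebesgue_on {0<..<T}) (\<lambda>t. LINT x|weighted \<Omega> \<rho>\<^sub>\<nu>. u t x * \<phi> x)"
    and "integrable (lebesgue_on {0<..<T})
      (\<lambda>t. L2_inner (weighted \<Omega> \<rho>\<^sub>\<mu>) (wgrad \<Omega> (\<lambda>x. spow (u t x) m)) (grad \<phi>))"
proof -
  define \<nu> \<mu> where "\<nu> = weighted \<Omega> \<rho>\<^sub>\<nu>" and "\<mu> = weighted \<Omega> \<rho>\<^sub>\<mu>"
  obtain K B where K: "compact K" "K \<subseteq> \<Omega>" "\<And>x. x \<notin> K \<Longrightarrow> \<phi> x = 0" "\<And>x. \<bar>\<phi> x\<bar> \<le> B" "B \<ge> 0"
    using test_function_bounds[OF \<phi>] by metis
  have weak: "u \<in> Bochner_L1_loc T \<Omega> \<nu>"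
    "(\<lambda>t. wgrad \<Omega> (\<lambda>x. spow (u t x) m)) \<in> Bochner 1 T (Lp 2 \<mu>) (Lp_norm 2 \<mu>)"
    using u T unfolding weak_solution_def Let_def \<nu>_def \<mu>_def by blast+
  have uK: "u \<in> Bochner 1 T (Lp 1 (restrict_space \<nu> K)) (Lp_norm 1 (restrict_space \<nu> K))"
    using weak(1) K(1,2) unfolding Bochner_L1_loc_def by blast
  have K_sets: "K \<in> sets \<nu>"
    using K(1,2) \<open>open \<Omega>\<close> compact_imp_closed[OF K(1)]
    by (auto simp: \<nu>_def sets_restrict_space image_iff intro!: bexI[of _ K])
  have \<phi>_meas: "\<phi> \<in> borel_measurable \<nu>"
    using test_function_measurable(1)[OF \<phi>] by (simp add: \<nu>_def)
  note pair = L1_pairing[OF K_sets _ \<phi>_meas K(3,4)]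
  have "integrable (lebesgue_on {0<..<T}) (\<lambda>t. LINT x|\<nu>. u t x * \<phi> x)"
  proof (rule Bochner_functional_integrable[OF uK, where C = B])
    fix g h :: "'a \<Rightarrow> real" assume gh: "g \<in> Lp 1 (restrict_space \<nu> K)" "h \<in> Lp 1 (restrict_space \<nu> K)"
    have "(\<lambda>x. g x - h x) \<in> Lp 1 (restrict_space \<nu> K)"
      by (rule Lp_diff(1)[OF gh]) simp
    from pair(2)[OF this] show "\<bar>(LINT x|\<nu>. g x * \<phi> x) - (LINT x|\<nu>. h x * \<phi> x)\<bar>
        \<le> B * Lp_norm 1 (restrict_space \<nu> K) (\<lambda>x. g x - h x)"
      using pair(1)[OF gh(1)] pair(1)[OF gh(2)] by (simp add: left_diff_distrib)
  qed (use K(5) pair(2) in auto)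
  then show "integrable (lebesgue_on {0<..<T}) (\<lambda>t. LINT x|weighted \<Omega> \<rho>\<^sub>\<nu>. u t x * \<phi> x)"
    by (simp add: \<nu>_def)
  have grad_L2: "grad \<phi> \<in> Lp 2 \<mu>"
    unfolding \<mu>_def by (rule test_function_Lp(2)[OF \<mu> \<phi>]) simp
  show "integrable (lebesgue_on {0<..<T})
      (\<lambda>t. L2_inner (weighted \<Omega> \<rho>\<^sub>\<mu>) (wgrad \<Omega> (\<lambda>x. spow (u t x) m)) (grad \<phi>))"
    using Bochner_L2_inner_integrable[OF weak(2) _ grad_L2] by (simp add: \<mu>_def)
qed

text \<open>The initial data cancel in the difference of the two weak formulations. The exceptional null set of
  times may depend on \<open>\<phi>\<close>.\<close>

lemma weak_solutions_time_integrated: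
  fixes \<phi> :: "'a::euclidean_space \<Rightarrow> real"
  assumes u: "weak_solution m \<Omega> \<rho>\<^sub>\<nu> \<rho>\<^sub>\<mu> u\<^sub>0 u" and v: "weak_solution m \<Omega> \<rho>\<^sub>\<nu> \<rho>\<^sub>\<mu> u\<^sub>0 v"
    and T: "T > 0" and "open \<Omega>"
    and \<mu>: "\<rho>\<^sub>\<mu> \<in> borel_measurable (lebesgue_on \<Omega>)" "AE x in lebesgue_on \<Omega>. \<rho>\<^sub>\<mu> x > 0"
      "\<rho>\<^sub>\<mu> \<in> L1_loc \<Omega> (lebesgue_on \<Omega>)"
    and \<phi>: "\<phi> \<in> test_functions \<Omega>"
  shows "AE s in lebesgue_on {0<..<T}.
      ((LINT x|weighted \<Omega> \<rho>\<^sub>\<nu>. u s x * \<phi> x) - (LINT x|weighted \<Omega> \<rho>\<^sub>\<nu>. v s x * \<phi> x))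
      + (LINT t|lebesgue_on {0<..<T}. indicator {..<s} t *
          (L2_inner (weighted \<Omega> \<rho>\<^sub>\<mu>) (wgrad \<Omega> (\<lambda>x. spow (u t x) m)) (grad \<phi>)
           - L2_inner (weighted \<Omega> \<rho>\<^sub>\<mu>) (wgrad \<Omega> (\<lambda>x. spow (v t x) m)) (grad \<phi>))) = 0"
proof (rule Volterra_identity_from_primitives[OF T])
  note int_u = weak_solution_pairing_integrable[OF u T \<open>open \<Omega>\<close> \<mu> \<phi>]
  note int_v = weak_solution_pairing_integrable[OF v T \<open>open \<Omega>\<close> \<mu> \<phi>]
  let ?M = "lebesgue_on {0<..<T}"
  let ?Wu = "\<lambda>t. LINT x|weighted \<Omega> \<rho>\<^sub>\<nu>. u t x * \<phi> x" and ?Wv = "\<lambda>t. LINT x|weighted \<Omega> \<rho>\<^sub>\<nu>. v t x * \<phi> x"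
  let ?Gu = "\<lambda>t. L2_inner (weighted \<Omega> \<rho>\<^sub>\<mu>) (wgrad \<Omega> (\<lambda>x. spow (u t x) m)) (grad \<phi>)"
  let ?Gv = "\<lambda>t. L2_inner (weighted \<Omega> \<rho>\<^sub>\<mu>) (wgrad \<Omega> (\<lambda>x. spow (v t x) m)) (grad \<phi>)"
  show "integrable ?M (\<lambda>t. ?Wu t - ?Wv t)" "integrable ?M (\<lambda>t. ?Gu t - ?Gv t)"
    using int_u int_v by auto
  fix \<theta> \<theta>' :: "real \<Rightarrow> real"
  assume \<theta>: "\<And>t. t \<in> {0..T} \<Longrightarrow> (\<theta> has_real_derivative \<theta>' t) (at t)"
    "continuous_on {0..T} \<theta>'" "\<theta> T = 0"
  have int_mult: "integrable ?M (\<lambda>t. f t * g t)"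
    if f: "continuous_on {0..T} f" and g: "integrable ?M g" for f g :: "real \<Rightarrow> real"
  proof -
    have f_meas: "f \<in> borel_measurable ?M"
      by (rule continuous_imp_measurable_on_sets_lebesgue[OF continuous_on_subset[OF f]]) auto
    have "bounded (f ` {0..T})" using f by (auto intro!: compact_imp_bounded compact_continuous_image)
    then obtain B where B: "\<And>t. t \<in> {0..T} \<Longrightarrow> \<bar>f t\<bar> \<le> B"
      unfolding bounded_iff by (metis imageI real_norm_def)
    show ?thesis
      by (rule integrable_bounded_mult[OF f_meas B g]) simp
  qed
  have \<theta>_cont: "continuous_on {0..T} \<theta>"
    by (intro continuous_at_imp_continuous_on ballI) (rule DERIV_isCont[OF \<theta>(1)])
  show "(LINT t|?M. \<theta>' t * (?Wu t - ?Wv t)) = (LINT t|?M. \<theta> t * (?Gu t - ?Gv t))"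
    using weak_solution_separated[OF u T \<open>open \<Omega>\<close> \<mu> \<phi> \<theta>] weak_solution_separated[OF v T \<open>open \<Omega>\<close> \<mu> \<phi> \<theta>]
      int_mult[OF \<theta>(2) int_u(1)] int_mult[OF \<theta>(2) int_v(1)]
      int_mult[OF \<theta>_cont int_u(2)] int_mult[OF \<theta>_cont int_v(2)]
    by (simp add: right_diff_distrib)
qed

section \<open>Functions of the energy space as test functions\<close>

text \<open>A strongly measurable function is almost everywhere a limit of simple functions, which together take
  only countably many values; each of these values is a limit of a sequence of test functions.\<close>

lemma V0p_Bochner_countable_approximants:
  fixes f :: "real \<Rightarrow> 'a::euclidean_space \<Rightarrow> real"
  assumes \<Omega>: "open \<Omega>"
    and \<nu>: "\<rho>\<^sub>\<nu> \<in> borel_measurable (lebesgue_on \<Omega>)" "AE x in lebesgue_on \<Omega>. \<rho>\<^sub>\<nu> x > 0"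
      "\<rho>\<^sub>\<nu> \<in> L1_loc \<Omega> (lebesgue_on \<Omega>)"
    and \<mu>: "\<rho>\<^sub>\<mu> \<in> borel_measurable (lebesgue_on \<Omega>)" "AE x in lebesgue_on \<Omega>. \<rho>\<^sub>\<mu> x > 0"
      "\<rho>\<^sub>\<mu> \<in> L1_loc \<Omega> (lebesgue_on \<Omega>)"
    and p: "p \<ge> 1"
  defines "\<nu> \<equiv> weighted \<Omega> \<rho>\<^sub>\<nu>" and "\<mu> \<equiv> weighted \<Omega> \<rho>\<^sub>\<mu>"
  assumes f: "f \<in> Bochner p T (V0p p \<Omega> \<nu> \<mu>) (V_norm p \<Omega> \<nu> \<mu>)"
  obtains C where "countable C" "C \<subseteq> test_functions \<Omega>"
    "AE t in lebesgue_on {0<..<T}. f t \<in> V0p p \<Omega> \<nu> \<mu> \<and>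
       (\<forall>\<epsilon>>0. \<exists>\<phi>\<in>C. Lp_norm p \<nu> (\<lambda>x. f t x - \<phi> x) < \<epsilon>
          \<and> Lp_norm 2 \<mu> (\<lambda>x. wgrad \<Omega> (f t) x - grad \<phi> x) < \<epsilon>)"
proof -
  let ?V = "V0p p \<Omega> \<nu> \<mu>" and ?N = "V_norm p \<Omega> \<nu> \<mu>" and ?M = "lebesgue_on {0<..<T}"
  have \<Omega>_sets: "\<Omega> \<in> sets lebesgue" using \<Omega> by auto
  obtain s where X: "AE t in ?M. f t \<in> ?V"
    and s: "\<And>n::nat. simple_function ?M (s n)" "\<And>n. s n ` {0<..<T} \<subseteq> ?V"
    and conv: "AE t in ?M. (\<lambda>n. ?N (\<lambda>x. s n t x - f t x)) \<longlonglongrightarrow> 0"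
    using f unfolding Bochner_def by blast
  have "\<forall>g\<in>?V. \<exists>\<phi>::nat \<Rightarrow> 'a \<Rightarrow> real. range \<phi> \<subseteq> test_functions \<Omega> \<and> (\<lambda>n. ?N (\<lambda>x. g x - \<phi> n x)) \<longlonglongrightarrow> 0"
    unfolding V0p_def by simp
  then obtain \<Phi> :: "('a \<Rightarrow> real) \<Rightarrow> nat \<Rightarrow> 'a \<Rightarrow> real" where
    \<Phi>: "\<And>g. g \<in> ?V \<Longrightarrow> range (\<Phi> g) \<subseteq> test_functions \<Omega>"
       "\<And>g. g \<in> ?V \<Longrightarrow> (\<lambda>n. ?N (\<lambda>x. g x - \<Phi> g n x)) \<longlonglongrightarrow> 0"
    unfolding bchoice_iff by blast
  define C where "C = (\<Union>n. \<Union>g\<in>s n ` {0<..<T}. range (\<Phi> g))"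
  have "finite (s n ` {0<..<T})" for n
    using simple_functionD(1)[OF s(1)[of n]] by simp
  then have C: "countable C"
    unfolding C_def by (intro countable_UN) (auto intro: countable_finite)
  have C_test: "C \<subseteq> test_functions \<Omega>"
    unfolding C_def using \<Phi>(1) s(2) by blast
  have V_D: "g \<in> W11_loc \<Omega>" "g \<in> Lp p \<nu>" "wgrad \<Omega> g \<in> Lp 2 \<mu>" if "g \<in> ?V" for g
    using that by (auto simp: V0p_def)
  note cong_\<mu> = Lp_cong_AE_weighted[OF \<Omega>_sets \<mu>(1), folded \<mu>_def]
  have diff: "(\<lambda>x. g x - h x) \<in> Lp p \<nu>"
    "wgrad \<Omega> (\<lambda>x. g x - h x) \<in> Lp 2 \<mu>"
    "AE x in lebesgue_on \<Omega>. wgrad \<Omega> (\<lambda>x. g x - h x) x = wgrad \<Omega> g x - wgrad \<Omega> h x"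
    if "g \<in> W11_loc \<Omega>" "h \<in> W11_loc \<Omega>" "g \<in> Lp p \<nu>" "h \<in> Lp p \<nu>" "wgrad \<Omega> g \<in> Lp 2 \<mu>" "wgrad \<Omega> h \<in> Lp 2 \<mu>"
    for g h
  proof -
    show "(\<lambda>x. g x - h x) \<in> Lp p \<nu>" using that p by (intro Lp_diff(1)) auto
    show ae: "AE x in lebesgue_on \<Omega>. wgrad \<Omega> (\<lambda>x. g x - h x) x = wgrad \<Omega> g x - wgrad \<Omega> h x"
      by (rule wgrad_diff[OF \<Omega> that(1,2)])
    show "wgrad \<Omega> (\<lambda>x. g x - h x) \<in> Lp 2 \<mu>"
      by (rule cong_\<mu>(1)[OF L2_diff[OF that(5,6)] ae])
  qed
  have "AE t in ?M. f t \<in> ?V \<and>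
       (\<forall>\<epsilon>>0. \<exists>\<phi>\<in>C. Lp_norm p \<nu> (\<lambda>x. f t x - \<phi> x) < \<epsilon>
          \<and> Lp_norm 2 \<mu> (\<lambda>x. wgrad \<Omega> (f t) x - grad \<phi> x) < \<epsilon>)"
    using X conv AE_space
  proof eventually_elim
    case (elim t)
    have "\<exists>\<phi>\<in>C. Lp_norm p \<nu> (\<lambda>x. f t x - \<phi> x) < \<epsilon> \<and> Lp_norm 2 \<mu> (\<lambda>x. wgrad \<Omega> (f t) x - grad \<phi> x) < \<epsilon>"
      if \<epsilon>: "\<epsilon> > 0" for \<epsilon>
    proof -
      \<comment> \<open>The quasi-triangle inequality costs a factor 2, adding up two terms at most another factor 2.\<close>
      define \<delta> where "\<delta> = \<epsilon> / 4"
      have \<delta>: "\<delta> > 0" using \<epsilon> by (simp add: \<delta>_def)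
      obtain n where n: "?N (\<lambda>x. s n t x - f t x) < \<delta>"
        using order_tendstoD(2)[OF elim(2) \<delta>] by (auto simp: eventually_sequentially)
      define g where "g = s n t"
      have t: "t \<in> {0<..<T}" using elim(3) by simp
      then have g: "g \<in> ?V" using s(2)[of n] by (auto simp: g_def)
      obtain k where k: "?N (\<lambda>x. g x - \<Phi> g k x) < \<delta>"
        using order_tendstoD(2)[OF \<Phi>(2)[OF g] \<delta>] by (auto simp: eventually_sequentially)
      define \<phi> where "\<phi> = \<Phi> g k"
      have \<phi>_C: "\<phi> \<in> C" unfolding C_def \<phi>_def g_def using t by blast
      then have \<phi>: "\<phi> \<in> test_functions \<Omega>" using C_test by auto
      have \<phi>_V: "\<phi> \<in> W11_loc \<Omega>" "\<phi> \<in> Lp p \<nu>" "grad \<phi> \<in> Lp 2 \<mu>"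
        using test_function_W11_loc[OF \<Omega> \<phi>] test_function_Lp(1)[OF \<nu> \<phi>] test_function_Lp(2)[OF \<mu> \<phi>] p
        by (auto simp: \<nu>_def \<mu>_def)
      have w\<phi>: "wgrad \<Omega> \<phi> \<in> Lp 2 \<mu>"
        by (rule cong_\<mu>(1)[OF \<phi>_V(3) wgrad_test_function[OF \<Omega> \<phi>]])
      let ?a = "\<lambda>x. g x - \<phi> x" and ?b = "\<lambda>x. g x - f t x"
      note da = diff[OF V_D(1)[OF g] \<phi>_V(1) V_D(2)[OF g] \<phi>_V(2) V_D(3)[OF g] w\<phi>]
      note db = diff[OF V_D(1)[OF g] V_D(1)[OF elim(1)] V_D(2)[OF g] V_D(2)[OF elim(1)]
          V_D(3)[OF g] V_D(3)[OF elim(1)]]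
      have N: "Lp_norm p \<nu> ?a < \<delta>" "Lp_norm 2 \<mu> (wgrad \<Omega> ?a) < \<delta>"
        "Lp_norm p \<nu> ?b < \<delta>" "Lp_norm 2 \<mu> (wgrad \<Omega> ?b) < \<delta>"
        using n k Lp_norm_nonneg[of p \<nu> ?a] Lp_norm_nonneg[of 2 \<mu> "wgrad \<Omega> ?a"]
          Lp_norm_nonneg[of p \<nu> ?b] Lp_norm_nonneg[of 2 \<mu> "wgrad \<Omega> ?b"]
        unfolding V_norm_def \<phi>_def[symmetric] g_def[symmetric] by linarith+
      have "Lp_norm p \<nu> (\<lambda>x. ?a x - ?b x) powr p \<le> 2 powr p * (Lp_norm p \<nu> ?a powr p + Lp_norm p \<nu> ?b powr p)"
        using p by (intro Lp_diff(2)[OF da(1) db(1)]) simp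
      also have "\<dots> < 2 powr p * (\<delta> powr p + \<delta> powr p)"
        using N p by (intro mult_strict_left_mono add_strict_mono powr_less_mono2) auto
      also have "\<dots> = 2 powr 1 * (2 * \<delta>) powr p"
        using \<delta> by (simp add: powr_mult)
      also have "\<dots> \<le> 2 powr p * (2 * \<delta>) powr p"
        using p by (intro mult_right_mono powr_mono) auto
      also have "\<dots> = \<epsilon> powr p"
        using \<delta> by (simp add: powr_mult[symmetric] \<delta>_def)
      finally have "Lp_norm p \<nu> (\<lambda>x. ?a x - ?b x) < \<epsilon>"
        using powr_mono2[of p \<epsilon> "Lp_norm p \<nu> (\<lambda>x. ?a x - ?b x)"] p \<epsilon> by fastforce
      then have 1: "Lp_norm p \<nu> (\<lambda>x. f t x - \<phi> x) < \<epsilon>" by simp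
      have ae: "AE x in lebesgue_on \<Omega>. wgrad \<Omega> (f t) x - grad \<phi> x = wgrad \<Omega> ?a x - wgrad \<Omega> ?b x"
        using da(3) db(3) wgrad_test_function[OF \<Omega> \<phi>] by eventually_elim simp
      have "Lp_norm 2 \<mu> (\<lambda>x. wgrad \<Omega> (f t) x - grad \<phi> x) = Lp_norm 2 \<mu> (\<lambda>x. wgrad \<Omega> ?a x - wgrad \<Omega> ?b x)"
        by (rule cong_\<mu>(2)[OF L2_diff[OF da(2) db(2)] ae])
      also have "\<dots> \<le> Lp_norm 2 \<mu> (wgrad \<Omega> ?a) + Lp_norm 2 \<mu> (wgrad \<Omega> ?b)"
        by (rule L2_triangle[OF da(2) db(2)])
      also have "\<dots> < \<epsilon>" using N(2,4) \<epsilon> unfolding \<delta>_def by linarith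
      finally show ?thesis using 1 \<phi>_C by blast
    qed
    then show ?case using elim(1) by blast
  qed
  then show thesis by (rule that[OF C C_test])
qed

lemma integrable_mult_indicator_lessThan:
  fixes f :: "real \<Rightarrow> real"
  assumes f: "integrable (lebesgue_on S) f"
  shows "integrable (lebesgue_on S) (\<lambda>t. indicator {..<s} t * f t)"
proof (rule Bochner_Integration.integrable_bound[OF f])
  have [measurable]: "(\<lambda>t. t) \<in> borel_measurable (lebesgue_on S)"
    using id_borel_measurable_lebesgue_on by (simp add: id_def)
  have [measurable]: "f \<in> borel_measurable (lebesgue_on S)" using f by auto
  have "(\<lambda>t. indicator {..<s} t * f t) = (\<lambda>t. if t < s then f t else 0)"
    by (auto simp: fun_eq_iff indicator_def)
  also have "\<dots> \<in> borel_measurable (lebesgue_on S)" by measurable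
  finally show "(\<lambda>t. indicator {..<s} t * f t) \<in> borel_measurable (lebesgue_on S)" .
qed (auto simp: indicator_def)

text \<open>Both terms of the identity are continuous in the pair \<open>(\<phi>, grad \<phi>)\<close> for the norms of \<open>L\<^sup>p(\<nu>)\<close> and
  \<open>L\<^sup>2(\<mu>)\<close>, by Hoelder's inequality in space and by integrability in time of the norm of \<open>F t\<close>.\<close>

lemma test_with_energy_function:
  fixes w f :: "'a::euclidean_space \<Rightarrow> real" and Df :: "'a \<Rightarrow> 'a"
  assumes F: "F \<in> Bochner 2 T (Lp 2 \<mu>) (Lp_norm 2 \<mu>)"
    and w: "w \<in> Lp q \<nu>" and pq: "p > 1" "q > 1" "1 / p + 1 / q = 1"
    and f: "f \<in> Lp p \<nu>" "Df \<in> Lp 2 \<mu>"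
    and C: "\<And>\<phi>. \<phi> \<in> C \<Longrightarrow> \<phi> \<in> Lp p \<nu>" "\<And>\<phi>. \<phi> \<in> C \<Longrightarrow> grad \<phi> \<in> Lp 2 \<mu>"
    and approx: "\<And>\<epsilon>. \<epsilon> > 0 \<Longrightarrow> \<exists>\<phi>\<in>C. Lp_norm p \<nu> (\<lambda>x. f x - \<phi> x) < \<epsilon> \<and> Lp_norm 2 \<mu> (\<lambda>x. Df x - grad \<phi> x) < \<epsilon>"
    and eq: "\<And>\<phi>. \<phi> \<in> C \<Longrightarrow> (LINT x|\<nu>. w x * \<phi> x)
        + (LINT t|lebesgue_on {0<..<T}. indicator {..<s} t * L2_inner \<mu> (F t) (grad \<phi>)) = 0"
  shows "(LINT x|\<nu>. w x * f x)
        + (LINT t|lebesgue_on {0<..<T}. indicator {..<s} t * L2_inner \<mu> (F t) Df) = 0"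
proof -
  define M where "M = lebesgue_on {0<..<T}"
  define I where "I g = (LINT t|M. indicator {..<s} t * L2_inner \<mu> (F t) g)" for g
  define B where "B = Lp_norm q \<nu> w + (LINT t|M. Lp_norm 2 \<mu> (F t))"
  have F_Lp: "AE t in M. F t \<in> Lp 2 \<mu>" using F unfolding Bochner_def M_def by blast
  have NF: "integrable M (\<lambda>t. Lp_norm 2 \<mu> (F t))"
    unfolding M_def
    by (rule Bochner_functional_integrable[OF F, where C = 1]) (auto simp: L2_norm_diff_le)
  have B: "B \<ge> 0"
    unfolding B_def by (intro add_nonneg_nonneg Bochner_Integration.integral_nonneg) auto
  have int_I: "integrable M (\<lambda>t. indicator {..<s} t * L2_inner \<mu> (F t) g)" if "g \<in> Lp 2 \<mu>" for g
    unfolding M_def by (intro integrable_mult_indicator_lessThan Bochner_L2_inner_integrable[OF F] that) simp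
  have w_int: "integrable \<nu> (\<lambda>x. w x * g x)"
    and w_le: "\<bar>LINT x|\<nu>. w x * g x\<bar> \<le> Lp_norm q \<nu> w * Lp_norm p \<nu> g" if "g \<in> Lp p \<nu>" for g
    using Hoelder[OF w that pq(2,1)] pq(3) by (simp_all add: add.commute)
  have le: "\<bar>(LINT x|\<nu>. w x * f x) + I Df\<bar> \<le> \<epsilon> * B" if \<epsilon>: "\<epsilon> > 0" for \<epsilon>
  proof -
    obtain \<phi> where \<phi>: "\<phi> \<in> C" "Lp_norm p \<nu> (\<lambda>x. f x - \<phi> x) < \<epsilon>" "Lp_norm 2 \<mu> (\<lambda>x. Df x - grad \<phi> x) < \<epsilon>"
      using approx[OF \<epsilon>] by blast
    let ?g = "\<lambda>x. f x - \<phi> x" and ?h = "\<lambda>x. Df x - grad \<phi> x"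
    have g: "?g \<in> Lp p \<nu>" using f(1) C(1)[OF \<phi>(1)] pq(1) by (intro Lp_diff(1)) auto
    have h: "?h \<in> Lp 2 \<mu>" by (rule L2_diff[OF f(2) C(2)[OF \<phi>(1)]])
    have 1: "(LINT x|\<nu>. w x * f x) - (LINT x|\<nu>. w x * \<phi> x) = (LINT x|\<nu>. w x * ?g x)"
      using w_int[OF f(1)] w_int[OF C(1)[OF \<phi>(1)]] by (simp add: right_diff_distrib)
    have "I ?h = (LINT t|M. indicator {..<s} t * L2_inner \<mu> (F t) Df - indicator {..<s} t * L2_inner \<mu> (F t) (grad \<phi>))"
      unfolding I_def
    proof (rule integral_cong_AE)
      show "AE t in M. indicator {..<s} t * L2_inner \<mu> (F t) ?h
          = indicator {..<s} t * L2_inner \<mu> (F t) Df - indicator {..<s} t * L2_inner \<mu> (F t) (grad \<phi>)"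
        using F_Lp
        by eventually_elim (simp add: L2_inner_diff_right f(2) C(2)[OF \<phi>(1)] right_diff_distrib)
    qed (use int_I[OF h] int_I[OF f(2)] int_I[OF C(2)[OF \<phi>(1)]] in \<open>auto intro: borel_measurable_integrable\<close>)
    then have 2: "I Df - I (grad \<phi>) = I ?h"
      using int_I[OF f(2)] int_I[OF C(2)[OF \<phi>(1)]] by (simp add: I_def)
    have "\<bar>I ?h\<bar> \<le> (LINT t|M. \<bar>indicator {..<s} t * L2_inner \<mu> (F t) ?h\<bar>)"
      unfolding I_def using integral_norm_bound[of M "\<lambda>t. indicator {..<s} t * L2_inner \<mu> (F t) ?h"] by simp
    also have "\<dots> \<le> (LINT t|M. Lp_norm 2 \<mu> (F t) * \<epsilon>)"
    proof (rule integral_mono_AE)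
      show "integrable M (\<lambda>t. \<bar>indicator {..<s} t * L2_inner \<mu> (F t) ?h\<bar>)"
        by (rule integrable_abs[OF int_I[OF h]])
      show "integrable M (\<lambda>t. Lp_norm 2 \<mu> (F t) * \<epsilon>)" using NF by simp
      show "AE t in M. \<bar>indicator {..<s} t * L2_inner \<mu> (F t) ?h\<bar> \<le> Lp_norm 2 \<mu> (F t) * \<epsilon>"
        using F_Lp
      proof eventually_elim
        case (elim t)
        have "\<bar>indicator {..<s} t * L2_inner \<mu> (F t) ?h\<bar> \<le> \<bar>L2_inner \<mu> (F t) ?h\<bar>"
          by (simp add: indicator_def)
        also have "\<dots> \<le> Lp_norm 2 \<mu> (F t) * Lp_norm 2 \<mu> ?h"
          by (rule L2_Cauchy_Schwarz[OF elim h])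
        also have "\<dots> \<le> Lp_norm 2 \<mu> (F t) * \<epsilon>"
          using \<phi>(3) by (intro mult_left_mono) auto
        finally show ?case .
      qed
    qed
    finally have 3: "\<bar>I ?h\<bar> \<le> \<epsilon> * (LINT t|M. Lp_norm 2 \<mu> (F t))" by (simp add: mult.commute)
    have "\<bar>LINT x|\<nu>. w x * ?g x\<bar> \<le> Lp_norm q \<nu> w * Lp_norm p \<nu> ?g" by (rule w_le[OF g])
    also have "\<dots> \<le> Lp_norm q \<nu> w * \<epsilon>" using \<phi>(2) by (intro mult_left_mono) auto
    finally have 4: "\<bar>LINT x|\<nu>. w x * ?g x\<bar> \<le> \<epsilon> * Lp_norm q \<nu> w" by (simp add: mult.commute)
    have "(LINT x|\<nu>. w x * f x) + I Df = (LINT x|\<nu>. w x * ?g x) + I ?h"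
      using eq[OF \<phi>(1)] 1 2 by (simp add: I_def M_def)
    then show ?thesis using 3 4 by (simp add: B_def distrib_left)
  qed
  have "\<bar>(LINT x|\<nu>. w x * f x) + I Df\<bar> \<le> 0"
  proof (rule field_le_epsilon)
    fix e :: real assume e: "e > 0"
    have "\<bar>(LINT x|\<nu>. w x * f x) + I Df\<bar> \<le> e / (B + 1) * B"
      using B e by (intro le) simp
    also have "\<dots> \<le> e" using B e by (simp add: field_simps)
    finally show "\<bar>(LINT x|\<nu>. w x * f x) + I Df\<bar> \<le> 0 + e" by simp
  qed
  then show ?thesis by (simp add: I_def M_def)
qed

section \<open>Signed powers\<close>

lemma abs_spow: "\<bar>spow x q\<bar> = \<bar>x\<bar> powr q"
  by (cases "x = 0") (simp_all add: spow_def abs_mult)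

lemma spow_inverse: "q > 0 \<Longrightarrow> spow (spow x q) (1 / q) = x"
  by (cases "x = 0") (auto simp: spow_def abs_mult sgn_mult powr_powr abs_mult_sgn)

lemma spow_strict_mono:
  assumes "q > 0" "a < b"
  shows "spow a q < spow b q"
proof (cases "0 \<le> a")
  case True
  then show ?thesis
    using assms powr_less_mono2[of q a b] by (auto simp: spow_def sgn_if)
next
  case False
  show ?thesis
  proof (cases "b \<ge> 0")
    case True
    have "spow a q < 0" using False by (simp add: spow_def)
    also have "0 \<le> spow b q" using True by (simp add: spow_def)
    finally show ?thesis .
  next
    case b: False
    then show ?thesis
      using False assms powr_less_mono2[of q "- b" "- a"] by (simp add: spow_def)
  qed
qed

lemma diff_mult_spow_diff:
  assumes "q > 0"
  shows "0 \<le> (a - b) * (spow a q - spow b q)" "(a - b) * (spow a q - spow b q) = 0 \<longleftrightarrow> a = b"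
proof -
  consider "a = b" | "a < b" | "b < a" by linarith
  then have "0 \<le> (a - b) * (spow a q - spow b q) \<and> ((a - b) * (spow a q - spow b q) = 0 \<longleftrightarrow> a = b)"
  proof cases
    case 2
    with spow_strict_mono[OF assms 2] show ?thesis by (auto simp: mult_nonpos_nonpos)
  next
    case 3
    with spow_strict_mono[OF assms 3] show ?thesis by auto
  qed simp
  then show "0 \<le> (a - b) * (spow a q - spow b q)" "(a - b) * (spow a q - spow b q) = 0 \<longleftrightarrow> a = b"
    by auto
qed

lemma borel_measurable_spow [measurable]: "(\<lambda>x. spow x q) \<in> borel_measurable borel"
  unfolding spow_def by measurable

text \<open>The exponents \<open>m + 1\<close> and \<open>(m + 1) / m\<close> are conjugate, so the energy class puts \<open>u t\<close> into the dual
  of the space that contains \<open>u\<^sup>m\<close>.\<close>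

lemma Lp_spow_imp_Lp:
  assumes m: "m > 0" and um: "(\<lambda>x. spow (u x) m) \<in> Lp ((m + 1) / m) M"
  shows "u \<in> Lp (m + 1) M"
proof -
  have "(\<lambda>x. spow (u x) m) \<in> borel_measurable M" using um by (simp add: Lp_def)
  then have "(\<lambda>x. spow (spow (u x) m) (1 / m)) \<in> borel_measurable M"
    by (rule measurable_compose) measurable
  then have "u \<in> borel_measurable M" using m by (simp add: spow_inverse)
  moreover have "integrable M (\<lambda>x. norm (u x) powr (m + 1))"
    using um m by (simp add: Lp_def abs_spow powr_powr)
  ultimately show ?thesis by (simp add: Lp_def)
qed

section \<open>Uniqueness\<close>

text \<open>For almost every time \<open>s\<close> the identity tested with \<open>u\<^sup>m(s) - v\<^sup>m(s)\<close> equates the nonnegative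
  \<open>\<integral> (u - v) (u\<^sup>m - v\<^sup>m) d\<nu>\<close> with \<open>- J s\<close>. The time integral of \<open>J\<close> being nonnegative, both vanish.\<close>

lemma weak_solutions_agree_before:
  fixes m T :: real and \<Omega> :: "'a::euclidean_space set"
  assumes m: "m > 1" and \<Omega>: "open \<Omega>" and T: "T > 0"
    and \<nu>: "\<rho>\<^sub>\<nu> \<in> borel_measurable (lebesgue_on \<Omega>)" "AE x in lebesgue_on \<Omega>. \<rho>\<^sub>\<nu> x > 0"
      "\<rho>\<^sub>\<nu> \<in> L1_loc \<Omega> (lebesgue_on \<Omega>)"
    and \<mu>: "\<rho>\<^sub>\<mu> \<in> borel_measurable (lebesgue_on \<Omega>)" "AE x in lebesgue_on \<Omega>. \<rho>\<^sub>\<mu> x > 0"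
      "\<rho>\<^sub>\<mu> \<in> L1_loc \<Omega> (lebesgue_on \<Omega>)"
    and u: "weak_solution m \<Omega> \<rho>\<^sub>\<nu> \<rho>\<^sub>\<mu> u\<^sub>0 u" "energy_class m \<Omega> \<rho>\<^sub>\<nu> \<rho>\<^sub>\<mu> u"
    and v: "weak_solution m \<Omega> \<rho>\<^sub>\<nu> \<rho>\<^sub>\<mu> u\<^sub>0 v" "energy_class m \<Omega> \<rho>\<^sub>\<nu> \<rho>\<^sub>\<mu> v"
  shows "AE t in lebesgue_on {0<..<T}. AE x in lebesgue_on \<Omega>. u t x = v t x"
proof -
  define \<nu> \<mu> where "\<nu> = weighted \<Omega> \<rho>\<^sub>\<nu>" and "\<mu> = weighted \<Omega> \<rho>\<^sub>\<mu>"
  define p where "p = (m + 1) / m"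
  define M where "M = lebesgue_on {0<..<T}"
  define um vm where "um t x = spow (u t x) m" and "vm t x = spow (v t x) m" for t x
  define Du Dv where "Du t = wgrad \<Omega> (um t)" and "Dv t = wgrad \<Omega> (vm t)" for t
  define F where "F = (\<lambda>t x. Du t x - Dv t x)"
  have p: "p > 1" "m + 1 > 1" "1 / p + 1 / (m + 1) = 1"
    using m by (auto simp: p_def field_simps)
  have Bu: "um \<in> Bochner p T (V0p p \<Omega> \<nu> \<mu>) (V_norm p \<Omega> \<nu> \<mu>)" "Du \<in> Bochner 2 T (Lp 2 \<mu>) (Lp_norm 2 \<mu>)"
    using u(2) T unfolding energy_class_def Let_def um_def[abs_def] Du_def[abs_def] \<nu>_def \<mu>_def p_def by blast+
  have Bv: "vm \<in> Bochner p T (V0p p \<Omega> \<nu> \<mu>) (V_norm p \<Omega> \<nu> \<mu>)" "Dv \<in> Bochner 2 T (Lp 2 \<mu>) (Lp_norm 2 \<mu>)"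
    using v(2) T unfolding energy_class_def Let_def vm_def[abs_def] Dv_def[abs_def] \<nu>_def \<mu>_def p_def by blast+
  have F: "F \<in> Bochner 2 T (Lp 2 \<mu>) (Lp_norm 2 \<mu>)"
    unfolding F_def by (rule Bochner_L2_diff[OF Bu(2) Bv(2)])
  have Du_Lp: "AE t in M. Du t \<in> Lp 2 \<mu>" and Dv_Lp: "AE t in M. Dv t \<in> Lp 2 \<mu>"
    and F_Lp: "AE t in M. F t \<in> Lp 2 \<mu>"
    using Bu(2) Bv(2) F unfolding Bochner_def M_def by blast+
  let ?good = "\<lambda>f C. f \<in> V0p p \<Omega> \<nu> \<mu> \<and>
     (\<forall>\<epsilon>>0. \<exists>\<phi>\<in>C. Lp_norm p \<nu> (\<lambda>x. f x - \<phi> x) < \<epsilon> \<and> Lp_norm 2 \<mu> (\<lambda>x. wgrad \<Omega> f x - grad \<phi> x) < \<epsilon>)"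
  have p1: "p \<ge> 1" using p by simp
  note approximants = V0p_Bochner_countable_approximants[OF \<Omega> \<nu> \<mu> p1, folded \<nu>_def \<mu>_def]
  obtain Cu where Cu: "countable Cu" "Cu \<subseteq> test_functions \<Omega>" "AE t in M. ?good (um t) Cu"
    unfolding M_def by (rule approximants[OF Bu(1)])
  obtain Cv where Cv: "countable Cv" "Cv \<subseteq> test_functions \<Omega>" "AE t in M. ?good (vm t) Cv"
    unfolding M_def by (rule approximants[OF Bv(1)])
  have C_Lp: "\<phi> \<in> Lp p \<nu>" "grad \<phi> \<in> Lp 2 \<mu>" if "\<phi> \<in> test_functions \<Omega>" for \<phi>
    using test_function_Lp(1)[OF \<nu> that, of p] test_function_Lp(2)[OF \<mu> that, of 2] p
    by (auto simp: \<nu>_def \<mu>_def)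
  have identity: "AE s in M. ((LINT x|\<nu>. u s x * \<phi> x) - (LINT x|\<nu>. v s x * \<phi> x))
      + (LINT t|M. indicator {..<s} t * L2_inner \<mu> (F t) (grad \<phi>)) = 0"
    if \<phi>: "\<phi> \<in> test_functions \<Omega>" for \<phi>
  proof -
    have int: "integrable M (\<lambda>t. L2_inner \<mu> (Du t) (grad \<phi>))" "integrable M (\<lambda>t. L2_inner \<mu> (Dv t) (grad \<phi>))"
      "integrable M (\<lambda>t. L2_inner \<mu> (F t) (grad \<phi>))"
      unfolding M_def by (rule Bochner_L2_inner_integrable[OF Bu(2)] Bochner_L2_inner_integrable[OF Bv(2)]
          Bochner_L2_inner_integrable[OF F]; simp add: C_Lp(2)[OF \<phi>])+
    have "(LINT t|M. indicator {..<s} t * (L2_inner \<mu> (Du t) (grad \<phi>) - L2_inner \<mu> (Dv t) (grad \<phi>)))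
        = (LINT t|M. indicator {..<s} t * L2_inner \<mu> (F t) (grad \<phi>))" for s
    proof (rule integral_cong_AE)
      show "(\<lambda>t. indicator {..<s} t * (L2_inner \<mu> (Du t) (grad \<phi>) - L2_inner \<mu> (Dv t) (grad \<phi>))) \<in> borel_measurable M"
        "(\<lambda>t. indicator {..<s} t * L2_inner \<mu> (F t) (grad \<phi>)) \<in> borel_measurable M"
        using int[THEN integrable_mult_indicator_lessThan[of "{0<..<T}", folded M_def], of s]
        by (auto simp: right_diff_distrib intro!: borel_measurable_diff)
      show "AE t in M. indicator {..<s} t * (L2_inner \<mu> (Du t) (grad \<phi>) - L2_inner \<mu> (Dv t) (grad \<phi>))
          = indicator {..<s} t * L2_inner \<mu> (F t) (grad \<phi>)"
        using Du_Lp Dv_Lp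
        by eventually_elim (simp add: F_def L2_inner_diff_left C_Lp(2)[OF \<phi>])
    qed
    then show ?thesis
      using weak_solutions_time_integrated[OF u(1) v(1) T \<Omega> \<mu> \<phi>]
      unfolding M_def \<nu>_def \<mu>_def Du_def[abs_def] Dv_def[abs_def] um_def[abs_def] vm_def[abs_def]
      by simp
  qed
  have identities: "AE s in M. \<forall>\<phi>\<in>Cu \<union> Cv. ((LINT x|\<nu>. u s x * \<phi> x) - (LINT x|\<nu>. v s x * \<phi> x))
      + (LINT t|M. indicator {..<s} t * L2_inner \<mu> (F t) (grad \<phi>)) = 0"
  proof (subst AE_ball_countable)
    show "countable (Cu \<union> Cv)" using Cu(1) Cv(1) by simp
    show "\<forall>\<phi>\<in>Cu \<union> Cv. AE s in M. ((LINT x|\<nu>. u s x * \<phi> x) - (LINT x|\<nu>. v s x * \<phi> x))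
      + (LINT t|M. indicator {..<s} t * L2_inner \<mu> (F t) (grad \<phi>)) = 0"
      using identity Cu(2) Cv(2) by blast
  qed
  obtain J where J: "integrable M J" "0 \<le> (LINT s|M. J s)"
    "AE s in M. J s = (LINT t|M. indicator {..<s} t * L2_inner \<mu> (F t) (F s))"
    unfolding M_def by (rule L2_time_ordered_integral_nonneg[OF F])
  define z where "z s x = (u s x - v s x) * (um s x - vm s x)" for s x
  have energy: "AE s in M. integrable \<nu> (z s) \<and> (LINT x|\<nu>. z s x) = - J s"
    using Cu(3) Cv(3) identities J(3)
  proof eventually_elim
    case (elim s)
    have V: "um s \<in> Lp p \<nu>" "vm s \<in> Lp p \<nu>" "Du s \<in> Lp 2 \<mu>" "Dv s \<in> Lp 2 \<mu>"
      using elim(1,2) by (auto simp: V0p_def Du_def Dv_def)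
    have uv: "u s \<in> Lp (m + 1) \<nu>" "v s \<in> Lp (m + 1) \<nu>"
      using V(1,2) m unfolding p_def um_def[abs_def] vm_def[abs_def] by (auto intro: Lp_spow_imp_Lp)
    let ?w = "\<lambda>x. u s x - v s x"
    have w: "?w \<in> Lp (m + 1) \<nu>"
      using m by (intro Lp_diff(1)[OF uv]) simp
    have pair: "integrable \<nu> (\<lambda>x. f x * g x)" if "f \<in> Lp (m + 1) \<nu>" "g \<in> Lp p \<nu>" for f g :: "'a \<Rightarrow> real"
      using Hoelder(1)[OF that p(2,1)] p(3) by (simp add: add.commute)
    have eq: "(LINT x|\<nu>. ?w x * \<phi> x) + (LINT t|M. indicator {..<s} t * L2_inner \<mu> (F t) (grad \<phi>)) = 0"
      if "\<phi> \<in> Cu \<union> Cv" for \<phi>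
    proof -
      have "\<phi> \<in> test_functions \<Omega>" using that Cu(2) Cv(2) by blast
      then have "(LINT x|\<nu>. ?w x * \<phi> x) = (LINT x|\<nu>. u s x * \<phi> x) - (LINT x|\<nu>. v s x * \<phi> x)"
        using pair[OF uv(1) C_Lp(1)] pair[OF uv(2) C_Lp(1)] by (simp add: left_diff_distrib)
      then show ?thesis using elim(3) that by simp
    qed
    have eq_u: "(LINT x|\<nu>. ?w x * um s x) + (LINT t|M. indicator {..<s} t * L2_inner \<mu> (F t) (Du s)) = 0"
      unfolding M_def
    proof (rule test_with_energy_function[OF F w p V(1,3), where C = Cu])
      show "\<phi> \<in> Lp p \<nu>" "grad \<phi> \<in> Lp 2 \<mu>" if "\<phi> \<in> Cu" for \<phi>
        using C_Lp Cu(2) that by blast+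
      show "\<exists>\<phi>\<in>Cu. Lp_norm p \<nu> (\<lambda>x. um s x - \<phi> x) < \<epsilon> \<and> Lp_norm 2 \<mu> (\<lambda>x. Du s x - grad \<phi> x) < \<epsilon>"
        if "\<epsilon> > 0" for \<epsilon>
        using elim(1) that unfolding Du_def by blast
    qed (use eq in \<open>simp add: M_def\<close>)
    have eq_v: "(LINT x|\<nu>. ?w x * vm s x) + (LINT t|M. indicator {..<s} t * L2_inner \<mu> (F t) (Dv s)) = 0"
      unfolding M_def
    proof (rule test_with_energy_function[OF F w p V(2,4), where C = Cv])
      show "\<phi> \<in> Lp p \<nu>" "grad \<phi> \<in> Lp 2 \<mu>" if "\<phi> \<in> Cv" for \<phi>
        using C_Lp Cv(2) that by blast+
      show "\<exists>\<phi>\<in>Cv. Lp_norm p \<nu> (\<lambda>x. vm s x - \<phi> x) < \<epsilon> \<and> Lp_norm 2 \<mu> (\<lambda>x. Dv s x - grad \<phi> x) < \<epsilon>"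
        if "\<epsilon> > 0" for \<epsilon>
        using elim(2) that unfolding Dv_def by blast
    qed (use eq in \<open>simp add: M_def\<close>)
    have Fs: "F s \<in> Lp 2 \<mu>" unfolding F_def by (rule L2_diff[OF V(3,4)])
    have int: "integrable M (\<lambda>t. indicator {..<s} t * L2_inner \<mu> (F t) g)" if "g \<in> Lp 2 \<mu>" for g
      unfolding M_def by (intro integrable_mult_indicator_lessThan Bochner_L2_inner_integrable[OF F] that) simp
    have "J s = (LINT t|M. indicator {..<s} t * L2_inner \<mu> (F t) (Du s) - indicator {..<s} t * L2_inner \<mu> (F t) (Dv s))"
      unfolding elim(4)
    proof (rule integral_cong_AE)
      show "AE t in M. indicator {..<s} t * L2_inner \<mu> (F t) (F s)
          = indicator {..<s} t * L2_inner \<mu> (F t) (Du s) - indicator {..<s} t * L2_inner \<mu> (F t) (Dv s)"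
        using F_Lp
        by eventually_elim (simp add: F_def[THEN fun_cong, of s] L2_inner_diff_right V(3,4) right_diff_distrib)
    qed (use int[OF Fs] int[OF V(3)] int[OF V(4)] in \<open>auto intro: borel_measurable_integrable\<close>)
    also have "\<dots> = - (LINT x|\<nu>. ?w x * um s x) + (LINT x|\<nu>. ?w x * vm s x)"
      using int[OF V(3)] int[OF V(4)] eq_u eq_v by simp
    finally have "(LINT x|\<nu>. ?w x * um s x) - (LINT x|\<nu>. ?w x * vm s x) = - J s" by simp
    then show ?case
      using pair[OF w V(1)] pair[OF w V(2)] by (simp add: z_def[abs_def] right_diff_distrib)
  qed
  have z: "0 \<le> z s x" "z s x = 0 \<longleftrightarrow> u s x = v s x" for s x
    using diff_mult_spow_diff[of m "u s x" "v s x"] m by (simp_all add: z_def um_def vm_def)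
  have J_nonpos: "AE s in M. 0 \<le> - J s"
    using energy
  proof eventually_elim
    case (elim s)
    have "0 \<le> (LINT x|\<nu>. z s x)" by (rule Bochner_Integration.integral_nonneg) (rule z(1))
    then show ?case using elim by simp
  qed
  then have "0 \<le> (LINT s|M. - J s)" by (rule integral_nonneg_AE)
  then have "(LINT s|M. - J s) = 0" using J(2) by simp
  then have "AE s in M. - J s = 0"
    using J(1) J_nonpos by (subst (asm) integral_nonneg_eq_0_iff_AE) auto
  then have "AE s in M. AE x in lebesgue_on \<Omega>. u s x = v s x"
    using energy
  proof eventually_elim
    case (elim s)
    then have "AE x in \<nu>. z s x = 0"
      using integral_nonneg_eq_0_iff_AE[of \<nu> "z s"] z(1) by auto
    then have "AE x in lebesgue_on \<Omega>. z s x = 0"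
      unfolding \<nu>_def by (rule AE_weightedD[OF \<nu>(1,2)])
    then show ?case by (simp add: z(2))
  qed
  then show ?thesis unfolding M_def .
qed

theorem proposition3p2:
  fixes m :: real
    and \<Omega> :: "'a::euclidean_space set"
    and \<rho>\<^sub>\<nu> \<rho>\<^sub>\<mu> u\<^sub>0 :: "'a \<Rightarrow> real"
    and u v :: "real \<Rightarrow> 'a \<Rightarrow> real"
  assumes "m > 1"
    and "open \<Omega>" "connected \<Omega>" "\<Omega> \<noteq> {}"
    and "\<rho>\<^sub>\<nu> \<in> borel_measurable (lebesgue_on \<Omega>)" "\<rho>\<^sub>\<mu> \<in> borel_measurable (lebesgue_on \<Omega>)"
    and "AE x in lebesgue_on \<Omega>. \<rho>\<^sub>\<nu> x > 0" "AE x in lebesgue_on \<Omega>. \<rho>\<^sub>\<mu> x > 0"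
    and "\<rho>\<^sub>\<nu> \<in> L1_loc \<Omega> (lebesgue_on \<Omega>)" "\<rho>\<^sub>\<mu> \<in> L1_loc \<Omega> (lebesgue_on \<Omega>)"
    and "(\<lambda>x. inverse (\<rho>\<^sub>\<mu> x)) \<in> L1_loc \<Omega> (lebesgue_on \<Omega>)"
    and "u\<^sub>0 \<in> L1_loc \<Omega> (weighted \<Omega> \<rho>\<^sub>\<nu>)"
    and "weak_solution m \<Omega> \<rho>\<^sub>\<nu> \<rho>\<^sub>\<mu> u\<^sub>0 u" "energy_class m \<Omega> \<rho>\<^sub>\<nu> \<rho>\<^sub>\<mu> u"
    and "weak_solution m \<Omega> \<rho>\<^sub>\<nu> \<rho>\<^sub>\<mu> u\<^sub>0 v" "energy_class m \<Omega> \<rho>\<^sub>\<nu> \<rho>\<^sub>\<mu> v"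
  shows "AE t in lebesgue_on {0<..}. AE x in lebesgue_on \<Omega>. u t x = v t x"
proof -
  have before: "AE t in lebesgue. t \<in> {0<..<real (Suc n)} \<longrightarrow> (AE x in lebesgue_on \<Omega>. u t x = v t x)" for n
  proof -
    have "AE t in lebesgue_on {0<..<real (Suc n)}. AE x in lebesgue_on \<Omega>. u t x = v t x"
      by (rule weak_solutions_agree_before) (use assms in auto)
    then show ?thesis by (subst (asm) AE_restrict_space_iff) auto
  qed
  have "AE t in lebesgue. \<forall>n. t \<in> {0<..<real (Suc n)} \<longrightarrow> (AE x in lebesgue_on \<Omega>. u t x = v t x)"
    unfolding AE_all_countable using before by (rule allI)
  then have "AE t in lebesgue. t \<in> {0<..} \<longrightarrow> (AE x in lebesgue_on \<Omega>. u t x = v t x)"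
  proof eventually_elim
    case (elim t)
    obtain n where "t < real n" using reals_Archimedean2 by blast
    then show ?case using elim[rule_format, of n] by auto
  qed
  then show ?thesis by (subst AE_restrict_space_iff) auto
qed

end
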